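(* Let $\omega_0\in L^1(\mathbb R^2)\cap L^\infty(\mathbb R^2)$ and let $\eta$ be the flow map of the Euler equation with initial vorticity $\omega_0$. Suppose that $\omega_0$ is approximated by a sequence of measures $q_0^n\in\mathcal M(\mathbb R^2)$ such that $q_0^n\rightharpoonup\omega_0$ weakly in $\mathcal M(\mathbb R^2)$ and $\|q_0^n\|_{\mathcal M}\to\|\omega_0\|_{L^1}$ as $n\to\infty$. Then for every $T>0$ there exists a sequence $\{\alpha_n\}$ of positive numbers converging to zero as $n\to\infty$ such that, when $\eta^{\alpha_n}$ denotes the flow map of the vortex method with $\alpha=\alpha_n$ and initial data $q_0^n$, $$\lim_{n\to\infty}\ \sup_{t\in[0,T]}\ \sup_{x\in\mathbb R^2}\bigl|\eta^{\alpha_n}(x,t)-\eta(x,t)\bigr|=0.$$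
   Context: $\mathcal M(\mathbb R^2)$ is the space of finite signed Radon measures on $\mathbb R^2$ with total variation norm $\|\cdot\|_{\mathcal M}$; weak convergence in $\mathcal M(\mathbb R^2)$ means convergence tested against continuous functions on $\mathbb R^2$ vanishing at infinity. A function $\omega_0\in L^1$ is identified with the measure $\omega_0\,dx$. $\mathcal G$ is the group of homeomorphisms of $\mathbb R^2$ preserving Lebesgue measure, and $\nabla^\perp=(-\partial_2,\partial_1)$. Euler flow map: with $K(x,y)=\frac1{2\pi}\nabla_x^\perp\log|x-y|$, $\eta$ is the unique solution, with $\eta(\cdot,t)\in\mathcal G$, of $$\partial_t\eta(x,t)=\int_{\mathbb R^2}K(\eta(x,t),\eta(y,t))\,\omega_0(y)\,dy,\qquad\eta(x,0)=x.$$ Flow map of the vortex method: for $\alpha>0$ let $K^\alpha(x,y)=\nabla_x^\perp G^\alpha(|x-y|)$ with $$G^\alpha(r)=\frac1{2\pi}K_0\Big(\frac r\alpha\Big)+\frac1{2\pi}\ln r,$$ $K_0$ being the modified Bessel function of the second kind of order zero, and $K^\alpha(x,x)=0$ (continuous extension). The flow map $\eta^\alpha$ of the vortex method with parameter $\alpha$ and initial data $q_0\in\mathcal M(\mathbb R^2)$ is the unique solution, with $\eta^\alpha(\cdot,t)\in\mathcal G$, of $$\partial_t\eta^\alpha(x,t)=\int_{\mathbb R^2}K^\alpha(\eta^\alpha(x,t),\eta^\alpha(y,t))\,dq_0(y),\qquad\eta^\alpha(x,0)=x.$$ *)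

theory Defs
  imports "HOL-Analysis.Analysis"
begin

text \<open>
  A finite signed Borel measure is a real-valued, countably additive set function; only its values
  on Borel sets matter. On \<open>\<real>\<^sup>2\<close> such a measure is automatically Radon and of finite total
  variation, so neither property is demanded separately.
\<close>

definition signed_measure :: "('a::topological_space set \<Rightarrow> real) \<Rightarrow> bool" where
  "signed_measure q \<longleftrightarrow>
     q {} = 0 \<and>
     (\<forall>A :: nat \<Rightarrow> 'a set. range A \<subseteq> sets borel \<longrightarrow> disjoint_family A \<longrightarrow>
        (\<lambda>n. q (A n)) sums q (\<Union>n. A n))"

text \<open>
  The upper and lower variations, i.e. the two parts of the Jordan decomposition. Negative values
  of \<open>q\<close> are cut off by \<^const>\<open>ennreal\<close>, which is harmless because \<open>B = {}\<close> takes part in the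
  supremum.
\<close>

definition pos_variation :: "('a::topological_space set \<Rightarrow> real) \<Rightarrow> 'a measure" where
  "pos_variation q =
     measure_of UNIV (sets borel) (\<lambda>A. SUP B \<in> {B \<in> sets borel. B \<subseteq> A}. ennreal (q B))"

definition neg_variation :: "('a::topological_space set \<Rightarrow> real) \<Rightarrow> 'a measure" where
  "neg_variation q = pos_variation (\<lambda>A. - q A)"

definition tv_norm :: "('a::topological_space set \<Rightarrow> real) \<Rightarrow> real" where
  "tv_norm q = measure (pos_variation q) UNIV + measure (neg_variation q) UNIV"

definition signed_integral ::
  "('a::topological_space set \<Rightarrow> real) \<Rightarrow> ('a \<Rightarrow> 'b::{banach, second_countable_topology}) \<Rightarrow> 'b" where
  "signed_integral q f = (LINT x|pos_variation q. f x) - (LINT x|neg_variation q. f x)"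

definition density_measure :: "('a::euclidean_space \<Rightarrow> real) \<Rightarrow> 'a set \<Rightarrow> real" where
  "density_measure w A = (LINT x:A|lborel. w x)"

definition weakly_converges ::
  "(nat \<Rightarrow> 'a::real_normed_vector set \<Rightarrow> real) \<Rightarrow> ('a set \<Rightarrow> real) \<Rightarrow> bool" where
  "weakly_converges q m \<longleftrightarrow>
     (\<forall>\<phi> :: 'a \<Rightarrow> real. continuous_on UNIV \<phi> \<longrightarrow> (\<phi> \<longlongrightarrow> 0) at_infinity \<longrightarrow>
        (\<lambda>n. signed_integral (q n) \<phi>) \<longlonglongrightarrow> signed_integral m \<phi>)"

definition in_L1_Linf :: "('a::euclidean_space \<Rightarrow> real) \<Rightarrow> bool" where
  "in_L1_Linf w \<longleftrightarrow> integrable lborel w \<and> (\<exists>C. AE x in lborel. \<bar>w x\<bar> \<le> C)"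

definition measure_preserving_homeos :: "('a::euclidean_space \<Rightarrow> 'a) set" where
  "measure_preserving_homeos =
     {g. (\<exists>h. homeomorphism UNIV UNIV g h) \<and> distr lborel borel g = lborel}"

definition nabla_perp :: "(real^2 \<Rightarrow> real) \<Rightarrow> real^2 \<Rightarrow> real^2" where
  "nabla_perp f x =
     vector [- frechet_derivative f (at x) (axis 2 1), frechet_derivative f (at x) (axis 1 1)]"

text \<open>
  The value on the diagonal, where the kernel is singular, is a convention; it does not affect
  integrals with respect to Lebesgue measure.
\<close>

definition euler_kernel :: "real^2 \<Rightarrow> real^2 \<Rightarrow> real^2" where
  "euler_kernel x y =
     (if x = y then 0 else (1 / (2 * pi)) *\<^sub>R nabla_perp (\<lambda>x. ln (norm (x - y))) x)"

text \<open>
  The modified Bessel function of the second kind of order zero, for a positive real argument,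
  by its classical integral formula.
\<close>

definition bessel_K0 :: "real \<Rightarrow> real" where
  "bessel_K0 r = (LINT t:{0..}|lborel. exp (- r * cosh t))"

definition vortex_G :: "real \<Rightarrow> real \<Rightarrow> real" where
  "vortex_G \<alpha> r = 1 / (2 * pi) * bessel_K0 (r / \<alpha>) + 1 / (2 * pi) * ln r"

definition vortex_kernel :: "real \<Rightarrow> real^2 \<Rightarrow> real^2 \<Rightarrow> real^2" where
  "vortex_kernel \<alpha> x y =
     (if x = y then 0 else nabla_perp (\<lambda>x. vortex_G \<alpha> (norm (x - y))) x)"

text \<open>
  Flows are indexed by times \<open>t \<ge> 0\<close>; at \<open>t = 0\<close> the time derivative is one-sided. The predicates
  below state the characterising properties of the flow map.
\<close>

definition euler_flow :: "(real^2 \<Rightarrow> real) \<Rightarrow> (real^2 \<Rightarrow> real \<Rightarrow> real^2) \<Rightarrow> bool" where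
  "euler_flow w \<eta> \<longleftrightarrow>
     (\<forall>t\<ge>0. (\<lambda>x. \<eta> x t) \<in> measure_preserving_homeos) \<and>
     (\<forall>x. \<eta> x 0 = x) \<and>
     (\<forall>x. \<forall>t\<ge>0.
        (\<eta> x has_vector_derivative
           (LINT y|lborel. w y *\<^sub>R euler_kernel (\<eta> x t) (\<eta> y t))) (at t within {0..}))"

definition vortex_flow ::
  "real \<Rightarrow> ((real^2) set \<Rightarrow> real) \<Rightarrow> (real^2 \<Rightarrow> real \<Rightarrow> real^2) \<Rightarrow> bool" where
  "vortex_flow \<alpha> q \<eta> \<longleftrightarrow>
     (\<forall>t\<ge>0. (\<lambda>x. \<eta> x t) \<in> measure_preserving_homeos) \<and>
     (\<forall>x. \<eta> x 0 = x) \<and>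
     (\<forall>x. \<forall>t\<ge>0.
        (\<eta> x has_vector_derivative
           signed_integral q (\<lambda>y. vortex_kernel \<alpha> (\<eta> x t) (\<eta> y t))) (at t within {0..}))"

end

theory Submission
  imports Defs "HOL-Real_Asymp.Real_Asymp"
begin

text \<open>
  Let \<open>\<eta>'\<close> be a flow of the vortex method with data \<open>q = q\<^sub>0 n\<close> and parameter \<open>\<alpha>\<close>. The velocity difference
  \<open>\<integral> K\<^sup>\<alpha>(\<eta>'(x), \<eta>'(y)) dq(y) - \<integral> K(\<eta>(x), \<eta>(y)) \<omega>\<^sub>0(y) dy\<close> is split into three parts.

  (1) \<open>\<integral> K\<^sup>\<alpha>(\<eta>'(x), \<eta>'(y)) d(q - \<omega>\<^sub>0)(y)\<close>. For fixed \<open>\<alpha>\<close> the kernel is bounded and log-Lipschitz, so the flows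
  \<open>\<eta>'\<close> have a common modulus of continuity on \<open>[0, T]\<close>. Weak convergence together with convergence of the
  norms prevents mass from escaping to infinity, and therefore acts uniformly on bounded equicontinuous
  families of test functions; this part tends to 0 as \<open>n \<rightarrow> \<infinity>\<close>.

  (2) \<open>\<integral> (K\<^sup>\<alpha> - K)(\<eta>'(x), \<eta>'(y)) \<omega>\<^sub>0(y) dy\<close> tends to 0 as \<open>\<alpha> \<rightarrow> 0\<close>, because \<open>\<eta>'\<close> preserves Lebesgue measure
  and \<open>\<omega>\<^sub>0\<close> is bounded and integrable.

  (3) \<open>\<integral> (K(\<eta>'(x), \<eta>'(y)) - K(\<eta>(x), \<eta>(y))) \<omega>\<^sub>0(y) dy\<close> is at most \<open>C r (1 - ln r)\<close> if \<open>\<bar>\<eta>' - \<eta>\<bar> \<le> r\<close>, since both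
  flows preserve Lebesgue measure; the constant \<open>C\<close> does not depend on \<open>\<alpha>\<close> and \<open>n\<close>.

  Osgood's criterion makes \<open>\<eta>' - \<eta>\<close> uniformly small on \<open>[0, T]\<close> for small \<open>\<alpha>\<close> and then large \<open>n\<close>. A
  diagonal choice of \<open>\<alpha>\<^sub>n\<close> concludes. No flow with a parameter \<open>\<alpha> > 0\<close> and data \<open>\<omega>\<^sub>0\<close> is needed.
\<close>

section \<open>Osgood's lemma in quantitative form for families of curves, and diagonal
  extraction\<close>

section \<open>Osgood comparison and diagonal sequences\<close>

text \<open>The modulus of continuity of planar velocity fields with bounded integrable vorticity.
  It satisfies Osgood's condition: the integral of \<open>1 / osgood_modulus r\<close> diverges at
  0, so small differences stay small on bounded time intervals.\<close>

definition osgood_modulus :: "real \<Rightarrow> real" where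
  "osgood_modulus r = r * (1 - ln r)"

lemma osgood_modulus_ge: "0 < r \<Longrightarrow> r \<le> 1 \<Longrightarrow> r \<le> osgood_modulus r"
  by (simp add: osgood_modulus_def mult_left_le)

lemma osgood_modulus_tendsto_0: "(osgood_modulus \<longlongrightarrow> 0) (at_right 0)"
  unfolding osgood_modulus_def by real_asymp

definition osgood_family ::
  "real \<Rightarrow> real \<Rightarrow> real \<Rightarrow> ('i \<Rightarrow> real \<Rightarrow> 'v::real_normed_vector) \<Rightarrow> ('i \<Rightarrow> real \<Rightarrow> 'v) \<Rightarrow> bool" where
  "osgood_family C T \<delta> g g' \<longleftrightarrow>
     (\<forall>i. norm (g i 0) \<le> \<delta>) \<and>
     (\<exists>L. \<forall>i. \<forall>s\<in>{0..T}. norm (g' i s) \<le> L) \<and>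
     (\<forall>i. \<forall>s\<in>{0..T}. (g i has_vector_derivative g' i s) (at s within {0..})) \<and>
     (\<forall>i. \<forall>s\<in>{0..T}. \<forall>r\<in>{\<delta>..1}. (\<forall>j. norm (g j s) \<le> r) \<longrightarrow> norm (g' i s) \<le> C * osgood_modulus r)"

text \<open>The explicit barrier \<open>y s = exp (1 - A * exp (- C * s))\<close> solves \<open>y' = C * osgood_modulus y\<close> and stays small
  on \<open>[0, T]\<close> if \<open>A\<close> is large. Since the \<open>g i\<close> are uniformly Lipschitz, the bound \<open>norm (g i s) \<le> y s\<close>
  propagates by time steps of a fixed length \<open>h\<close>.\<close>

lemma osgood_comparison:
  fixes C T \<epsilon> :: real
  assumes "C > 0" "T > 0" "\<epsilon> > 0"
  obtains \<delta> where "0 < \<delta>" "\<delta> \<le> 1"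
    "\<And>(g :: 'i \<Rightarrow> real \<Rightarrow> 'v::real_normed_vector) g' i t.
       osgood_family C T \<delta> g g' \<Longrightarrow> 0 \<le> t \<Longrightarrow> t \<le> T \<Longrightarrow> norm (g i t) \<le> \<epsilon>"
proof -
  \<comment> \<open>This choice gives \<open>y T = min 1 \<epsilon>\<close>, so on [0, T] the
    barrier stays below \<epsilon> and within (0, 1], where the growth bound is available.\<close>
  define A where "A = exp (C * T) * (1 + max 0 (- ln \<epsilon>))"
  define y where "y s = exp (1 - A * exp (- (C * s)))" for s
  \<comment> \<open>Starting at half the barrier leaves a gap of \<delta>, which persists because
    \<open>norm (g i s)\<close> grows no faster than \<open>y\<close>.\<close>
  define \<delta> where "\<delta> = y 0 / 2"
  have A: "A > 0" by (simp add: A_def add_pos_nonneg)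
  have AT: "A * exp (- (C * s)) \<ge> 1 + max 0 (- ln \<epsilon>)" if "s \<le> T" for s
  proof -
    have "exp (- (C * T)) \<le> exp (- (C * s))" using that assms by simp
    then have "A * exp (- (C * T)) \<le> A * exp (- (C * s))" using A by simp
    moreover have "A * exp (- (C * T)) = 1 + max 0 (- ln \<epsilon>)"
      by (simp add: A_def exp_minus)
    ultimately show ?thesis by simp
  qed
  have y1: "y s \<le> 1" "y s \<le> \<epsilon>" if "s \<le> T" for s
  proof -
    show "y s \<le> 1" using AT[OF that] by (simp add: y_def max_def split: if_splits)
    have "y s \<le> exp (ln \<epsilon>)" using AT[OF that] by (simp add: y_def del: exp_ln)
    then show "y s \<le> \<epsilon>" using assms by simp
  qed
  have ypos: "y s > 0" for s by (simp add: y_def)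
  have ymono: "y s \<le> y s'" if "s \<le> s'" for s s'
    using that A assms by (simp add: y_def)
  have yder: "(y has_real_derivative C * osgood_modulus (y s)) (at s)" for s
    unfolding y_def osgood_modulus_def
    by (auto intro!: derivative_eq_intros simp: algebra_simps)
  show thesis
  proof (rule that[of \<delta>])
    show "0 < \<delta>" using ypos by (simp add: \<delta>_def)
    show "\<delta> \<le> 1" using y1[of 0] assms ypos[of 0] by (simp add: \<delta>_def)
    fix g g' :: "'i \<Rightarrow> real \<Rightarrow> 'v" and i t
    assume family: "osgood_family C T \<delta> g g'" and t: "0 \<le> t" "t \<le> T"
    have der: "\<And>i s. 0 \<le> s \<Longrightarrow> s \<le> T \<Longrightarrow> (g i has_vector_derivative g' i s) (at s within {0..})"
      and g0: "\<And>i. norm (g i 0) \<le> \<delta>"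
      and osgood_modulus: "\<And>i s r. 0 \<le> s \<Longrightarrow> s \<le> T \<Longrightarrow> \<delta> \<le> r \<Longrightarrow> r \<le> 1 \<Longrightarrow> (\<And>j. norm (g j s) \<le> r) \<Longrightarrow>
          norm (g' i s) \<le> C * osgood_modulus r"
      using family by (auto simp: osgood_family_def)
    obtain L where "\<forall>i. \<forall>s\<in>{0..T}. norm (g' i s) \<le> L"
      using family unfolding osgood_family_def by blast
    then have L: "\<And>i s. 0 \<le> s \<Longrightarrow> s \<le> T \<Longrightarrow> norm (g' i s) \<le> L" by simp
    have cont: "continuous_on {a..b} (g i)" if "0 \<le> a" "b \<le> T" for a b i
    proof (rule continuous_on_vector_derivative)
      fix s assume "s \<in> {a..b}"
      then show "(g i has_vector_derivative g' i s) (at s within {a..b})"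
        using der[of s i] that by (auto intro: has_vector_derivative_within_subset)
    qed
    have at: "(g i has_vector_derivative g' i s) (at s)" if "0 < s" "s \<le> T" for s i
    proof -
      have "at s within {0..} = at s"
        using that by (intro at_within_interior) (simp add: interior_real_atLeast)
      then show ?thesis using der[of s i] that by simp
    qed
    \<comment> \<open>During a time \<open>h\<close> no curve moves by more than \<delta>, the size
      of the gap. The added 1 covers \<open>L = 0\<close>.\<close>
    define h where "h = \<delta> / (\<bar>L\<bar> + 1)"
    have h: "h > 0" "\<bar>L\<bar> * h \<le> \<delta>"
      using \<open>0 < \<delta>\<close> by (auto simp: h_def field_simps)
    have step: "\<forall>i. \<forall>s\<in>{0..T}. s \<le> real k * h \<longrightarrow> norm (g i s) \<le> y s" for k :: nat
    proof (induction k)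
      case 0
      have "norm (g i 0) \<le> y 0" for i using g0[of i] ypos[of 0] by (simp add: \<delta>_def)
      moreover have "s = 0" if "s \<in> {0..T}" "s \<le> real 0 * h" for s using that by simp
      ultimately show ?case by blast
    next
      case (Suc k)
      \<comment> \<open>On the first \<open>k\<close> steps the induction hypothesis bounds all
        curves by \<open>y\<close>, and integrating the growth bound improves this to
        \<open>y s - \<delta>\<close>. The gap then pays for the movement during the next
        step.\<close>
      have *: "norm (g i s) \<le> y s - \<delta>" if s: "0 \<le> s" "s \<le> T" "s \<le> real k * h" for i s
      proof (cases "s = 0")
        case True
        then show ?thesis using g0[of i] by (simp add: \<delta>_def)
      next
        case False
        have "norm (g i s - g i 0) \<le> y s - y 0"
        proof (rule differentiable_bound_general)
          show "0 < s" using False s by simp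
          show "continuous_on {0..s} (g i)" using cont s by simp
          show "continuous_on {0..s} y" unfolding y_def by (intro continuous_intros)
          fix x assume x: "0 < x" "x < s"
          show "(g i has_vector_derivative g' i x) (at x)" using at x s by simp
          show "(y has_vector_derivative C * osgood_modulus (y x)) (at x)"
            using yder by (simp add: has_real_derivative_iff_has_vector_derivative)
          show "norm (g' i x) \<le> C * osgood_modulus (y x)"
          proof (rule osgood_modulus)
            show "\<delta> \<le> y x" using ymono[of 0 x] ypos[of 0] x by (simp add: \<delta>_def)
            show "y x \<le> 1" using y1 x s by simp
            show "norm (g j x) \<le> y x" for j using Suc x s by auto
          qed (use x s in auto)
        qed
        moreover have "norm (g i s) \<le> norm (g i 0) + norm (g i s - g i 0)"
          by (metis add.commute diff_add_cancel norm_triangle_ineq)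
        ultimately show ?thesis using g0[of i] by (simp add: \<delta>_def)
      qed
      show ?case
      proof (intro allI ballI impI)
        fix i s assume s: "s \<in> {0..T}" "s \<le> real (Suc k) * h"
        show "norm (g i s) \<le> y s"
        proof (cases "s \<le> real k * h")
          case True
          then show ?thesis using Suc s by auto
        next
          case False
          define s0 where "s0 = real k * h"
          have s0: "0 \<le> s0" "s0 < s" using h False by (auto simp: s0_def)
          have "norm (g i s - g i s0) \<le> L * s - L * s0"
          proof (rule differentiable_bound_general)
            show "continuous_on {s0..s} (g i)" using cont s s0 by simp
            fix x assume x: "s0 < x" "x < s"
            show "(g i has_vector_derivative g' i x) (at x)" using at x s s0 by simp
            show "((*) L has_vector_derivative L) (at x)"
              by (auto intro!: derivative_eq_intros simp flip: has_real_derivative_iff_has_vector_derivative)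
            show "norm (g' i x) \<le> L" using L x s s0 by simp
          qed (use s0 in \<open>auto intro!: continuous_intros\<close>)
          also have "\<dots> \<le> \<bar>L\<bar> * (s - s0)" using s0 by (simp add: mult_right_mono right_diff_distrib[symmetric])
          also have "\<dots> \<le> \<bar>L\<bar> * h" using s s0 by (intro mult_left_mono) (auto simp: s0_def algebra_simps)
          also have "\<dots> \<le> \<delta>" by (rule h)
          finally have "norm (g i s - g i s0) \<le> \<delta>" .
          moreover have "norm (g i s) \<le> norm (g i s0) + norm (g i s - g i s0)"
            by (metis add.commute diff_add_cancel norm_triangle_ineq)
          moreover have "norm (g i s0) \<le> y s0 - \<delta>" using * s s0 by (simp add: s0_def)
          ultimately show ?thesis using ymono[of s0 s] s0 by simp
        qed
      qed
    qed
    obtain k :: nat where "t \<le> real k * h"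
      using reals_Archimedean3[of h] h by (metis less_eq_real_def)
    then have "norm (g i t) \<le> y t" using step t by auto
    then show "norm (g i t) \<le> \<epsilon>" using y1(2)[of t] t by simp
  qed
qed

text \<open>For each k fix a parameter \<open>a k\<close> for the accuracy 1/(k+1), with a threshold
  \<open>N k\<close>. Since every small parameter is admissible, \<open>a k\<close> can also be
  taken below 1/(k+1), which forces convergence to 0. Index n then uses the largest k whose
  threshold has been passed.\<close>

lemma diagonal_sequence:
  fixes P :: "real \<Rightarrow> real \<Rightarrow> nat \<Rightarrow> bool"
  assumes P: "\<And>\<epsilon>. \<epsilon> > 0 \<Longrightarrow> \<exists>a0>0. \<forall>a. 0 < a \<longrightarrow> a \<le> a0 \<longrightarrow> (\<exists>N. \<forall>n\<ge>N. P \<epsilon> a n)"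
    and mono: "\<And>\<epsilon> \<epsilon>' a n. P \<epsilon> a n \<Longrightarrow> \<epsilon> \<le> \<epsilon>' \<Longrightarrow> P \<epsilon>' a n"
  obtains \<alpha> :: "nat \<Rightarrow> real" where "\<And>n. \<alpha> n > 0" "\<alpha> \<longlonglongrightarrow> 0"
    "\<And>\<epsilon>. \<epsilon> > 0 \<Longrightarrow> \<exists>N. \<forall>n\<ge>N. P \<epsilon> (\<alpha> n) n"
proof -
  have "\<exists>a N. 0 < a \<and> a \<le> 1 / real (Suc k) \<and> (\<forall>n\<ge>N. P (1 / real (Suc k)) a n)" for k
  proof -
    obtain a0 where a0: "a0 > 0" "\<And>a. 0 < a \<Longrightarrow> a \<le> a0 \<Longrightarrow> \<exists>N. \<forall>n\<ge>N. P (1 / real (Suc k)) a n"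
      using P[of "1 / real (Suc k)"] by auto
    show ?thesis
      using a0(2)[of "min a0 (1 / real (Suc k))"] a0(1)
      by (intro exI[of _ "min a0 (1 / real (Suc k))"]) auto
  qed
  then obtain a N where aN: "\<And>k. 0 < a k" "\<And>k. a k \<le> 1 / real (Suc k)"
      "\<And>k n. n \<ge> N k \<Longrightarrow> P (1 / real (Suc k)) (a k) n"
    by metis
  \<comment> \<open>The condition \<open>k \<le> n\<close> makes the set finite, so that its maximum
    exists. The default 0 for an empty set concerns only finitely many n, because 0 belongs to
    \<open>S n\<close> as soon as \<open>n \<ge> N 0\<close>.\<close>
  define S where "S n = {k. k \<le> n \<and> N k \<le> n}" for n
  define K where "K n = (if S n = {} then 0 else Max (S n))" for n
  have fin: "finite (S n)" for n by (simp add: S_def)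
  have K: "k \<le> K n \<and> N (K n) \<le> n" if "n \<ge> max k (N k)" for k n
  proof -
    have "k \<in> S n" using that by (simp add: S_def)
    then have "K n = Max (S n)" "S n \<noteq> {}" by (auto simp: K_def)
    then show ?thesis using Max_in[OF fin] Max_ge[OF fin \<open>k \<in> S n\<close>] by (auto simp: S_def)
  qed
  have small: "\<exists>m. \<forall>n\<ge>m. 1 / real (Suc (K n)) \<le> \<epsilon> \<and> N (K n) \<le> n" if "\<epsilon> > 0" for \<epsilon>
  proof -
    obtain k where k: "1 / real (Suc k) < \<epsilon>" using \<open>\<epsilon> > 0\<close> nat_approx_posE by blast
    show ?thesis
    proof (intro exI allI impI)
      fix n assume n: "n \<ge> max k (N k)"
      have "1 / real (Suc (K n)) \<le> 1 / real (Suc k)" using K[OF n] by (auto simp: frac_le)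
      then show "1 / real (Suc (K n)) \<le> \<epsilon> \<and> N (K n) \<le> n" using K[OF n] k by linarith
    qed
  qed
  show thesis
  proof (rule that[of "\<lambda>n. a (K n)"])
    show "a (K n) > 0" for n by (rule aN)
    show "(\<lambda>n. a (K n)) \<longlonglongrightarrow> 0"
    proof (rule LIMSEQ_I)
      fix \<epsilon> :: real assume "\<epsilon> > 0"
      then obtain m where "\<forall>n\<ge>m. 1 / real (Suc (K n)) \<le> \<epsilon> / 2 \<and> N (K n) \<le> n"
        using small[of "\<epsilon> / 2"] by auto
      moreover have "\<bar>a k\<bar> \<le> 1 / real (Suc k)" for k using aN(1)[of k] aN(2)[of k] by simp
      ultimately show "\<exists>no. \<forall>n\<ge>no. norm (a (K n) - 0) < \<epsilon>"
        using \<open>\<epsilon> > 0\<close> by (intro exI[of _ m]) (force intro: le_less_trans order_trans)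
    qed
    fix \<epsilon> :: real assume "\<epsilon> > 0"
    then obtain m where "\<forall>n\<ge>m. 1 / real (Suc (K n)) \<le> \<epsilon> \<and> N (K n) \<le> n" using small by blast
    then show "\<exists>N. \<forall>n\<ge>N. P \<epsilon> (a (K n)) n" using aN(3) mono by blast
  qed
qed

section \<open>Potentials of bounded integrable densities, transported by measure-preserving
  maps\<close>

section \<open>Potential estimates\<close>

text \<open>The integrand is at most d on [0, 1], d/v on [1, 1/d] and 1/v^2 beyond. The three
  integrals are d, d ln(1/d) and d; the middle range produces the logarithm. Both the potential of a
  density and the superposition formula for the vortex kernel lead to this integral.\<close>

lemma nn_integral_log_split:
  fixes d :: real
  assumes "0 < d" "d \<le> 1"
  shows "(\<integral>\<^sup>+v. ennreal (min d (1 / v) * min 1 (1 / v)) * indicator {0<..} v \<partial>lborel) \<le> ennreal (2 * osgood_modulus d)"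
proof -
  have d1: "1 \<le> 1 / d" using assms by simp
  have "(\<integral>\<^sup>+v. ennreal (min d (1 / v) * min 1 (1 / v)) * indicator {0<..} v \<partial>lborel)
      \<le> (\<integral>\<^sup>+v. ennreal d * indicator {0..1} v + ennreal (d / v) * indicator {1..1/d} v
            + ennreal (1 / v\<^sup>2) * indicator {1/d..} v \<partial>lborel)"
  proof (rule nn_integral_mono)
    fix v :: real
    consider "v \<le> 0" | "0 < v" "v \<le> 1" | "1 \<le> v" "v \<le> 1 / d" | "1 / d \<le> v" using d1 by linarith
    then show "ennreal (min d (1 / v) * min 1 (1 / v)) * indicator {0<..} v
      \<le> ennreal d * indicator {0..1} v + ennreal (d / v) * indicator {1..1/d} v
            + ennreal (1 / v\<^sup>2) * indicator {1/d..} v"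
    proof cases
      case 2
      have "min d (1 / v) * min 1 (1 / v) \<le> d * 1"
        using 2 assms by (intro mult_mono) auto
      then have "ennreal (min d (1 / v) * min 1 (1 / v)) \<le> ennreal d" by (simp add: ennreal_leI)
      then show ?thesis using 2 by (simp add: add.assoc add_increasing2)
    next
      case 3
      have "min d (1 / v) * min 1 (1 / v) \<le> d * (1 / v)"
        using 3 assms by (intro mult_mono) auto
      then have "ennreal (min d (1 / v) * min 1 (1 / v)) \<le> ennreal (d / v)" by (simp add: ennreal_leI)
      then show ?thesis using 3 by (simp add: add_increasing add_increasing2)
    next
      case 4
      then have "v > 0" using d1 by linarith
      have "min d (1 / v) * min 1 (1 / v) \<le> (1 / v) * (1 / v)"
        using \<open>v > 0\<close> assms by (intro mult_mono) auto
      then have "ennreal (min d (1 / v) * min 1 (1 / v)) \<le> ennreal (1 / v\<^sup>2)"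
        by (intro ennreal_leI) (simp add: power2_eq_square)
      then show ?thesis using 4 \<open>v > 0\<close> by (simp add: add_increasing add_increasing2)
    qed auto
  qed
  also have "\<dots> = (\<integral>\<^sup>+v. ennreal d * indicator {0..1::real} v \<partial>lborel) + (\<integral>\<^sup>+v. ennreal (d / v) * indicator {1..1/d} v \<partial>lborel)
            + (\<integral>\<^sup>+v. ennreal (1 / v\<^sup>2) * indicator {1/d..} v \<partial>lborel)"
  proof -
    have m: "(\<lambda>v::real. ennreal d * indicator {0..1} v) \<in> borel_measurable lborel"
      "(\<lambda>v. ennreal (d / v) * indicator {1..1/d} v) \<in> borel_measurable lborel"
      "(\<lambda>v. ennreal (1 / v\<^sup>2) * indicator {1/d..} v) \<in> borel_measurable lborel"
      by measurable
    show ?thesis by (simp only: nn_integral_add m borel_measurable_add)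
  qed
  also have "(\<integral>\<^sup>+v. ennreal d * indicator {0..1::real} v \<partial>lborel) = ennreal d"
    by (subst nn_integral_cmult_indicator) auto
  also have "(\<integral>\<^sup>+v. ennreal (d / v) * indicator {1..1/d} v \<partial>lborel) = ennreal (d * ln (1 / d) - d * ln 1)"
    using assms d1 by (intro nn_integral_FTC_Icc) (auto intro!: derivative_eq_intros simp: has_real_derivative_iff_has_vector_derivative[symmetric])
  also have "(\<integral>\<^sup>+v. ennreal (1 / v\<^sup>2) * indicator {1/d..} v \<partial>lborel) = ennreal (0 - (- 1 / (1 / d)))"
  proof (rule nn_integral_FTC_atLeast)
    fix x assume "1 / d \<le> x"
    then have "x > 0" using d1 by linarith
    then show "((\<lambda>x. - 1 / x) has_real_derivative 1 / x\<^sup>2) (at x)"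
      by (auto intro!: derivative_eq_intros simp: power2_eq_square field_simps)
    show "0 \<le> 1 / x\<^sup>2" by simp
  next
    show "((\<lambda>x::real. - 1 / x) \<longlongrightarrow> 0) at_top" by real_asymp
  qed measurable
  also have "ennreal d + ennreal (d * ln (1 / d) - d * ln 1) + ennreal (0 - (- 1 / (1 / d))) =
      ennreal (d + (d * ln (1 / d) - d * ln 1) + (0 - (- 1 / (1 / d))))"
    using assms d1 by (simp flip: ennreal_plus)
  also have "\<dots> \<le> ennreal (2 * osgood_modulus d)"
    using assms mult_nonneg_nonpos[of d "ln d"]
    by (intro ennreal_leI) (simp add: osgood_modulus_def ln_div algebra_simps)
  finally show ?thesis .
qed

lemma ennreal_mult4: "0 \<le> p \<Longrightarrow> 0 \<le> q \<Longrightarrow> ennreal (4 * (p * q)) = 4 * (ennreal p * ennreal q)"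
  by (simp add: ennreal_mult)

text \<open>Layer-cake formula in the variable \<open>v = 1 / \<rho>\<close>: the integrand is compared with the integral of
  \<open>min 1 (d * v)\<close> over \<open>0 < v \<le> 1 / R y\<close>, of which the part \<open>v \<ge> 1 / (2 * R y)\<close> suffices.
  At \<open>R y = 0\<close> the integrand is 0 because \<open>1 / 0 = 0\<close>.\<close>

lemma (in finite_measure) nn_integral_min_inverse:
  fixes R :: "'a \<Rightarrow> real"
  assumes R[measurable]: "R \<in> borel_measurable M" and R0: "\<And>y. R y \<ge> 0"
    and ball: "\<And>\<rho>. \<rho> > 0 \<Longrightarrow> measure M {y \<in> space M. R y \<le> \<rho>} \<le> b * \<rho>\<^sup>2"
    and b: "b \<ge> 0"
    and d: "0 < d" "d \<le> 1"
  shows "(\<integral>\<^sup>+y. ennreal (min (1 / R y) (d / (R y)\<^sup>2)) \<partial>M) \<le> ennreal (8 * (measure M (space M) + b) * osgood_modulus d)"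
proof -
  interpret pair_sigma_finite M lborel
    by (intro pair_sigma_finite.intro sigma_finite_measure_axioms lborel.sigma_finite_measure_axioms)
  define m where "m = measure M (space M)"
  have m: "m \<ge> 0" by (simp add: m_def)
  have pt: "ennreal (min (1 / R y) (d / (R y)\<^sup>2)) \<le>
      4 * (\<integral>\<^sup>+v. (if 0 < v \<and> v * R y \<le> 1 then ennreal (min 1 (d * v)) else 0) \<partial>lborel)" for y
  proof (cases "R y = 0")
    case False
    define u where "u = 1 / R y"
    have u: "u > 0" using False R0[of y] by (simp add: u_def)
    have eq: "min (1 / R y) (d / (R y)\<^sup>2) = min u (d * u\<^sup>2)"
      by (simp add: u_def power_divide)
    \<comment> \<open>The left side is \<open>u * min 1 (d * u)\<close>; halving u costs at most a
      factor 2 in each of the two factors.\<close>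
    have "min u (d * u\<^sup>2) \<le> 4 * (min 1 (d * (u / 2)) * (u / 2))"
      using u d by (auto simp: min_def power2_eq_square not_le field_simps)
    then have "ennreal (min (1 / R y) (d / (R y)\<^sup>2)) \<le> ennreal (4 * (min 1 (d * (u / 2)) * (u / 2)))"
      unfolding eq by (rule ennreal_leI)
    also have "\<dots> = 4 * (ennreal (min 1 (d * (u / 2))) * ennreal (u / 2))"
      using u d by (intro ennreal_mult4) auto
    also have "ennreal (min 1 (d * (u / 2))) * ennreal (u / 2)
        = (\<integral>\<^sup>+v. ennreal (min 1 (d * (u / 2))) * indicator {u/2..u} v \<partial>lborel)"
      using u by (subst nn_integral_cmult_indicator) auto
    also have "\<dots> \<le> (\<integral>\<^sup>+v. (if 0 < v \<and> v * R y \<le> 1 then ennreal (min 1 (d * v)) else 0) \<partial>lborel)"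
    proof (rule nn_integral_mono)
      fix v :: real
      show "ennreal (min 1 (d * (u / 2))) * indicator {u/2..u} v
        \<le> (if 0 < v \<and> v * R y \<le> 1 then ennreal (min 1 (d * v)) else 0)"
      proof (cases "v \<in> {u/2..u}")
        case True
        then have "0 < v" using u by auto
        with True have "0 < v \<and> v * R y \<le> 1" using u R0[of y] False by (auto simp: u_def field_simps)
        moreover have "min 1 (d * (u / 2)) \<le> min 1 (d * v)"
          using True d by (intro min.mono mult_left_mono) auto
        ultimately show ?thesis using True by (simp add: ennreal_leI)
      qed simp
    qed
    finally show ?thesis by (simp add: mult_left_mono)
  qed simp
  \<comment> \<open>The total mass is the better bound for small v, the quadratic bound on balls for
    large v.\<close>
  have sl: "emeasure M {y \<in> space M. v * R y \<le> 1} \<le> ennreal ((m + b) * min 1 (1 / v\<^sup>2))" if "v > 0" for v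
  proof -
    have "{y \<in> space M. v * R y \<le> 1} = {y \<in> space M. R y \<le> 1 / v}"
      using that by (auto simp: field_simps)
    then have "measure M {y \<in> space M. v * R y \<le> 1} \<le> b * (1 / v)\<^sup>2"
      using ball[of "1 / v"] that by simp
    moreover have "measure M {y \<in> space M. v * R y \<le> 1} \<le> m"
      unfolding m_def by (rule bounded_measure)
    moreover have "m + b \<ge> m" "(m + b) * (1 / v\<^sup>2) \<ge> b * (1 / v\<^sup>2)"
      using m b by (auto intro!: divide_right_mono)
    ultimately have "measure M {y \<in> space M. v * R y \<le> 1} \<le> (m + b) * min 1 (1 / v\<^sup>2)"
      by (auto simp: min_def power_divide)
    then show ?thesis by (simp add: emeasure_eq_measure ennreal_leI)
  qed
  have "(\<integral>\<^sup>+y. ennreal (min (1 / R y) (d / (R y)\<^sup>2)) \<partial>M) \<le>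
     (\<integral>\<^sup>+y. 4 * (\<integral>\<^sup>+v. (if 0 < v \<and> v * R y \<le> 1 then ennreal (min 1 (d * v)) else 0) \<partial>lborel) \<partial>M)"
    by (intro nn_integral_mono pt)
  also have "\<dots> = 4 * (\<integral>\<^sup>+y. (\<integral>\<^sup>+v. (if 0 < v \<and> v * R y \<le> 1 then ennreal (min 1 (d * v)) else 0) \<partial>lborel) \<partial>M)"
    by (intro nn_integral_cmult) measurable
  also have "\<dots> = 4 * (\<integral>\<^sup>+v. (\<integral>\<^sup>+y. (if 0 < v \<and> v * R y \<le> 1 then ennreal (min 1 (d * v)) else 0) \<partial>M) \<partial>lborel)"
    by (subst Fubini') (simp_all)
  also have "\<dots> \<le> 4 * (\<integral>\<^sup>+v. ennreal (m + b) * (ennreal (min d (1 / v) * min 1 (1 / v)) * indicator {0<..} v) \<partial>lborel)"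
  proof (intro mult_left_mono nn_integral_mono)
    fix v :: real
    show "(\<integral>\<^sup>+y. (if 0 < v \<and> v * R y \<le> 1 then ennreal (min 1 (d * v)) else 0) \<partial>M)
      \<le> ennreal (m + b) * (ennreal (min d (1 / v) * min 1 (1 / v)) * indicator {0<..} v)"
    proof (cases "v > 0")
      case True
      have "(\<integral>\<^sup>+y. (if 0 < v \<and> v * R y \<le> 1 then ennreal (min 1 (d * v)) else 0) \<partial>M)
        = (\<integral>\<^sup>+y. ennreal (min 1 (d * v)) * indicator {y \<in> space M. v * R y \<le> 1} y \<partial>M)"
        using True by (intro nn_integral_cong) (auto simp: indicator_def)
      also have "\<dots> = ennreal (min 1 (d * v)) * emeasure M {y \<in> space M. v * R y \<le> 1}"
        by (subst nn_integral_cmult_indicator) auto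
      also have "\<dots> \<le> ennreal (min 1 (d * v)) * ennreal ((m + b) * min 1 (1 / v\<^sup>2))"
        by (intro mult_left_mono sl True) auto
      also have "\<dots> = ennreal (min 1 (d * v) * ((m + b) * min 1 (1 / v\<^sup>2)))"
        using m b d True by (subst ennreal_mult) auto
      also have "\<dots> \<le> ennreal ((m + b) * (min d (1 / v) * min 1 (1 / v)))"
      proof (rule ennreal_leI)
        \<comment> \<open>Moving a factor v from the first minimum to the second produces the
          integrand of \<open>nn_integral_log_split\<close>.\<close>
        have "min 1 (d * v) * min 1 (1 / v\<^sup>2) = min d (1 / v) * (v * min 1 (1 / v\<^sup>2))"
          using True by (auto simp: min_def field_simps)
        also have "\<dots> = min d (1 / v) * min v (1 / v)"
          using True by (auto simp: min_def field_simps power2_eq_square)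
        also have "\<dots> \<le> min d (1 / v) * min 1 (1 / v)"
          using True d mult_le_one[of v v] by (intro mult_left_mono) (auto simp: min_def field_simps)
        finally have "(m + b) * (min 1 (d * v) * min 1 (1 / v\<^sup>2)) \<le> (m + b) * (min d (1 / v) * min 1 (1 / v))"
          using m b by (intro mult_left_mono) auto
        then show "min 1 (d * v) * ((m + b) * min 1 (1 / v\<^sup>2)) \<le> (m + b) * (min d (1 / v) * min 1 (1 / v))"
          by (simp add: mult_ac)
      qed
      also have "\<dots> = ennreal (m + b) * (ennreal (min d (1 / v) * min 1 (1 / v)) * indicator {0<..} v)"
        using m b d True by (subst ennreal_mult) auto
      finally show ?thesis .
    qed simp
  qed simp
  also have "\<dots> = 4 * (ennreal (m + b) * (\<integral>\<^sup>+v. (ennreal (min d (1 / v) * min 1 (1 / v)) * indicator {0<..} v) \<partial>lborel))"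
    by (subst nn_integral_cmult) measurable
  also have "\<dots> \<le> 4 * (ennreal (m + b) * ennreal (2 * osgood_modulus d))"
    by (intro mult_left_mono nn_integral_log_split d) auto
  also have "\<dots> = ennreal (8 * (m + b) * osgood_modulus d)"
  proof -
    have "osgood_modulus d \<ge> 0" using osgood_modulus_ge d by fastforce
    then have "4 * (ennreal (m + b) * ennreal (2 * osgood_modulus d)) = ennreal (4 * ((m + b) * (2 * osgood_modulus d)))"
      using m b by (intro ennreal_mult4[symmetric]) auto
    then show ?thesis by (simp add: mult_ac)
  qed
  finally show ?thesis by (simp add: m_def)
qed

lemma measure_preserving_homeos_measurable:
  assumes "\<psi> \<in> measure_preserving_homeos"
  shows "continuous_on UNIV \<psi>" "\<psi> \<in> borel_measurable borel"
proof -
  show "continuous_on UNIV \<psi>"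
    using assms by (auto simp: measure_preserving_homeos_def homeomorphism_def)
  then show "\<psi> \<in> borel_measurable borel" by (rule borel_measurable_continuous_onI)
qed

text \<open>The preimage of a disc of radius \<rho> under a measure-preserving map has area \<pi>
  \<rho>^2, so its mass with respect to |w| dx is at most a constant times \<rho>^2, whatever \<psi>
  and the centre are. This is the hypothesis \<open>ball\<close> of the layer-cake estimate, and it
  makes \<open>C\<close> depend on \<open>w\<close> alone.\<close>

lemma nn_integral_potential:
  fixes w :: "real^2 \<Rightarrow> real"
  assumes "in_L1_Linf w"
  obtains C where "C \<ge> 1" "\<And>\<psi> a d. \<psi> \<in> measure_preserving_homeos \<Longrightarrow> 0 < d \<Longrightarrow> d \<le> 1 \<Longrightarrow>
     (\<integral>\<^sup>+y. ennreal (\<bar>w y\<bar> * min (1 / norm (a - \<psi> y)) (d / (norm (a - \<psi> y))\<^sup>2)) \<partial>lborel) \<le> ennreal (C * osgood_modulus d)"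
proof -
  have w: "integrable lborel w" using assms by (simp add: in_L1_Linf_def)
  then have wm[measurable]: "w \<in> borel_measurable borel" by (simp add: borel_measurable_integrable)
  obtain B where B: "AE x in lborel. \<bar>w x\<bar> \<le> B" using assms by (auto simp: in_L1_Linf_def)
  define N where "N = density lborel (\<lambda>x. ennreal \<bar>w x\<bar>)"
  have spN: "space N = UNIV" "sets N = sets borel" by (simp_all add: N_def)
  interpret N: finite_measure N
  proof
    have "emeasure N (space N) = (\<integral>\<^sup>+x. ennreal (norm (w x)) \<partial>lborel)"
      unfolding N_def by (subst emeasure_density) simp_all
    also have "\<dots> < \<infinity>" using w by (simp add: integrable_iff_bounded)
    finally show "emeasure N (space N) \<noteq> \<infinity>" by simp
  qed
  define b where "b = \<bar>B\<bar> * pi"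
  define C where "C = 8 * (measure N (space N) + b) + 1"
  show thesis
  proof (rule that)
    show "C \<ge> 1" by (simp add: C_def b_def)
    fix \<psi> :: "real^2 \<Rightarrow> real^2" and a :: "real^2" and d :: real
    assume psi: "\<psi> \<in> measure_preserving_homeos" and d: "0 < d" "d \<le> 1"
    note [measurable] = measure_preserving_homeos_measurable(2)[OF psi]
    have distr: "distr lborel borel \<psi> = lborel" using psi by (simp add: measure_preserving_homeos_def)
    have "(\<integral>\<^sup>+y. ennreal (\<bar>w y\<bar> * min (1 / norm (a - \<psi> y)) (d / (norm (a - \<psi> y))\<^sup>2)) \<partial>lborel)
      = (\<integral>\<^sup>+y. ennreal (min (1 / norm (a - \<psi> y)) (d / (norm (a - \<psi> y))\<^sup>2)) \<partial>N)"
      unfolding N_def using d by (subst nn_integral_density) (auto simp: ennreal_mult)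
    also have "\<dots> \<le> ennreal (8 * (measure N (space N) + b) * osgood_modulus d)"
    proof (rule N.nn_integral_min_inverse)
      show "(\<lambda>y. norm (a - \<psi> y)) \<in> borel_measurable N" unfolding N_def by measurable
      show "b \<ge> 0" by (simp add: b_def)
      fix \<rho> :: real assume "\<rho> > 0"
      have "emeasure N {y \<in> space N. norm (a - \<psi> y) \<le> \<rho>}
        = (\<integral>\<^sup>+x. ennreal \<bar>w x\<bar> * indicator {y. norm (a - \<psi> y) \<le> \<rho>} x \<partial>lborel)"
        unfolding N_def by (subst emeasure_density) auto
      also have "\<dots> \<le> (\<integral>\<^sup>+x. ennreal \<bar>B\<bar> * indicator {y. norm (a - \<psi> y) \<le> \<rho>} x \<partial>lborel)"
        using B by (intro nn_integral_mono_AE) (auto intro!: ennreal_leI mult_right_mono elim!: eventually_mono)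
      also have "\<dots> = ennreal \<bar>B\<bar> * emeasure lborel {y. norm (a - \<psi> y) \<le> \<rho>}"
        by (subst nn_integral_cmult_indicator) auto
      also have "{y. norm (a - \<psi> y) \<le> \<rho>} = \<psi> -` cball a \<rho> \<inter> space lborel"
        by (auto simp: dist_norm)
      also have "emeasure lborel \<dots> = emeasure (distr lborel borel \<psi>) (cball a \<rho>)"
        by (subst emeasure_distr) auto
      also have "\<dots> = ennreal (pi * \<rho>\<^sup>2)"
        unfolding distr using \<open>\<rho> > 0\<close> by (subst emeasure_cball) (auto simp: unit_ball_vol_2)
      also have "ennreal \<bar>B\<bar> * ennreal (pi * \<rho>\<^sup>2) = ennreal (b * \<rho>\<^sup>2)"
        by (simp add: b_def ennreal_mult mult_ac)
      finally show "measure N {y \<in> space N. norm (a - \<psi> y) \<le> \<rho>} \<le> b * \<rho>\<^sup>2"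
        by (simp add: N.emeasure_eq_measure b_def)
    qed (use d in auto)
    also have "\<dots> \<le> ennreal (C * osgood_modulus d)"
      using osgood_modulus_ge[OF d] d by (intro ennreal_leI mult_right_mono) (auto simp: C_def)
    finally show "(\<integral>\<^sup>+y. ennreal (\<bar>w y\<bar> * min (1 / norm (a - \<psi> y)) (d / (norm (a - \<psi> y))\<^sup>2)) \<partial>lborel)
      \<le> ennreal (C * osgood_modulus d)" .
  qed
qed

section \<open>Derivative of K_0 and elementary bounds for K_1\<close>

section \<open>Bessel functions\<close>

lemma half_line_exp:
  fixes s :: real
  assumes "s > 0"
  shows "set_integrable lborel {0..} (\<lambda>v. exp (- s * v))"
    and "(LINT v:{0..}|lborel. exp (- s * v)) = 1 / s"
proof -
  have "(\<integral>\<^sup>+v. ennreal (exp (- s * v)) * indicator {0..} v \<partial>lborel) = ennreal (0 - (- exp (- s * 0) / s))"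
  proof (rule nn_integral_FTC_atLeast)
    show "((\<lambda>v. - exp (- s * v) / s) \<longlongrightarrow> 0) at_top" using assms by real_asymp
  qed (use assms in \<open>auto intro!: derivative_eq_intros\<close>)
  then have "(\<integral>\<^sup>+v. ennreal (indicator {0..} v * exp (- s * v)) \<partial>lborel) = ennreal (1 / s)"
    by (simp add: mult.commute ennreal_mult ennreal_indicator)
  then have "has_bochner_integral lborel (\<lambda>v. indicator {0..} v * exp (- s * v)) (1 / s)"
    using assms by (intro has_bochner_integral_nn_integral) auto
  then show "set_integrable lborel {0..} (\<lambda>v. exp (- s * v))" "(LINT v:{0..}|lborel. exp (- s * v)) = 1 / s"
    by (auto simp: set_integrable_def set_lebesgue_integral_def has_bochner_integral_iff)
qed

lemma set_integrable_real_bound: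
  fixes f g :: "real \<Rightarrow> real"
  assumes "set_integrable lborel A f" "set_borel_measurable lborel A g" "\<And>x. x \<in> A \<Longrightarrow> \<bar>g x\<bar> \<le> f x"
  shows "set_integrable lborel A g"
proof (rule set_integrable_bound[OF assms(1,2)], intro AE_I2 impI)
  fix x assume "x \<in> A"
  then show "norm (g x) \<le> norm (f x)" using assms(3)[of x] by simp
qed

lemma mult_exp_minus_le: "x * exp (- x) \<le> (1/2 :: real)"
proof -
  have "2 * x \<le> exp x"
  proof (cases "x \<ge> 0")
    case True
    have "2 * x \<le> 1 + x + x\<^sup>2 / 2"
      using zero_le_power2[of "x - 1"] by (simp add: power2_eq_square algebra_simps)
    then show ?thesis using exp_lower_Taylor_quadratic[OF True] by linarith
  next
    case False
    then show ?thesis using exp_gt_zero[of x] by linarith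
  qed
  then show ?thesis by (simp add: exp_minus field_simps)
qed

text \<open>The powers 0, 1, 2 occur in K_0, in its derivative and in the Taylor remainder. Half of
  the exponent absorbs cosh^2 through x^2/2 \<le> exp x; the other half decays exponentially because
  cosh t \<ge> t/2.\<close>

lemma set_integrable_cosh_exp:
  fixes r :: real
  assumes r: "r > 0" and k: "k \<le> (2::nat)"
  shows "set_integrable lborel {0..} (\<lambda>t. cosh t ^ k * exp (- r * cosh t))"
proof (rule set_integrable_real_bound)
  show "set_integrable lborel {0..} (\<lambda>t. (8 / r\<^sup>2) * exp (- (r / 4) * t))"
    using r half_line_exp(1)[of "r / 4"] by (intro set_integrable_mult_right) auto
  show "set_borel_measurable lborel {0..} (\<lambda>t. cosh t ^ k * exp (- r * cosh t))"
  proof -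
    have "(\<lambda>t. cosh t ^ k * exp (- r * cosh t)) \<in> borel_measurable borel"
      by (intro borel_measurable_continuous_onI continuous_intros)
    then show ?thesis unfolding set_borel_measurable_def by measurable
  qed
  fix t :: real assume t: "t \<in> {0..}"
  have c1: "cosh t \<ge> 1" by (rule cosh_real_ge_1)
  have ct: "cosh t \<ge> t / 2"
  proof -
    have "t \<le> exp t" using exp_ge_add_one_self[of t] by linarith
    moreover have "exp (- t) > 0" by simp
    ultimately have "t \<le> exp t + exp (- t)" by linarith
    then show ?thesis by (simp add: cosh_def)
  qed
  have "(r * cosh t / 2)\<^sup>2 / 2 \<le> exp (r * cosh t / 2)"
    using exp_lower_Taylor_quadratic[of "r * cosh t / 2"] mult_pos_pos[OF r, of "cosh t"] c1 by linarith
  then have "cosh t ^ 2 \<le> (8 / r\<^sup>2) * exp (r * cosh t / 2)"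
    using r by (simp add: power_mult_distrib power_divide field_simps)
  then have "cosh t ^ 2 * exp (- r * cosh t) \<le> (8 / r\<^sup>2) * exp (r * cosh t / 2) * exp (- r * cosh t)"
    by (intro mult_right_mono) auto
  also have "\<dots> = (8 / r\<^sup>2) * exp (- r * cosh t / 2)"
    by (simp flip: exp_add add: mult.assoc)
  also have "\<dots> \<le> (8 / r\<^sup>2) * exp (- (r / 4) * t)"
    using ct r by (intro mult_left_mono) auto
  finally have *: "cosh t ^ 2 * exp (- r * cosh t) \<le> (8 / r\<^sup>2) * exp (- (r / 4) * t)" .
  have "cosh t ^ k * exp (- r * cosh t) \<le> cosh t ^ 2 * exp (- r * cosh t)"
    using c1 k by (intro mult_right_mono power_increasing) auto
  then have "cosh t ^ k * exp (- r * cosh t) \<le> (8 / r\<^sup>2) * exp (- (r / 4) * t)"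
    using * by (rule order_trans)
  then show "\<bar>cosh t ^ k * exp (- r * cosh t)\<bar> \<le> (8 / r\<^sup>2) * exp (- (r / 4) * t)"
    using c1 by (simp add: abs_mult)
qed

lemma exp_minus_taylor_bound:
  fixes x :: real
  shows "\<bar>exp x - 1 - x\<bar> \<le> x\<^sup>2 * exp \<bar>x\<bar>"
proof -
  obtain t where t: "\<bar>t\<bar> \<le> \<bar>x\<bar>" "exp x = (\<Sum>m<2. (x ^ m) / fact m) + (exp t / fact 2) * x ^ 2"
    using Maclaurin_exp_le[of x 2] by blast
  have "exp x - 1 - x = (exp t / 2) * x\<^sup>2"
    using t(2) by (simp add: numeral_2_eq_2)
  moreover have le: "exp t / 2 \<le> exp \<bar>x\<bar>" using t(1) exp_le_cancel_iff[of t "\<bar>x\<bar>"] exp_gt_zero[of t] by linarith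
  ultimately have "\<bar>exp x - 1 - x\<bar> = exp t / 2 * x\<^sup>2" by (simp only: abs_mult) simp
  also have "\<dots> \<le> exp \<bar>x\<bar> * x\<^sup>2" using le by (intro mult_right_mono) auto
  finally show ?thesis by (simp add: mult.commute)
qed

text \<open>The modified Bessel function \<open>K\<^sub>1\<close>, after the substitution \<open>v = sinh t\<close>.\<close>

definition bessel_K1 :: "real \<Rightarrow> real" where
  "bessel_K1 s = (LINT v:{0..}|lborel. exp (- s * sqrt (1 + v\<^sup>2)))"

text \<open>The right side is what differentiating K_0 under the integral sign produces; the
  defining form of \<open>bessel_K1\<close> is easy to compare with the integral of exp(-s v), which
  equals 1/s.\<close>

lemma bessel_K1_eq:
  assumes "s > 0"
  shows "bessel_K1 s = (LINT t:{0..}|lborel. cosh t * exp (- s * cosh t))"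
proof -
  have eq: "exp (- s * sqrt (1 + (sinh t)\<^sup>2)) * cosh t = cosh t * exp (- s * cosh t)" for t :: real
    using cosh_square_eq[of t] by (simp add: add.commute[of 1] flip: cosh_square_eq)
  have "set_integrable lborel (einterval 0 \<infinity>) (\<lambda>t. cosh t * exp (- s * cosh t))"
  proof (rule set_integrable_subset)
    show "set_integrable lborel {0..} (\<lambda>t. cosh t * exp (- s * cosh t))"
      using set_integrable_cosh_exp[OF assms, of 1] by simp
  qed (auto simp: einterval_def)
  then have I: "set_integrable lborel (einterval 0 \<infinity>) (\<lambda>t. exp (- s * sqrt (1 + (sinh t)\<^sup>2)) * cosh t)"
    by (simp only: eq)
  have "(LBINT v=0..\<infinity>. exp (- s * sqrt (1 + v\<^sup>2))) = (LBINT t=0..\<infinity>. exp (- s * sqrt (1 + (sinh t)\<^sup>2)) * cosh t)"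
  proof (rule interval_integral_substitution_nonneg(2)[where g = sinh and g' = cosh])
    show "set_integrable lborel (einterval 0 \<infinity>) (\<lambda>t. exp (- s * sqrt (1 + (sinh t)\<^sup>2)) * cosh t)" by (rule I)
    show "((ereal \<circ> sinh \<circ> real_of_ereal) \<longlongrightarrow> 0) (at_right 0)"
    proof -
      have "((\<lambda>x. ereal (sinh x)) \<longlongrightarrow> ereal (sinh 0)) (at_right 0)"
        by (intro tendsto_intros)
      then show ?thesis unfolding zero_ereal_def ereal_tendsto_simps1 by (simp add: comp_def)
    qed
    show "((ereal \<circ> sinh \<circ> real_of_ereal) \<longlongrightarrow> \<infinity>) (at_left \<infinity>)"
    proof -
      have "filterlim (sinh :: real \<Rightarrow> real) at_top at_top" by (rule sinh_real_at_top)
      then show ?thesis unfolding ereal_tendsto_simps1 by (simp add: comp_def tendsto_PInfty_eq_at_top)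
    qed
  qed (auto intro!: derivative_eq_intros continuous_intros simp: add_nonneg_eq_0_iff)
  \<comment> \<open>The interval integral runs over the open half line; the added point 0 is a null
    set.\<close>
  moreover have "(LBINT v=0..\<infinity>. f v) = (LINT v:{0..}|lborel. f v)" for f :: "real \<Rightarrow> real"
    unfolding zero_ereal_def interval_integral_to_infinity_eq
    by (rule set_integral_discrete_difference[where X="{0}"]) auto
  ultimately show ?thesis unfolding bessel_K1_def eq by metis
qed

text \<open>Differentiation under the integral sign by an explicit remainder. The second-order
  Taylor remainder of exp(-h cosh t) is at most h^2 cosh^2 t exp(|h| cosh t). For |h| \<le> r/2 half
  of the decay exp(-r cosh t) survives, so the integrated remainder is at most
  \<open>h\<^sup>2 * C\<close>.\<close>

lemma bessel_K0_has_derivative: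
  fixes r :: real
  assumes r: "r > 0"
  shows "(bessel_K0 has_real_derivative - bessel_K1 r) (at r)"
proof -
  define C where "C = (LINT t:{0..}|lborel. cosh t ^ 2 * exp (- (r / 2) * cosh t))"
  have bound: "\<bar>bessel_K0 (r + h) - bessel_K0 r + h * bessel_K1 r\<bar> \<le> h\<^sup>2 * C" if h: "\<bar>h\<bar> \<le> r / 2" for h
  proof -
    have rh: "r + h > 0" using h r by linarith
    have i: "set_integrable lborel {0..} (\<lambda>t. exp (- (r + h) * cosh t))"
      "set_integrable lborel {0..} (\<lambda>t. exp (- r * cosh t))"
      "set_integrable lborel {0..} (\<lambda>t. cosh t * exp (- r * cosh t))"
      using set_integrable_cosh_exp[OF rh, of 0] set_integrable_cosh_exp[OF r, of 0] set_integrable_cosh_exp[OF r, of 1] by auto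
    let ?f = "\<lambda>t. exp (- (r + h) * cosh t) - exp (- r * cosh t) + h * (cosh t * exp (- r * cosh t))"
    have int: "set_integrable lborel {0..} ?f"
      using i by (intro set_integral_add set_integral_diff set_integrable_mult_right) auto
    have "bessel_K0 (r + h) - bessel_K0 r + h * bessel_K1 r = (LINT t:{0..}|lborel. ?f t)"
      unfolding bessel_K0_def bessel_K1_eq[OF r]
      using i by (subst set_integral_add) (auto intro!: set_integral_diff set_integrable_mult_right)
    moreover have "\<bar>LINT t:{0..}|lborel. ?f t\<bar> \<le> (LINT t:{0..}|lborel. \<bar>?f t\<bar>)"
      using set_integral_norm_bound[OF int] by simp
    moreover have "(LINT t:{0..}|lborel. \<bar>?f t\<bar>) \<le> (LINT t:{0..}|lborel. h\<^sup>2 * (cosh t ^ 2 * exp (- (r / 2) * cosh t)))"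
    proof (rule set_integral_mono)
      show "set_integrable lborel {0..} (\<lambda>t. \<bar>?f t\<bar>)" using int by (rule set_integrable_abs)
      show "set_integrable lborel {0..} (\<lambda>t. h\<^sup>2 * (cosh t ^ 2 * exp (- (r / 2) * cosh t)))"
        using set_integrable_cosh_exp[of "r/2" 2] r by (intro set_integrable_mult_right) auto
      fix t :: real
      let ?c = "cosh t"
      have c: "?c \<ge> 1" by (rule cosh_real_ge_1)
      have "?f t = exp (- r * ?c) * (exp (- h * ?c) - 1 - (- h * ?c))"
        by (simp add: algebra_simps flip: exp_add)
      then have "\<bar>?f t\<bar> = exp (- r * ?c) * \<bar>exp (- h * ?c) - 1 - (- h * ?c)\<bar>"
        by (simp add: abs_mult)
      also have "\<dots> \<le> exp (- r * ?c) * ((- h * ?c)\<^sup>2 * exp \<bar>- h * ?c\<bar>)"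
        by (intro mult_left_mono exp_minus_taylor_bound) auto
      also have "\<dots> = h\<^sup>2 * (?c\<^sup>2 * exp (- r * ?c + \<bar>h\<bar> * ?c))"
        using c unfolding exp_add by (simp add: power_mult_distrib abs_mult)
      also have "\<dots> \<le> h\<^sup>2 * (?c\<^sup>2 * exp (- (r / 2) * ?c))"
        proof -
        have "- r * ?c + \<bar>h\<bar> * ?c \<le> - (r / 2) * ?c"
          using mult_right_mono[OF h, of ?c] c by (simp add: algebra_simps)
        then show ?thesis by (intro mult_left_mono) auto
      qed
      finally show "\<bar>?f t\<bar> \<le> h\<^sup>2 * (?c ^ 2 * exp (- (r / 2) * ?c))" .
    qed
    ultimately show ?thesis by (simp add: C_def)
  qed
  have C0: "C \<ge> 0" unfolding C_def set_lebesgue_integral_def by (intro integral_nonneg_AE) (auto intro!: AE_I2)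
  show ?thesis
    unfolding DERIV_def
  proof -
    show "(\<lambda>h. (bessel_K0 (r + h) - bessel_K0 r) / h) \<midarrow>0\<rightarrow> - bessel_K1 r"
    proof (rule LIM_zero_cancel, rule Lim_null_comparison)
      show "((\<lambda>h. \<bar>h\<bar> * C) \<longlongrightarrow> 0) (at 0)" by (auto intro!: tendsto_eq_intros)
      show "\<forall>\<^sub>F h in at 0. norm ((bessel_K0 (r + h) - bessel_K0 r) / h - - bessel_K1 r) \<le> \<bar>h\<bar> * C"
        unfolding eventually_at
      proof (intro exI[of _ "r/2"] conjI ballI impI)
        fix h :: real assume "h \<noteq> 0 \<and> dist h 0 < r / 2"
        then have h: "h \<noteq> 0" "\<bar>h\<bar> \<le> r / 2" by auto
        have "(bessel_K0 (r + h) - bessel_K0 r) / h - - bessel_K1 r = (bessel_K0 (r + h) - bessel_K0 r + h * bessel_K1 r) / h"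
          using h by (simp add: field_simps)
        then have "norm ((bessel_K0 (r + h) - bessel_K0 r) / h - - bessel_K1 r) = \<bar>bessel_K0 (r + h) - bessel_K0 r + h * bessel_K1 r\<bar> / \<bar>h\<bar>"
          by (simp add: abs_divide)
        also have "\<dots> \<le> h\<^sup>2 * C / \<bar>h\<bar>" using bound[OF h(2)] by (intro divide_right_mono) auto
        also have "\<dots> = \<bar>h\<bar> * C" using h(1) by (simp add: power2_eq_square abs_if)
        finally show "norm ((bessel_K0 (r + h) - bessel_K0 r) / h - - bessel_K1 r) \<le> \<bar>h\<bar> * C" .
      qed (use r in auto)
    qed
  qed
qed

text \<open>The last two bounds rest on the identity (w - v)(w + v) = 1 for w = sqrt(1 + v^2), since
  w + v is at least 1 and at least v.\<close>

lemma sqrt_one_plus_bounds: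
  fixes v :: real
  assumes "v \<ge> 0"
  shows "1 \<le> sqrt (1 + v\<^sup>2)" "v \<le> sqrt (1 + v\<^sup>2)" "sqrt (1 + v\<^sup>2) - v \<le> 1" "v * (sqrt (1 + v\<^sup>2) - v) \<le> 1"
proof -
  show 1: "1 \<le> sqrt (1 + v\<^sup>2)" by simp
  show 2: "v \<le> sqrt (1 + v\<^sup>2)" by (rule real_le_rsqrt) simp
  have e: "(sqrt (1 + v\<^sup>2) - v) * (sqrt (1 + v\<^sup>2) + v) = 1"
    by (simp add: algebra_simps flip: power2_eq_square)
  have "(sqrt (1 + v\<^sup>2) - v) * 1 \<le> (sqrt (1 + v\<^sup>2) - v) * (sqrt (1 + v\<^sup>2) + v)"
    using 1 2 assms by (intro mult_left_mono) linarith+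
  then show "sqrt (1 + v\<^sup>2) - v \<le> 1" using e by simp
  have "(sqrt (1 + v\<^sup>2) - v) * v \<le> (sqrt (1 + v\<^sup>2) - v) * (sqrt (1 + v\<^sup>2) + v)"
    using 1 2 assms by (intro mult_left_mono) linarith+
  then show "v * (sqrt (1 + v\<^sup>2) - v) \<le> 1" using e by (simp add: mult.commute)
qed

lemma set_integrable_K1:
  assumes "s > 0"
  shows "set_integrable lborel {0..} (\<lambda>v. exp (- s * sqrt (1 + v\<^sup>2)))"
proof (rule set_integrable_real_bound[OF half_line_exp(1)[OF assms]])
  show "set_borel_measurable lborel {0..} (\<lambda>v. exp (- s * sqrt (1 + v\<^sup>2)))"
    unfolding set_borel_measurable_def by measurable
  show "\<bar>exp (- s * sqrt (1 + v\<^sup>2))\<bar> \<le> exp (- s * v)" if "v \<in> {0..}" for v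
    using sqrt_one_plus_bounds(2)[of v] that assms by simp
qed

text \<open>Pointwise comparisons of w = sqrt(1 + v^2) in the exponent: w \<ge> v gives 1/s, w \<ge>
  (1 + v)/2 gives the decay 4/s^2, and w - v \<le> 1 shows that the singularities of 1/s and K_1(s)
  at 0 cancel up to a bounded term.\<close>

lemma bessel_K1_bounds:
  assumes s: "s > 0"
  shows "0 \<le> bessel_K1 s" "bessel_K1 s \<le> 1 / s" "bessel_K1 s \<le> 4 / s\<^sup>2" "1 / s - bessel_K1 s \<le> 1"
proof -
  show "0 \<le> bessel_K1 s" unfolding bessel_K1_def set_lebesgue_integral_def
    by (intro integral_nonneg_AE) (auto intro!: AE_I2)
  have "bessel_K1 s \<le> (LINT v:{0..}|lborel. exp (- s * v))"
    unfolding bessel_K1_def using s sqrt_one_plus_bounds(2)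
    by (intro set_integral_mono half_line_exp set_integrable_K1) auto
  then show "bessel_K1 s \<le> 1 / s" using half_line_exp(2)[OF s] by simp
  have "bessel_K1 s \<le> (LINT v:{0..}|lborel. exp (- s / 2) * exp (- (s / 2) * v))"
    unfolding bessel_K1_def
  proof (intro set_integral_mono set_integrable_mult_right half_line_exp set_integrable_K1 s)
    fix v :: real assume v: "v \<in> {0..}"
    have "(1 + v) / 2 \<le> sqrt (1 + v\<^sup>2)"
    proof -
      have "v \<ge> 0" using v by simp
      moreover have "1 \<le> w \<Longrightarrow> v \<le> w \<Longrightarrow> (1 + v) / 2 \<le> w" for w :: real by simp
      ultimately show ?thesis using sqrt_one_plus_bounds(1,2) by blast
    qed
    then have "s * ((1 + v) / 2) \<le> s * sqrt (1 + v\<^sup>2)"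
      using s by (intro mult_left_mono) auto
    then show "exp (- s * sqrt (1 + v\<^sup>2)) \<le> exp (- s / 2) * exp (- (s / 2) * v)"
      by (simp add: algebra_simps flip: exp_add)
  qed (use s in auto)
  also have "\<dots> = exp (- s / 2) * (2 / s)" using half_line_exp(2)[of "s/2"] s by simp
  also have "\<dots> \<le> (2 / s) * (2 / s)"
  proof (rule mult_right_mono)
    show "exp (- s / 2) \<le> 2 / s" using mult_exp_minus_le[of "s/2"] s by (simp add: field_simps)
  qed (use s in auto)
  finally show "bessel_K1 s \<le> 4 / s\<^sup>2" by (simp add: power2_eq_square)
  have "1 / s - bessel_K1 s = (LINT v:{0..}|lborel. exp (- s * v) - exp (- s * sqrt (1 + v\<^sup>2)))"
    unfolding bessel_K1_def using half_line_exp[OF s] set_integrable_K1[OF s] by simp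
  also have "\<dots> \<le> (LINT v:{0..}|lborel. s * exp (- s * v))"
  proof (intro set_integral_mono set_integral_diff set_integrable_mult_right half_line_exp set_integrable_K1 s)
    fix v :: real assume v: "v \<in> {0..}"
    define w where "w = sqrt (1 + v\<^sup>2)"
    have "exp (- s * w) = exp (- s * v) * exp (- (s * (w - v)))"
      by (simp add: algebra_simps flip: exp_add)
    moreover have "1 - s \<le> exp (- (s * (w - v)))"
    proof -
      have "s * (w - v) \<le> s * 1" using sqrt_one_plus_bounds(3)[of v] v s by (intro mult_left_mono) (auto simp: w_def)
      then show ?thesis using exp_ge_add_one_self[of "- (s * (w - v))"] by linarith
    qed
    ultimately have "exp (- s * w) \<ge> exp (- s * v) * (1 - s)" by (simp add: mult_left_mono)
    then show "exp (- s * v) - exp (- s * sqrt (1 + v\<^sup>2)) \<le> s * exp (- s * v)"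
      by (simp add: w_def algebra_simps)
  qed
  also have "\<dots> = 1" using half_line_exp(2)[OF s] s by simp
  finally show "1 / s - bessel_K1 s \<le> 1" .
qed

section \<open>Explicit formulas, log-Lipschitz bounds and comparison of the two kernels\<close>

section \<open>Kernels\<close>

definition rot :: "real^2 \<Rightarrow> real^2" where
  "rot z = vector [- z $ 2, z $ 1]"

lemma rot_linear: "rot (x - y) = rot x - rot y" "rot (c *\<^sub>R x) = c *\<^sub>R rot x" "rot 0 = 0"
  by (simp_all add: rot_def vec_eq_iff forall_2)

lemma norm_rot [simp]: "norm (rot z) = norm z"
  by (simp add: rot_def norm_eq_sqrt_inner inner_vec_def sum_2 add.commute)

lemma continuous_on_rot [continuous_intros]: "continuous_on S f \<Longrightarrow> continuous_on S (\<lambda>x. rot (f x))"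
proof -
  have "continuous_on UNIV rot"
    by (rule linear_continuous_on, rule linear_linear[THEN iffD2])
       (auto simp: rot_def linear_iff vec_eq_iff forall_2)
  then show "continuous_on S f \<Longrightarrow> continuous_on S (\<lambda>x. rot (f x))"
    by (metis continuous_on_compose2 subset_UNIV)
qed

text \<open>The gradient of a radial function points along x - y, and \<open>nabla_perp\<close> is
  the gradient turned by a right angle, which is the map \<open>rot\<close>.\<close>

lemma nabla_perp_radial:
  fixes x y :: "real^2"
  assumes "x \<noteq> y" and g: "(g has_real_derivative g') (at (norm (x - y)))"
  shows "nabla_perp (\<lambda>x. g (norm (x - y))) x = (g' / norm (x - y)) *\<^sub>R rot (x - y)"
proof -
  have "((\<lambda>x. norm (x - y)) has_derivative (\<lambda>h. inner h (sgn (x - y)))) (at x)"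
  proof -
    have "(norm has_derivative (\<lambda>h. inner h (sgn (x - y)))) (at (x - y))"
      by (rule has_derivative_norm) (use \<open>x \<noteq> y\<close> in simp)
    moreover have "((\<lambda>x. x - y) has_derivative (\<lambda>h. h)) (at x)" by (auto intro!: derivative_eq_intros)
    ultimately show ?thesis using has_derivative_compose by blast
  qed
  then have "((\<lambda>x. g (norm (x - y))) has_derivative (\<lambda>h. g' * inner h (sgn (x - y)))) (at x)"
    using has_derivative_compose[where g = g and f = "\<lambda>x. norm (x - y)"] g unfolding has_field_derivative_def by blast
  then have "frechet_derivative (\<lambda>x. g (norm (x - y))) (at x) = (\<lambda>h. g' * inner h (sgn (x - y)))"
    by (rule frechet_derivative_at[symmetric])
  then show ?thesis
    by (simp add: nabla_perp_def rot_def vec_eq_iff forall_2 inner_axis' sgn_div_norm divide_inverse algebra_simps)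
qed

text \<open>On the diagonal both sides vanish because \<open>rot 0 = 0\<close>, so later estimates
  need no exception at x = y.\<close>

lemma euler_kernel_eq: "euler_kernel x y = (1 / (2 * pi)) *\<^sub>R ((1 / (norm (x - y))\<^sup>2) *\<^sub>R rot (x - y))"
proof (cases "x = y")
  case False
  have "nabla_perp (\<lambda>x. ln (norm (x - y))) x = ((1 / norm (x - y)) / norm (x - y)) *\<^sub>R rot (x - y)"
    using False by (intro nabla_perp_radial) (auto intro!: derivative_eq_intros)
  then show ?thesis using False by (simp add: euler_kernel_def power2_eq_square)
qed (simp add: euler_kernel_def rot_linear)

text \<open>Up to the factor 1/(2 \<pi>) this is the vortex kernel with \<alpha> = 1 as a function
  of x - y; other parameters are obtained by scaling. It vanishes at z = 0 because
  \<open>rot 0 = 0\<close>.\<close>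

definition vortex_profile :: "real^2 \<Rightarrow> real^2" where
  "vortex_profile z = ((1 / norm z - bessel_K1 (norm z)) / norm z) *\<^sub>R rot z"

lemma vortex_kernel_off_diagonal:
  fixes x y :: "real^2"
  defines "r \<equiv> norm (x - y)"
  assumes a: "\<alpha> > 0" and "x \<noteq> y"
  shows "vortex_kernel \<alpha> x y = (1 / (2 * pi) * ((1 / r - bessel_K1 (r / \<alpha>) / \<alpha>) / r)) *\<^sub>R rot (x - y)"
proof -
  have r: "r > 0" using \<open>x \<noteq> y\<close> by (simp add: r_def)
  have "((\<lambda>r. bessel_K0 (r / \<alpha>)) has_real_derivative - bessel_K1 (r / \<alpha>) * (1 / \<alpha>)) (at r)"
    using bessel_K0_has_derivative[of "r / \<alpha>"] r a
    by (intro DERIV_chain2[where f = bessel_K0 and g = "\<lambda>r. r / \<alpha>"]) (auto intro!: derivative_eq_intros)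
  then have "((\<lambda>r. 1 / (2 * pi) * bessel_K0 (r / \<alpha>) + 1 / (2 * pi) * ln r) has_real_derivative
      1 / (2 * pi) * (- bessel_K1 (r / \<alpha>) * (1 / \<alpha>)) + 1 / (2 * pi) * (1 / r)) (at r)"
    using r by (intro DERIV_add DERIV_cmult) (auto intro!: derivative_eq_intros)
  moreover have "vortex_G \<alpha> = (\<lambda>r. 1 / (2 * pi) * bessel_K0 (r / \<alpha>) + 1 / (2 * pi) * ln r)"
    by (rule ext) (simp add: vortex_G_def)
  moreover have "1 / (2 * pi) * (- bessel_K1 (r / \<alpha>) * (1 / \<alpha>)) + 1 / (2 * pi) * (1 / r) =
      1 / (2 * pi) * (1 / r - bessel_K1 (r / \<alpha>) / \<alpha>)"
    by (simp add: algebra_simps)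
  ultimately have "(vortex_G \<alpha> has_real_derivative 1 / (2 * pi) * (1 / r - bessel_K1 (r / \<alpha>) / \<alpha>)) (at r)"
    by simp
  from nabla_perp_radial[OF \<open>x \<noteq> y\<close> this[unfolded r_def]] \<open>x \<noteq> y\<close> show ?thesis
    by (simp add: vortex_kernel_def r_def)
qed

lemma vortex_kernel_eq:
  assumes a: "\<alpha> > 0"
  shows "vortex_kernel \<alpha> x y = (1 / (2 * pi * \<alpha>)) *\<^sub>R vortex_profile ((x - y) /\<^sub>R \<alpha>)"
proof (cases "x = y")
  case False
  define r where "r = norm (x - y)"
  have r: "r > 0" using False by (simp add: r_def)
  have n: "norm ((x - y) /\<^sub>R \<alpha>) = r / \<alpha>" using a by (simp add: r_def divide_inverse mult.commute)
  have "1 / (2 * pi) * ((1 / r - bessel_K1 (r / \<alpha>) / \<alpha>) / r) =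
      1 / (2 * pi * \<alpha>) * ((1 / (r / \<alpha>) - bessel_K1 (r / \<alpha>)) / (r / \<alpha>) * inverse \<alpha>)"
    using a r by (simp add: field_simps)
  then show ?thesis
    unfolding vortex_kernel_off_diagonal[OF a False] vortex_profile_def n rot_linear(2) scaleR_scaleR
    by (simp flip: r_def)
qed (simp add: vortex_kernel_def vortex_profile_def rot_linear)

text \<open>The length is 1/s - K_1(s) with s = |z|, in which the singularities at 0 cancel.\<close>

lemma norm_vortex_profile: "norm (vortex_profile z) \<le> 1"
proof (cases "z = 0")
  case False
  then have n: "norm z > 0" by simp
  have "norm (vortex_profile z) = 1 / norm z - bessel_K1 (norm z)"
    using n bessel_K1_bounds(2)[OF n] by (simp add: vortex_profile_def)
  then show ?thesis using bessel_K1_bounds(4)[OF n] by simp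
qed (simp add: vortex_profile_def rot_linear)

lemma power2_norm_scaled_diff:
  fixes a b :: "'a::real_inner"
  shows "(norm (s *\<^sub>R a - t *\<^sub>R b))\<^sup>2 = s\<^sup>2 * (norm a)\<^sup>2 + t\<^sup>2 * (norm b)\<^sup>2 - 2 * s * t * inner a b"
  unfolding power2_norm_eq_inner
  by (simp add: inner_diff_left inner_diff_right inner_commute power2_eq_square algebra_simps)

text \<open>Reduces Lipschitz bounds for radial fields to their scalar profiles. The identity
  \<open>e\<close> splits |s a - t b|^2 into a radial part and an angular part. The assumption
  \<open>d\<close> controls the first, the bounds on p and q the second, and s = t = 1 in the same
  identity reassembles |a - b|^2.\<close>

lemma norm_scaled_radial_diff:
  fixes a b :: "'a::real_inner"
  assumes A: "0 \<le> p" "p \<le> m" "0 \<le> q" "q \<le> m"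
    and d: "\<bar>norm a * p - norm b * q\<bar> \<le> m * \<bar>norm a - norm b\<bar>"
  shows "norm (p *\<^sub>R a - q *\<^sub>R b) \<le> m * norm (a - b)"
proof (rule power2_le_imp_le)
  have e: "(norm (s *\<^sub>R a - t *\<^sub>R b))\<^sup>2 = (norm a * s - norm b * t)\<^sup>2 + 2 * (s * t) * (norm a * norm b - inner a b)" for s t
    unfolding power2_norm_scaled_diff by (simp add: power2_eq_square algebra_simps)
  have "(norm a * p - norm b * q)\<^sup>2 \<le> (m * \<bar>norm a - norm b\<bar>)\<^sup>2"
    using power_mono[OF d, of 2] by simp
  also have "\<dots> = m\<^sup>2 * (norm a - norm b)\<^sup>2" by (simp add: power_mult_distrib)
  finally have 1: "(norm a * p - norm b * q)\<^sup>2 \<le> m\<^sup>2 * (norm a - norm b)\<^sup>2" .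
  have 2: "2 * (p * q) * (norm a * norm b - inner a b) \<le> 2 * (m * m) * (norm a * norm b - inner a b)"
    using A norm_cauchy_schwarz[of a b] by (intro mult_right_mono mult_left_mono mult_mono) auto
  have "(norm (p *\<^sub>R a - q *\<^sub>R b))\<^sup>2 \<le> m\<^sup>2 * ((norm a * 1 - norm b * 1)\<^sup>2 + 2 * (1 * 1) * (norm a * norm b - inner a b))"
    unfolding e using 1 2 by (simp add: power2_eq_square algebra_simps)
  also have "\<dots> = (m * norm (a - b))\<^sup>2"
    unfolding e[symmetric] by (simp add: power_mult_distrib)
  finally show "(norm (p *\<^sub>R a - q *\<^sub>R b))\<^sup>2 \<le> (m * norm (a - b))\<^sup>2" .
  show "0 \<le> m * norm (a - b)" using A by simp
qed

text \<open>As a function of r, exp(-r v) - exp(-r w) is the profile of one radial field in the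
  superposition of \<open>vortex_profile\<close>. The bounds show that it is nonnegative, at most
  linear, bounded, and Lipschitz with constant w - v.\<close>

lemma exp_diff_bounds:
  fixes v w r s :: real
  assumes v: "0 \<le> v" "v \<le> w" and r: "0 \<le> r"
  shows "0 \<le> exp (- r * v) - exp (- r * w)"
    and "exp (- r * v) - exp (- r * w) \<le> r * (w - v)"
    and "v * (exp (- r * v) - exp (- r * w)) \<le> (w - v) / 2"
    and "0 \<le> s \<Longrightarrow> \<bar>(exp (- r * v) - exp (- r * w)) - (exp (- s * v) - exp (- s * w))\<bar> \<le> (w - v) * \<bar>r - s\<bar>"
proof -
  have mono: "exp (- p * w) \<le> exp (- p * v)" if "p \<ge> 0" for p
    using v that by (auto intro: mult_left_mono)
  show "0 \<le> exp (- r * v) - exp (- r * w)" using mono[OF r] by simp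
  have f: "exp (- r * v) - exp (- r * w) \<le> exp (- r * v) * (r * (w - v))"
  proof -
    have "exp (- r * w) = exp (- r * v) * exp (- (r * (w - v)))" by (simp add: algebra_simps flip: exp_add)
    moreover have "exp (- r * v) * (1 - r * (w - v)) \<le> exp (- r * v) * exp (- (r * (w - v)))"
      using exp_ge_add_one_self[of "- (r * (w - v))"] by (intro mult_left_mono) auto
    ultimately show ?thesis by (simp add: algebra_simps)
  qed
  also have "\<dots> \<le> 1 * (r * (w - v))" using v r by (intro mult_right_mono) auto
  finally show "exp (- r * v) - exp (- r * w) \<le> r * (w - v)" by simp
  have "v * (exp (- r * v) - exp (- r * w)) \<le> v * (exp (- r * v) * (r * (w - v)))"
    using f v by (intro mult_left_mono) auto
  also have "\<dots> = ((r * v) * exp (- (r * v))) * (w - v)" by simp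
  also have "\<dots> \<le> 1 / 2 * (w - v)" using mult_exp_minus_le[of "r * v"] v by (intro mult_right_mono) auto
  finally show "v * (exp (- r * v) - exp (- r * w)) \<le> (w - v) / 2" by simp
  assume s: "0 \<le> s"
  have "norm ((exp (- r * v) - exp (- r * w)) - (exp (- s * v) - exp (- s * w))) \<le> (w - v) * norm (r - s)"
  proof (rule field_differentiable_bound[where S = "{0..}" and f' = "\<lambda>p. w * exp (- p * w) - v * exp (- p * v)"])
    fix p :: real assume p: "p \<in> {0..}"
    show "((\<lambda>r. exp (- r * v) - exp (- r * w)) has_real_derivative w * exp (- p * w) - v * exp (- p * v)) (at p within {0..})"
      by (auto intro!: derivative_eq_intros)
    have "w * exp (- p * w) - v * exp (- p * v) \<le> (w - v) * exp (- p * v)"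
      using mult_left_mono[OF mono[of p], of w] p v by (simp add: algebra_simps)
    also have "\<dots> \<le> (w - v) * 1" using p v by (intro mult_left_mono) auto
    finally have u: "w * exp (- p * w) - v * exp (- p * v) \<le> w - v" by simp
    \<comment> \<open>The lower bound -(w - v) for the derivative says that x exp(-p x) + x does not
      decrease from v to w. Its derivative is nonnegative since p x exp(-p x) \<le> 1/2.\<close>
    have "v * exp (- p * v) + v \<le> w * exp (- p * w) + w"
    proof (rule DERIV_nonneg_imp_nondecreasing[OF v(2)])
      fix x assume "v \<le> x" "x \<le> w"
      have "((\<lambda>x. x * exp (- p * x) + x) has_real_derivative exp (- p * x) + x * (exp (- p * x) * (- p)) + 1) (at x)"
        by (auto intro!: derivative_eq_intros)
      moreover have "exp (- p * x) + x * (exp (- p * x) * (- p)) + 1 \<ge> 0"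
      proof -
        have "exp (- p * x) + x * (exp (- p * x) * (- p)) + 1 = exp (- p * x) - (p * x) * exp (- (p * x)) + 1" by simp
        then show ?thesis using mult_exp_minus_le[of "p * x"] exp_gt_zero[of "- p * x"] by linarith
      qed
      ultimately show "\<exists>y. ((\<lambda>x. x * exp (- p * x) + x) has_real_derivative y) (at x) \<and> 0 \<le> y" by blast
    qed
    then show "norm (w * exp (- p * w) - v * exp (- p * v)) \<le> w - v" using u by (simp add: abs_le_iff)
  qed (use r s in auto)
  then show "\<bar>(exp (- r * v) - exp (- r * w)) - (exp (- s * v) - exp (- s * w))\<bar> \<le> (w - v) * \<bar>r - s\<bar>" by simp
qed

text \<open>Since \<open>1 / s\<close> is the integral of \<open>exp (- s * v)\<close> over \<open>v \<ge> 0\<close>, the profile is a superposition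
  over \<open>v\<close> of radial fields. Each of them is Lipschitz with constant \<open>w v - v\<close> and bounded by
  \<open>(w v - v) / (2 * v)\<close>, where \<open>w v = sqrt (1 + v\<^sup>2)\<close> and \<open>w v - v \<le> min 1 (1 / v)\<close>.\<close>

lemma vortex_profile_log_lipschitz:
  assumes r: "0 < r" "r \<le> 1" and c: "c \<ge> 1" and ab: "norm (a - b) \<le> c * r"
  shows "norm (vortex_profile a - vortex_profile b) \<le> 2 * c * osgood_modulus r"
proof -
  define w where "w v = sqrt (1 + v\<^sup>2)" for v :: real
  \<comment> \<open>Dividing by |z| turns the profile into the coefficient of \<open>rot z\<close>.
    At z = 0 the coefficient is 0 by division, and \<open>rot z\<close> vanishes as well.\<close>
  define p where "p v z = (exp (- norm z * v) - exp (- norm z * w v)) / norm z" for v and z :: "real^2"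
  have int: "set_integrable lborel {0..} (\<lambda>v. p v z *\<^sub>R rot z)"
    and eq: "vortex_profile z = (LINT v:{0..}|lborel. p v z *\<^sub>R rot z)" for z :: "real^2"
  proof -
    have *: "set_integrable lborel {0..} (\<lambda>v. p v z) \<and> (1 / norm z - bessel_K1 (norm z)) / norm z = (LINT v:{0..}|lborel. p v z)"
      if "z \<noteq> 0"
      unfolding p_def w_def bessel_K1_def
      using that half_line_exp[of "norm z"] set_integrable_K1[of "norm z"]
      by (auto intro!: set_integrable_divide)
    show "set_integrable lborel {0..} (\<lambda>v. p v z *\<^sub>R rot z)"
      using * by (cases "z = 0") (auto simp: rot_linear set_integrable_def)
    show "vortex_profile z = (LINT v:{0..}|lborel. p v z *\<^sub>R rot z)"
      using * by (cases "z = 0") (auto simp: vortex_profile_def rot_linear set_lebesgue_integral_def set_integrable_def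
        simp flip: integral_scaleR_left)
  qed
  have pt: "norm (p v a *\<^sub>R rot a - p v b *\<^sub>R rot b) \<le> c * (min r (1 / v) * min 1 (1 / v))" if v: "v > 0" for v
  proof -
    have w: "1 \<le> w v" "v \<le> w v" "w v - v \<le> 1" "w v - v \<le> 1 / v"
      using sqrt_one_plus_bounds[of v] v by (auto simp: w_def field_simps)
    have np: "norm z * p v z = exp (- norm z * v) - exp (- norm z * w v)" for z
      by (cases "z = 0") (auto simp: p_def)
    have pm: "0 \<le> p v z" "p v z \<le> w v - v" for z
    proof -
      show "0 \<le> p v z" unfolding p_def using exp_diff_bounds(1)[of v "w v" "norm z"] v w by simp
      show "p v z \<le> w v - v"
        using exp_diff_bounds(2)[of v "w v" "norm z"] v w
        by (cases "z = 0") (auto simp: p_def field_simps)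
    qed
    have "norm (p v a *\<^sub>R a - p v b *\<^sub>R b) \<le> (w v - v) * norm (a - b)"
    proof (rule norm_scaled_radial_diff)
      show "\<bar>norm a * p v a - norm b * p v b\<bar> \<le> (w v - v) * \<bar>norm a - norm b\<bar>"
        unfolding np using exp_diff_bounds(4)[of v "w v" "norm a" "norm b"] v w by simp
    qed (auto intro: pm)
    then have 1: "norm (p v a *\<^sub>R rot a - p v b *\<^sub>R rot b) \<le> (w v - v) * norm (a - b)"
      by (simp flip: rot_linear)
    have n: "norm (p v z *\<^sub>R rot z) \<le> (w v - v) / (2 * v)" for z
    proof -
      have "norm (p v z *\<^sub>R rot z) = norm z * p v z" using pm[of z] by (simp add: mult.commute)
      also have "\<dots> \<le> (w v - v) / (2 * v)"
        unfolding np using exp_diff_bounds(3)[of v "w v" "norm z"] v w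
        by (simp only: pos_le_divide_eq[of "2 * v"]) (simp add: mult_ac)
      finally show ?thesis .
    qed
    have 2: "norm (p v a *\<^sub>R rot a - p v b *\<^sub>R rot b) \<le> (w v - v) * (1 / v)"
    proof -
      have "(w v - v) / (2 * v) + (w v - v) / (2 * v) = (w v - v) * (1 / v)" by (simp add: field_simps)
      then show ?thesis
        using norm_triangle_ineq4[of "p v a *\<^sub>R rot a" "p v b *\<^sub>R rot b"] n[of a] n[of b] by linarith
    qed
    \<comment> \<open>The Lipschitz bound is used for r \<le> 1/v and the uniform bound otherwise; c
      \<ge> 1 allows the same factor c in both cases.\<close>
    have "norm (p v a *\<^sub>R rot a - p v b *\<^sub>R rot b) \<le> (w v - v) * (c * min r (1 / v))"
    proof (cases "r \<le> 1 / v")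
      case True
      have "(w v - v) * norm (a - b) \<le> (w v - v) * (c * r)" using ab w by (intro mult_left_mono) auto
      then show ?thesis using 1 True by simp
    next
      case False
      have "1 * (1 / v) \<le> c * (1 / v)" using c v by (intro mult_right_mono) auto
      then have "(w v - v) * (1 / v) \<le> (w v - v) * (c * (1 / v))" using w by (intro mult_left_mono) auto
      then show ?thesis using 2 False by simp
    qed
    also have "\<dots> \<le> min 1 (1 / v) * (c * min r (1 / v))"
      using w v r c by (intro mult_right_mono) auto
    finally show ?thesis by (simp add: mult_ac)
  qed
  have "vortex_profile a - vortex_profile b = (LINT v:{0..}|lborel. p v a *\<^sub>R rot a - p v b *\<^sub>R rot b)"
    unfolding eq using int by simp
  also have "ennreal (norm \<dots>) \<le> (\<integral>\<^sup>+v. ennreal (norm (indicator {0..} v *\<^sub>R (p v a *\<^sub>R rot a - p v b *\<^sub>R rot b))) \<partial>lborel)"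
    unfolding set_lebesgue_integral_def
  proof (rule integral_norm_bound_ennreal)
    show "integrable lborel (\<lambda>v. indicator {0..} v *\<^sub>R (p v a *\<^sub>R rot a - p v b *\<^sub>R rot b))"
      using set_integral_diff(1)[OF int int] by (simp add: set_integrable_def)
  qed
  also have "\<dots> \<le> (\<integral>\<^sup>+v. ennreal c * (ennreal (min r (1 / v) * min 1 (1 / v)) * indicator {0<..} v) \<partial>lborel)"
  proof (rule nn_integral_mono_AE)
    \<comment> \<open>\<open>nn_integral_log_split\<close> integrates over v > 0, so the point 0 is
      discarded as a null set.\<close>
    have "AE v in lborel. v \<noteq> (0::real)" by (rule AE_lborel_singleton)
    then show "AE v in lborel. ennreal (norm (indicator {0..} v *\<^sub>R (p v a *\<^sub>R rot a - p v b *\<^sub>R rot b)))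
       \<le> ennreal c * (ennreal (min r (1 / v) * min 1 (1 / v)) * indicator {0<..} v)"
    proof eventually_elim
      case (elim v)
      show ?case
      proof (cases "v > 0")
        case True
        then have "ennreal (norm (p v a *\<^sub>R rot a - p v b *\<^sub>R rot b)) \<le> ennreal (c * (min r (1 / v) * min 1 (1 / v)))"
          using pt by (intro ennreal_leI)
        also have "\<dots> = ennreal c * ennreal (min r (1 / v) * min 1 (1 / v))"
          using c r True by (intro ennreal_mult) auto
        finally show ?thesis using True by simp
      next
        case False
        with elim show ?thesis by simp
      qed
    qed
  qed
  also have "\<dots> = ennreal c * (\<integral>\<^sup>+v. ennreal (min r (1 / v) * min 1 (1 / v)) * indicator {0<..} v \<partial>lborel)"
    by (rule nn_integral_cmult) measurable
  also have "\<dots> \<le> ennreal c * ennreal (2 * osgood_modulus r)"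
    by (intro mult_left_mono nn_integral_log_split r) auto
  also have "\<dots> = ennreal (2 * c * osgood_modulus r)"
    using c osgood_modulus_ge[OF r] r by (simp add: ennreal_mult[symmetric] mult_ac)
  finally show ?thesis using c osgood_modulus_ge[OF r] r by (simp add: ennreal_le_iff)
qed

lemma continuous_on_vortex_profile [continuous_intros]:
  assumes "continuous_on S f"
  shows "continuous_on S (\<lambda>x. vortex_profile (f x))"
proof -
  have "isCont vortex_profile a" for a
    unfolding continuous_at_eps_delta
  proof (intro allI impI)
    fix \<epsilon> :: real assume "\<epsilon> > 0"
    have "((\<lambda>r. 2 * osgood_modulus r) \<longlongrightarrow> 2 * 0) (at_right 0)" by (intro tendsto_intros osgood_modulus_tendsto_0)
    then have "\<forall>\<^sub>F r in at_right 0. 2 * osgood_modulus r < \<epsilon>" using \<open>\<epsilon> > 0\<close> by (simp add: order_tendstoD)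
    then obtain b where b: "b > 0" "\<And>r. 0 < r \<Longrightarrow> r < b \<Longrightarrow> 2 * osgood_modulus r < \<epsilon>"
      by (auto simp: eventually_at_right_field)
    define r where "r = min 1 (b / 2)"
    have r: "0 < r" "r \<le> 1" "r < b" using b by (auto simp: r_def)
    show "\<exists>d>0. \<forall>x'. dist x' a < d \<longrightarrow> dist (vortex_profile x') (vortex_profile a) < \<epsilon>"
    proof (intro exI[of _ r] conjI allI impI)
      fix x' assume "dist x' a < r"
      then have "norm (vortex_profile x' - vortex_profile a) \<le> 2 * 1 * osgood_modulus r"
        using r by (intro vortex_profile_log_lipschitz) (auto simp: dist_norm)
      then show "dist (vortex_profile x') (vortex_profile a) < \<epsilon>" using b(2)[OF r(1,3)] by (simp add: dist_norm)
    qed (use r in auto)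
  qed
  then have "continuous_on UNIV vortex_profile" by (simp add: continuous_at_imp_continuous_on)
  then show ?thesis using assms by (metis continuous_on_compose2 subset_UNIV)
qed

text \<open>By the convention \<open>1 / 0 = 0\<close> this includes \<open>X = 0\<close> and \<open>Y = 0\<close>.\<close>

lemma euler_kernel_diff_bound:
  fixes X Y :: "real^2"
  assumes r: "r > 0" and XY: "norm (X - Y) \<le> 2 * r"
  shows "norm ((1 / (norm X)\<^sup>2) *\<^sub>R rot X - (1 / (norm Y)\<^sup>2) *\<^sub>R rot Y) \<le>
    2 * min (1 / norm X) (r / (norm X)\<^sup>2) + 2 * min (1 / norm Y) (r / (norm Y)\<^sup>2)"
proof -
  define g where "g t = min (1 / t) (r / t\<^sup>2)" for t :: real
  have g0: "g t \<ge> 0" if "t \<ge> 0" for t using r that by (simp add: g_def)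
  \<comment> \<open>The inversion identity |X/|X|^2 - Y/|Y|^2| = |X - Y| / (|X| |Y|) with the
    shorter vector called X. Both bounds follow from |Y| \<ge> |X|, using |X - Y| \<le> 2 r for one
    and |X - Y| \<le> 2 |Y| for the other.\<close>
  have sym: "norm ((1 / (norm X)\<^sup>2) *\<^sub>R X - (1 / (norm Y)\<^sup>2) *\<^sub>R Y) \<le> 2 * g (norm X)"
    if le: "norm X \<le> norm Y" "X \<noteq> 0" and XY: "norm (X - Y) \<le> 2 * r" for X Y :: "real^2"
  proof -
    have nX: "norm X > 0" "norm Y > 0" using le zero_less_norm_iff[of X] by linarith+
    have "(norm ((1 / (norm X)\<^sup>2) *\<^sub>R X - (1 / (norm Y)\<^sup>2) *\<^sub>R Y))\<^sup>2 = (norm (X - Y) / (norm X * norm Y))\<^sup>2"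
    proof -
      have "(norm ((1 / (norm X)\<^sup>2) *\<^sub>R X - (1 / (norm Y)\<^sup>2) *\<^sub>R Y))\<^sup>2 =
        (1 / (norm X)\<^sup>2)\<^sup>2 * (norm X)\<^sup>2 + (1 / (norm Y)\<^sup>2)\<^sup>2 * (norm Y)\<^sup>2 - 2 * (1 / (norm X)\<^sup>2) * (1 / (norm Y)\<^sup>2) * inner X Y"
        unfolding power2_norm_scaled_diff by simp
      moreover have "(norm (X - Y))\<^sup>2 = (norm X)\<^sup>2 + (norm Y)\<^sup>2 - 2 * inner X Y"
        using power2_norm_scaled_diff[of 1 X 1 Y] by simp
      ultimately show ?thesis using nX by (simp only: power_divide power_mult_distrib) (simp add: field_simps power2_eq_square)
    qed
    then have e: "norm ((1 / (norm X)\<^sup>2) *\<^sub>R X - (1 / (norm Y)\<^sup>2) *\<^sub>R Y) = norm (X - Y) / (norm X * norm Y)"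
      using nX by (simp add: power2_eq_iff_nonneg)
    have "norm (X - Y) / (norm X * norm Y) \<le> 2 * (r / (norm X)\<^sup>2)"
    proof -
      have "norm (X - Y) / (norm X * norm Y) \<le> (2 * r) / (norm X * norm X)"
        using nX XY le r by (intro frac_le mult_left_mono) auto
      then show ?thesis by (simp add: power2_eq_square)
    qed
    moreover have "norm (X - Y) / (norm X * norm Y) \<le> 2 * (1 / norm X)"
    proof -
      have "norm (X - Y) \<le> 2 * norm Y" using norm_triangle_ineq4[of X Y] le by simp
      then show ?thesis using nX by (simp add: field_simps)
    qed
    ultimately show ?thesis unfolding e g_def by simp
  qed
  \<comment> \<open>If one of the vectors is 0, the other has length at most 2 r, so 1/|Y| \<le> 2
    r/|Y|^2.\<close>
  have zero: "norm ((1 / (norm Y)\<^sup>2) *\<^sub>R Y) \<le> 2 * g (norm Y)" if "norm Y \<le> 2 * r" for Y :: "real^2"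
  proof (cases "Y = 0")
    case False
    then have "norm ((1 / (norm Y)\<^sup>2) *\<^sub>R Y) = 1 / norm Y" by (simp add: power2_eq_square)
    moreover have "1 / norm Y \<le> 2 * (1 / norm Y)" by (simp add: divide_right_mono)
    moreover have "1 / norm Y \<le> 2 * (r / (norm Y)\<^sup>2)" using that False by (simp add: power2_eq_square field_simps)
    ultimately show ?thesis unfolding g_def min_def by presburger
  qed (simp add: g_def)
  have "norm ((1 / (norm X)\<^sup>2) *\<^sub>R X - (1 / (norm Y)\<^sup>2) *\<^sub>R Y) \<le> 2 * g (norm X) + 2 * g (norm Y)"
  proof -
    consider "X = 0" | "Y = 0" | "X \<noteq> 0" "norm X \<le> norm Y" | "Y \<noteq> 0" "norm Y \<le> norm X" by linarith
    then show ?thesis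
    proof cases
      case 1
      then show ?thesis using zero[of Y] XY g0[of 0] by simp
    next
      case 2
      then show ?thesis using zero[of X] XY g0[of 0] by simp
    next
      case 3
      then show ?thesis using sym[of X Y] XY g0[of "norm Y"] by simp
    next
      case 4
      then show ?thesis using sym[of Y X] XY g0[of "norm X"] by (simp add: norm_minus_commute)
    qed
  qed
  then show ?thesis by (simp add: g_def flip: rot_linear)
qed

text \<open>The difference has length K_1(r/\<alpha>) / (2 \<pi> \<alpha>), and the bounds 1/s and
  4/s^2 for K_1 are rescaled. The estimate 1/(2 \<pi>) \<le> 1/4 absorbs the factor 4.\<close>

lemma euler_vortex_kernel_diff_bound:
  assumes a: "\<alpha> > 0"
  shows "norm (euler_kernel x y - vortex_kernel \<alpha> x y) \<le> min (1 / norm (x - y)) (\<alpha> / (norm (x - y))\<^sup>2)"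
proof (cases "x = y")
  case False
  define r where "r = norm (x - y)"
  have r: "r > 0" using False by (simp add: r_def)
  have "1 / (2 * pi) * (1 / r\<^sup>2) - 1 / (2 * pi) * ((1 / r - bessel_K1 (r / \<alpha>) / \<alpha>) / r)
      = 1 / (2 * pi) * (bessel_K1 (r / \<alpha>) / \<alpha> / r)"
    using a r by (simp add: field_simps power2_eq_square)
  then have "euler_kernel x y - vortex_kernel \<alpha> x y = (1 / (2 * pi) * (bessel_K1 (r / \<alpha>) / \<alpha> / r)) *\<^sub>R rot (x - y)"
    unfolding euler_kernel_eq vortex_kernel_off_diagonal[OF a False] scaleR_scaleR
    by (simp add: r_def flip: scaleR_diff_left)
  then have "norm (euler_kernel x y - vortex_kernel \<alpha> x y) = 1 / (2 * pi) * (bessel_K1 (r / \<alpha>) / \<alpha>)"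
    using a r bessel_K1_bounds(1)[of "r / \<alpha>"] by (simp add: abs_mult flip: r_def)
  moreover have "1 / (2 * pi) * (bessel_K1 (r / \<alpha>) / \<alpha>) \<le> 1 / 4 * (bessel_K1 (r / \<alpha>) / \<alpha>)"
    using a r bessel_K1_bounds(1)[of "r / \<alpha>"] pi_ge_two by (intro mult_right_mono) (auto simp: field_simps)
  moreover have "bessel_K1 (r / \<alpha>) / \<alpha> \<le> 1 / r"
    using bessel_K1_bounds(2)[of "r / \<alpha>"] a r by (simp add: field_simps)
  moreover have "bessel_K1 (r / \<alpha>) / \<alpha> \<le> 4 * (\<alpha> / r\<^sup>2)"
    using bessel_K1_bounds(3)[of "r / \<alpha>"] a r by (simp add: field_simps power2_eq_square)
  moreover have "0 \<le> bessel_K1 (r / \<alpha>) / \<alpha>" using bessel_K1_bounds(1)[of "r / \<alpha>"] a r by simp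
  ultimately have "norm (euler_kernel x y - vortex_kernel \<alpha> x y) \<le> 1 / r"
    "norm (euler_kernel x y - vortex_kernel \<alpha> x y) \<le> \<alpha> / r\<^sup>2" by linarith+
  then show ?thesis by (simp add: r_def)
qed (simp add: euler_kernel_def vortex_kernel_def)

section \<open>Finiteness of the variations, and the Jordan decomposition of a density\<close>

section \<open>Signed measures\<close>

lemma signed_measure_Un:
  assumes q: "signed_measure q" and AB: "A \<in> sets borel" "B \<in> sets borel" "A \<inter> B = {}"
  shows "q (A \<union> B) = q A + q B"
proof -
  have "range (binaryset A B) \<subseteq> sets borel" using AB by (auto simp: range_binaryset_eq)
  moreover have "disjoint_family (binaryset A B)"
    using AB by (auto simp: disjoint_family_on_def binaryset_def)
  ultimately have "(\<lambda>n. q (binaryset A B n)) sums q (\<Union>n. binaryset A B n)"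
    using q by (simp add: signed_measure_def)
  moreover have "(\<lambda>n. q (binaryset A B n)) sums (q A + q B)"
    using q by (intro binaryset_sums) (simp add: signed_measure_def)
  ultimately show ?thesis using sums_unique2 UN_binaryset_eq by metis
qed

text \<open>If \<open>q\<close> were unbounded, then repeatedly splitting a Borel set on whose subsets \<open>q\<close> is
  unbounded would produce disjoint sets \<open>A\<^sub>n\<close> with \<open>\<bar>q A\<^sub>n\<bar> \<ge> 1\<close>, contradicting countable additivity.\<close>

lemma signed_measure_bounded:
  fixes q :: "'a::topological_space set \<Rightarrow> real"
  assumes q: "signed_measure q"
  shows "\<exists>B. \<forall>A\<in>sets borel. \<bar>q A\<bar> \<le> B"
proof (rule ccontr)
  assume unbounded: "\<not> ?thesis"
  define bad where "bad E \<longleftrightarrow> E \<in> sets borel \<and> (\<forall>B. \<exists>A\<in>sets borel. A \<subseteq> E \<and> \<bar>q A\<bar> > B)" for E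
  have bad_UNIV: "bad UNIV"
    using unbounded by (auto simp: bad_def not_le)
  have "\<exists>E'. bad E' \<and> E' \<subseteq> E \<and> \<bar>q (E - E')\<bar> \<ge> 1" if E: "bad E" for E
  proof -
    have Eb: "E \<in> sets borel" using E by (simp add: bad_def)
    \<comment> \<open>With this margin both A and E - A have |q| at least 1. Whichever part is kept
      because q is unbounded on its subsets, the discarded one carries at least 1.\<close>
    obtain A where A: "A \<in> sets borel" "A \<subseteq> E" "\<bar>q A\<bar> > \<bar>q E\<bar> + 1"
      using E unfolding bad_def by meson
    have qE: "q E = q A + q (E - A)"
      using signed_measure_Un[OF q A(1), of "E - A"] A Eb by (simp add: Un_absorb1)
    have "bad A \<or> bad (E - A)"
    proof (rule ccontr)
      assume "\<not> (bad A \<or> bad (E - A))"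
      then obtain B1 B2 where B: "\<And>C. C \<in> sets borel \<Longrightarrow> C \<subseteq> A \<Longrightarrow> \<bar>q C\<bar> \<le> B1"
          "\<And>C. C \<in> sets borel \<Longrightarrow> C \<subseteq> E - A \<Longrightarrow> \<bar>q C\<bar> \<le> B2"
        using A(1) Eb unfolding bad_def by (metis linorder_not_le sets.Diff[of E borel A])
      obtain C where C: "C \<in> sets borel" "C \<subseteq> E" "\<bar>q C\<bar> > B1 + B2" using E unfolding bad_def by meson
      have "(C \<inter> A) \<inter> (C - A) = {}" "(C \<inter> A) \<union> (C - A) = C" by blast+
      then have "q C = q (C \<inter> A) + q (C - A)"
        using signed_measure_Un[OF q, of "C \<inter> A" "C - A"] C(1) A(1) sets.Int sets.Diff by metis
      moreover have "\<bar>q (C \<inter> A)\<bar> \<le> B1" "\<bar>q (C - A)\<bar> \<le> B2"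
        using A C by (auto intro!: B)
      ultimately show False using C(3) by linarith
    qed
    then show ?thesis
    proof
      assume "bad A"
      moreover have "\<bar>q (E - A)\<bar> \<ge> 1" using qE A(3) by linarith
      ultimately show ?thesis using A by blast
    next
      assume "bad (E - A)"
      moreover have "E - (E - A) = A" using A by blast
      moreover have "\<bar>q A\<bar> \<ge> 1" using A(3) by linarith
      ultimately show ?thesis by (metis Diff_subset)
    qed
  qed
  then obtain F where F: "\<And>E. bad E \<Longrightarrow> bad (F E) \<and> F E \<subseteq> E \<and> \<bar>q (E - F E)\<bar> \<ge> 1" by metis
  define S where "S n = (F ^^ n) UNIV" for n
  have S: "bad (S n)" for n
    by (induction n) (use bad_UNIV F in \<open>auto simp: S_def\<close>)
  have Sm: "decseq S" by (rule decseq_SucI) (use F S in \<open>auto simp: S_def\<close>)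
  define A where "A n = S n - S (Suc n)" for n
  have "disjoint_family A"
  proof -
    have "A m \<inter> A n = {}" if "m < n" for m n
      using decseqD[OF Sm, of "Suc m" n] that by (auto simp: A_def)
    then show ?thesis unfolding disjoint_family_on_def
      by (metis Int_commute linorder_neqE_nat)
  qed
  moreover have "range A \<subseteq> sets borel" using S by (auto simp: A_def bad_def)
  ultimately have "(\<lambda>n. q (A n)) sums q (\<Union>n. A n)" using q by (simp add: signed_measure_def)
  then have "(\<lambda>n. q (A n)) \<longlonglongrightarrow> 0" by (intro summable_LIMSEQ_zero sums_summable)
  then have "\<forall>\<^sub>F n in sequentially. \<bar>q (A n)\<bar> < 1"
    by (auto dest!: tendstoD[of _ _ _ 1] simp: dist_real_def)
  then obtain n where "\<bar>q (A n)\<bar> < 1" by (auto simp: eventually_sequentially)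
  moreover have "\<bar>q (A n)\<bar> \<ge> 1" using F[OF S[of n]] by (simp add: A_def S_def)
  ultimately show False by simp
qed

lemma signed_measure_uminus: "signed_measure q \<Longrightarrow> signed_measure (\<lambda>A. - q A)"
  by (simp add: signed_measure_def sums_minus)

lemma sets_pos_variation [simp, measurable_cong]: "sets (pos_variation q) = sets borel"
  and space_pos_variation [simp]: "space (pos_variation q) = UNIV"
  by (simp_all add: pos_variation_def sets_measure_of_conv space_measure_of_conv
      sets.sigma_sets_eq[of borel, simplified])

lemma sets_neg_variation [simp, measurable_cong]: "sets (neg_variation q) = sets borel"
  and space_neg_variation [simp]: "space (neg_variation q) = UNIV"
  by (simp_all add: neg_variation_def)

text \<open>\<open>measure_of\<close> returns the given set function if it is a measure and the zero
  measure otherwise. In either case the total mass is at most the supremum of q, which is finite by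
  \<open>signed_measure_bounded\<close>.\<close>

lemma finite_measure_pos_variation:
  assumes "signed_measure q"
  shows "finite_measure (pos_variation q)"
proof
  obtain B where B: "\<And>A. A \<in> sets borel \<Longrightarrow> \<bar>q A\<bar> \<le> B" using signed_measure_bounded[OF assms] by blast
  have "emeasure (pos_variation q) UNIV \<le> (SUP B\<in>{B \<in> sets borel. B \<subseteq> UNIV}. ennreal (q B))"
    by (simp add: pos_variation_def emeasure_measure_of_conv)
  also have "\<dots> \<le> ennreal B"
    using B by (intro SUP_least ennreal_leI) (auto simp: abs_le_iff)
  finally show "emeasure (pos_variation q) (space (pos_variation q)) \<noteq> \<infinity>"
    by (auto simp: top_unique)
qed

lemma finite_measure_neg_variation: "signed_measure q \<Longrightarrow> finite_measure (neg_variation q)"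
  unfolding neg_variation_def by (intro finite_measure_pos_variation signed_measure_uminus)

text \<open>The supremum over Borel subsets of A is attained at the part of A where w > 0. The set
  function in \<open>pos_variation\<close> thus agrees on Borel sets with a genuine measure, which
  \<open>measure_of\<close> then returns; \<open>ennreal\<close> reduces the density to the positive
  part of w.\<close>

lemma pos_variation_density_measure:
  fixes w :: "'a::euclidean_space \<Rightarrow> real"
  assumes w: "integrable lborel w"
  shows "pos_variation (density_measure w) = density lborel (\<lambda>x. ennreal (w x))"
proof -
  have wm[measurable]: "w \<in> borel_measurable borel" using w by (simp add: borel_measurable_integrable)
  have iB: "integrable lborel (\<lambda>x. indicator B x * w x)" if "B \<in> sets borel" for B
    using integrable_mult_indicator[of B lborel w] that w by simp
  let ?M = "density lborel (\<lambda>x. ennreal (w x))"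
  have sup: "(SUP B\<in>{B \<in> sets borel. B \<subseteq> A}. ennreal (density_measure w B)) = emeasure ?M A"
    if A: "A \<in> sets borel" for A
  proof (rule antisym)
    note [measurable] = A
    have em: "emeasure ?M A = (\<integral>\<^sup>+x. ennreal (w x) * indicator A x \<partial>lborel)"
      by (subst emeasure_density) auto
    show "(SUP B\<in>{B \<in> sets borel. B \<subseteq> A}. ennreal (density_measure w B)) \<le> emeasure ?M A"
    proof (rule SUP_least)
      fix B assume "B \<in> {B \<in> sets borel. B \<subseteq> A}"
      then have B[measurable]: "B \<in> sets borel" and BA: "B \<subseteq> A" by auto
      have "density_measure w B \<le> (LINT x|lborel. max 0 (indicator B x * w x))"
        unfolding density_measure_def set_lebesgue_integral_def
        using iB[OF B] by (intro integral_mono integrable_max) auto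
      then have "ennreal (density_measure w B) \<le> ennreal (LINT x|lborel. max 0 (indicator B x * w x))"
        by (rule ennreal_leI)
      also have "\<dots> = (\<integral>\<^sup>+x. ennreal (max 0 (indicator B x * w x)) \<partial>lborel)"
        using iB[OF B] by (intro nn_integral_eq_integral[symmetric] integrable_max) auto
      also have "\<dots> \<le> (\<integral>\<^sup>+x. ennreal (w x) * indicator A x \<partial>lborel)"
        using BA by (intro nn_integral_mono) (auto simp: indicator_def ennreal_max_0)
      finally show "ennreal (density_measure w B) \<le> emeasure ?M A" by (simp add: em)
    qed
    define P where "P = A \<inter> {x. w x > 0}"
    have Pm[measurable]: "P \<in> sets borel" unfolding P_def by measurable
    have "emeasure ?M A = (\<integral>\<^sup>+x. ennreal (indicator P x * w x) \<partial>lborel)"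
      unfolding em by (intro nn_integral_cong) (auto simp: P_def indicator_def ennreal_neg)
    also have "\<dots> = ennreal (LINT x|lborel. indicator P x * w x)"
      by (intro nn_integral_eq_integral iB Pm AE_I2) (auto simp: P_def indicator_def)
    also have "\<dots> = ennreal (density_measure w P)"
      by (simp add: density_measure_def set_lebesgue_integral_def)
    also have "\<dots> \<le> (SUP B\<in>{B \<in> sets borel. B \<subseteq> A}. ennreal (density_measure w B))"
      by (rule SUP_upper) (auto simp: P_def intro!: Pm[unfolded P_def])
    finally show "emeasure ?M A \<le> (SUP B\<in>{B \<in> sets borel. B \<subseteq> A}. ennreal (density_measure w B))" .
  qed
  have ss: "sigma_sets UNIV (sets borel) = (sets borel :: 'a set set)"
    using sets.sigma_sets_eq[of borel] by simp
  have "pos_variation (density_measure w) = measure_of UNIV (sets borel) (emeasure ?M)"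
    unfolding pos_variation_def by (rule measure_of_eq) (auto simp: ss sup)
  also have "\<dots> = ?M"
    using measure_of_of_measure[of ?M] by simp
  finally show ?thesis .
qed

lemma neg_variation_density_measure:
  assumes "integrable lborel w"
  shows "neg_variation (density_measure w) = density lborel (\<lambda>x. ennreal (- w x))"
proof -
  have "(\<lambda>A. - density_measure w A) = density_measure (\<lambda>x. - w x)"
    by (rule ext) (simp add: density_measure_def set_lebesgue_integral_def)
  then show ?thesis
    unfolding neg_variation_def using assms by (simp add: pos_variation_density_measure)
qed

lemma integrable_scaleR_bounded:
  fixes w :: "'a \<Rightarrow> real" and f :: "'a \<Rightarrow> 'b::{banach, second_countable_topology}"
  assumes w: "integrable M w" and f: "f \<in> borel_measurable M" and C: "\<And>x. norm (f x) \<le> C"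
  shows "integrable M (\<lambda>x. w x *\<^sub>R f x)"
proof (rule Bochner_Integration.integrable_bound)
  show "integrable M (\<lambda>x. C * w x)" using w by simp
  have "norm (w x *\<^sub>R f x) \<le> norm (C * w x)" for x
    using mult_right_mono[OF order_trans[OF C[of x] abs_ge_self], of "\<bar>w x\<bar>"] by (simp add: abs_mult mult.commute)
  then show "AE x in M. norm (w x *\<^sub>R f x) \<le> norm (C * w x)" by simp
qed (use w f in measurable)

lemma signed_integral_density_measure:
  fixes f :: "'a::euclidean_space \<Rightarrow> 'b::{banach, second_countable_topology}"
  assumes w: "integrable lborel w" and f: "f \<in> borel_measurable borel" and C: "\<And>x. norm (f x) \<le> C"
  shows "signed_integral (density_measure w) f = (LINT x|lborel. w x *\<^sub>R f x)"
proof -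
  have wm[measurable]: "w \<in> borel_measurable borel" using w by (simp add: borel_measurable_integrable)
  note [measurable] = f
  \<comment> \<open>\<open>integral_density\<close> works with nonnegative real densities, so the
    truncation hidden in \<open>ennreal\<close> is made explicit.\<close>
  have dens: "density lborel (\<lambda>x. ennreal (v x)) = density lborel (\<lambda>x. ennreal (max 0 (v x)))"
    if "v \<in> borel_measurable borel" for v :: "'a \<Rightarrow> real"
    by (rule density_cong) (use that in \<open>auto simp: ennreal_max_0\<close>)
  have i: "integrable lborel (\<lambda>x. max 0 (w x) *\<^sub>R f x)" "integrable lborel (\<lambda>x. max 0 (- w x) *\<^sub>R f x)"
    using w f C by (auto intro!: integrable_scaleR_bounded integrable_max)
  have "signed_integral (density_measure w) f =
      (LINT x|lborel. max 0 (w x) *\<^sub>R f x) - (LINT x|lborel. max 0 (- w x) *\<^sub>R f x)"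
    unfolding signed_integral_def pos_variation_density_measure[OF w] neg_variation_density_measure[OF w]
    using f by (subst dens[of w], simp, subst dens[of "\<lambda>x. - w x"], simp) (simp add: integral_density)
  also have "\<dots> = (LINT x|lborel. max 0 (w x) *\<^sub>R f x - max 0 (- w x) *\<^sub>R f x)"
    using i by simp
  also have "\<dots> = (LINT x|lborel. w x *\<^sub>R f x)"
    by (intro Bochner_Integration.integral_cong) (auto simp: max_def simp flip: scaleR_diff_left)
  finally show ?thesis .
qed

section \<open>Weak convergence with convergence of norms, uniformly over bounded equicontinuous
  families\<close>

section \<open>Uniform weak convergence\<close>

text \<open>Integration against the total variation measure |q|.\<close>

definition tv_integral :: "('a::topological_space set \<Rightarrow> real) \<Rightarrow> ('a \<Rightarrow> real) \<Rightarrow> real" where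
  "tv_integral q f = (LINT x|pos_variation q. f x) + (LINT x|neg_variation q. f x)"

lemma integrable_variation:
  fixes f :: "'a::topological_space \<Rightarrow> 'b::{banach, second_countable_topology}"
  assumes q: "signed_measure q" and f: "f \<in> borel_measurable borel" "\<And>x. norm (f x) \<le> C"
  shows "integrable (pos_variation q) f" "integrable (neg_variation q) f"
proof -
  have fm: "f \<in> borel_measurable (pos_variation q)" "f \<in> borel_measurable (neg_variation q)"
    using f(1) by (simp_all cong: measurable_cong_sets)
  show "integrable (pos_variation q) f"
    by (rule finite_measure.integrable_const_bound[OF finite_measure_pos_variation[OF q], of _ C]) (use f fm in auto)
  show "integrable (neg_variation q) f"
    by (rule finite_measure.integrable_const_bound[OF finite_measure_neg_variation[OF q], of _ C]) (use f fm in auto)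
qed

lemma norm_signed_integral_le:
  fixes f :: "'a::topological_space \<Rightarrow> 'b::{banach, second_countable_topology}"
  assumes q: "signed_measure q" and f: "f \<in> borel_measurable borel" "\<And>x. norm (f x) \<le> g x"
    and g: "g \<in> borel_measurable borel" "\<And>x. g x \<le> C"
  shows "norm (signed_integral q f) \<le> tv_integral q g"
proof -
  have fC: "norm (f x) \<le> C" for x using f(2) g(2) order_trans by blast
  have gC: "norm (g x) \<le> C" for x using g(2)[of x] order_trans[OF norm_ge_zero f(2)[of x]] by simp
  note int = integrable_variation[OF q f(1) fC] integrable_variation[OF q g(1) gC]
  have "norm (signed_integral q f) \<le> norm (LINT x|pos_variation q. f x) + norm (LINT x|neg_variation q. f x)"
    unfolding signed_integral_def by (rule norm_triangle_ineq4)
  also have "norm (LINT x|pos_variation q. f x) \<le> (LINT x|pos_variation q. g x)"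
    by (rule order_trans[OF integral_norm_bound integral_mono]) (use int f in \<open>auto intro: integrable_norm\<close>)
  also have "norm (LINT x|neg_variation q. f x) \<le> (LINT x|neg_variation q. g x)"
    by (rule order_trans[OF integral_norm_bound integral_mono]) (use int f in \<open>auto intro: integrable_norm\<close>)
  finally show ?thesis by (simp add: tv_integral_def)
qed

lemma tv_integral_const: "tv_integral q (\<lambda>_. c) = c * tv_norm q"
  by (simp add: tv_integral_def tv_norm_def algebra_simps)

lemma tv_integral_mult: "tv_integral q (\<lambda>x. c * f x) = c * tv_integral q f"
  by (simp add: tv_integral_def algebra_simps)

lemma signed_integral_add:
  fixes f g :: "'a::topological_space \<Rightarrow> 'b::{banach, second_countable_topology}"
  assumes "signed_measure q" "f \<in> borel_measurable borel" "\<And>x. norm (f x) \<le> C"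
     "g \<in> borel_measurable borel" "\<And>x. norm (g x) \<le> D"
  shows "signed_integral q (\<lambda>x. f x + g x) = signed_integral q f + signed_integral q g"
  using integrable_variation[OF assms(1,2,3)] integrable_variation[OF assms(1,4,5)]
  by (simp add: signed_integral_def)

lemma signed_integral_diff:
  fixes f g :: "'a::topological_space \<Rightarrow> 'b::{banach, second_countable_topology}"
  assumes "signed_measure q" "f \<in> borel_measurable borel" "\<And>x. norm (f x) \<le> C"
     "g \<in> borel_measurable borel" "\<And>x. norm (g x) \<le> D"
  shows "signed_integral q (\<lambda>x. f x - g x) = signed_integral q f - signed_integral q g"
  using integrable_variation[OF assms(1,2,3)] integrable_variation[OF assms(1,4,5)]
  by (simp add: signed_integral_def)

lemma signed_integral_sum_scaleR:
  fixes h :: "'i \<Rightarrow> 'a::topological_space \<Rightarrow> real" and c :: "'i \<Rightarrow> 'b::{banach, second_countable_topology}"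
  assumes "signed_measure q" "\<And>i. i \<in> I \<Longrightarrow> h i \<in> borel_measurable borel" "\<And>i x. i \<in> I \<Longrightarrow> norm (h i x) \<le> C"
  shows "signed_integral q (\<lambda>x. \<Sum>i\<in>I. h i x *\<^sub>R c i) = (\<Sum>i\<in>I. signed_integral q (h i) *\<^sub>R c i)"
  using integrable_variation[OF assms]
  by (simp add: signed_integral_def Bochner_Integration.integral_sum sum_subtractf[symmetric] scaleR_diff_left)

text \<open>Continuous functions converging almost everywhere to sgn w are truncated to [-1, 1] and
  cut off; dominated convergence then brings their integrals against w close to the norm of
  w.\<close>

lemma exists_C0_almost_norming:
  fixes w :: "'a::euclidean_space \<Rightarrow> real"
  assumes w: "integrable lborel w" and \<epsilon>: "\<epsilon> > 0"
  obtains \<phi> :: "'a \<Rightarrow> real" and R where "continuous_on UNIV \<phi>" "\<And>x. \<bar>\<phi> x\<bar> \<le> 1" "\<And>x. norm x > R \<Longrightarrow> \<phi> x = 0"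
    "(LINT x|lborel. w x * \<phi> x) \<ge> (LINT x|lborel. \<bar>w x\<bar>) - \<epsilon>"
proof -
  have wm[measurable]: "w \<in> borel_measurable borel" using w by (simp add: borel_measurable_integrable)
  have "(\<lambda>x. sgn (w x)) \<in> borel_measurable lebesgue"
    by (rule measurable_completion) measurable
  then have "(\<lambda>x. sgn (w x)) measurable_on UNIV"
    by (intro lebesgue_measurable_imp_measurable_on) auto
  then obtain N and g :: "nat \<Rightarrow> 'a \<Rightarrow> real" where N: "negligible N" and g: "\<And>n. continuous_on UNIV (g n)"
      "\<And>x. x \<notin> N \<Longrightarrow> (\<lambda>n. g n x) \<longlonglongrightarrow> sgn (w x)"
    by (auto simp: measurable_on_def)
  \<comment> \<open>The second factor is 1 on the ball of radius n and 0 outside the ball of radius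
    n + 1, so it tends to 1 pointwise.\<close>
  define \<phi> where "\<phi> n x = max (-1) (min 1 (g n x)) * max 0 (min 1 (real n + 1 - norm x))" for n x
  have cont: "continuous_on UNIV (\<phi> n)" for n
    unfolding \<phi>_def by (intro continuous_intros g)
  have b: "\<bar>\<phi> n x\<bar> \<le> 1" for n x
  proof -
    have "\<bar>\<phi> n x\<bar> \<le> 1 * 1" unfolding \<phi>_def abs_mult by (intro mult_mono) auto
    then show ?thesis by simp
  qed
  have lim: "(\<lambda>n. \<phi> n x) \<longlonglongrightarrow> sgn (w x)" if "x \<notin> N" for x
  proof -
    have "(\<lambda>n. max (-1) (min 1 (g n x))) \<longlonglongrightarrow> max (-1) (min 1 (sgn (w x)))"
      by (intro tendsto_intros g that)
    moreover have "(\<lambda>n. max 0 (min 1 (real n + 1 - norm x))) \<longlonglongrightarrow> 1"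
    proof (rule tendsto_eventually)
      obtain m :: nat where "norm x \<le> real m" using real_arch_simple by blast
      then show "\<forall>\<^sub>F n in sequentially. max 0 (min 1 (real n + 1 - norm x)) = 1"
        unfolding eventually_sequentially by (intro exI[of _ m]) auto
    qed
    ultimately have "(\<lambda>n. \<phi> n x) \<longlonglongrightarrow> max (-1) (min 1 (sgn (w x))) * 1"
      unfolding \<phi>_def by (intro tendsto_mult)
    moreover have "max (-1) (min 1 (sgn (w x))) = sgn (w x)" by (auto simp: sgn_real_def)
    ultimately show ?thesis by simp
  qed
  have meas: "\<phi> n \<in> borel_measurable borel" for n by (rule borel_measurable_continuous_onI[OF cont])
  have "(\<lambda>n. LINT x|lborel. w x * \<phi> n x) \<longlonglongrightarrow> (LINT x|lborel. \<bar>w x\<bar>)"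
  proof (rule integral_dominated_convergence[where w = "\<lambda>x. \<bar>w x\<bar>"])
    have "AE x in lebesgue. x \<notin> N" using N by (simp add: negligible_iff_null_sets AE_not_in)
    then have "AE x in lborel. x \<notin> N" by (simp add: AE_completion_iff)
    then show "AE x in lborel. (\<lambda>n. w x * \<phi> n x) \<longlonglongrightarrow> \<bar>w x\<bar>"
    proof eventually_elim
      case (elim x)
      have "(\<lambda>n. w x * \<phi> n x) \<longlonglongrightarrow> w x * sgn (w x)" by (intro tendsto_intros lim elim)
      then show ?case by (simp add: abs_sgn)
    qed
    show "AE x in lborel. norm (w x * \<phi> n x) \<le> \<bar>w x\<bar>" for n
      using b by (intro AE_I2) (simp add: abs_mult mult_left_le)
  qed (use w meas in auto)
  then obtain n where "dist (LINT x|lborel. w x * \<phi> n x) (LINT x|lborel. \<bar>w x\<bar>) < \<epsilon>"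
    using \<epsilon> by (metis (no_types, lifting) LIMSEQ_def order_refl)
  then show thesis
    by (intro that[of "\<phi> n" "real n + 1"] cont b) (auto simp: dist_real_def \<phi>_def)
qed

text \<open>Tightness enters through the almost norming function \<open>\<phi>\<close>: convergence of the norms forces the weight
  \<open>1 - \<bar>\<phi>\<bar>\<close> to have small mass for the total variation of \<open>q n\<close>. What remains, \<open>\<bar>\<phi>\<bar> f\<close>, is approximated
  by combinations of finitely many test functions \<open>\<tau> y\<close> that do not depend on \<open>f\<close>.\<close>

lemma weakly_converges_uniform:
  fixes w :: "'a::euclidean_space \<Rightarrow> real" and F :: "('a \<Rightarrow> 'b::euclidean_space) set"
  assumes w: "integrable lborel w" and q: "\<And>n. signed_measure (q n)"
    and weak: "weakly_converges q (density_measure w)"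
    and tv: "(\<lambda>n. tv_norm (q n)) \<longlonglongrightarrow> (LINT x|lborel. \<bar>w x\<bar>)"
    and C: "\<And>f x. f \<in> F \<Longrightarrow> norm (f x) \<le> C"
    and equi: "\<And>\<epsilon>. \<epsilon> > 0 \<Longrightarrow> \<exists>\<delta>>0. \<forall>f\<in>F. \<forall>x y. dist x y < \<delta> \<longrightarrow> norm (f x - f y) \<le> \<epsilon>"
    and \<epsilon>: "\<epsilon> > 0"
  shows "\<exists>N. \<forall>n\<ge>N. \<forall>f\<in>F. norm (signed_integral (q n) f - (LINT y|lborel. w y *\<^sub>R f y)) \<le> \<epsilon>"
proof -
  \<comment> \<open>If \<open>F\<close> is empty, \<open>C\<close> may be negative.\<close>
  define C' where "C' = max C 0"
  have C': "C' \<ge> 0" "\<And>f x. f \<in> F \<Longrightarrow> norm (f x) \<le> C'" by (auto simp: C'_def le_max_iff_disj C)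
  define m where "m = (LINT x|lborel. \<bar>w x\<bar>)"
  have m: "m \<ge> 0" by (simp add: m_def)
  \<comment> \<open>The five error terms below add up to (5 C' + 2 m + 1) e; e \<le> 1 serves to
    bound \<open>tv_norm (q n)\<close> by m + 1.\<close>
  define e where "e = min 1 (\<epsilon> / (5 * C' + 2 * m + 2))"
  have e: "e > 0" "e \<le> 1" "(5 * C' + 2 * m + 2) * e \<le> \<epsilon>"
  proof -
    have p: "5 * C' + 2 * m + 2 > 0" using C' m by linarith
    then show "e > 0" "e \<le> 1" using \<epsilon> by (auto simp: e_def)
    have "(5 * C' + 2 * m + 2) * e \<le> (5 * C' + 2 * m + 2) * (\<epsilon> / (5 * C' + 2 * m + 2))"
      using p by (intro mult_left_mono) (auto simp: e_def)
    then show "(5 * C' + 2 * m + 2) * e \<le> \<epsilon>" using p by simp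
  qed
  have wm[measurable]: "w \<in> borel_measurable borel" using w by (simp add: borel_measurable_integrable)
  obtain \<phi> R where phi: "continuous_on UNIV \<phi>" "\<And>x. \<bar>\<phi> x\<bar> \<le> 1" "\<And>x. norm x > R \<Longrightarrow> \<phi> x = 0"
    "(LINT x|lborel. w x * \<phi> x) \<ge> m - e"
    using exists_C0_almost_norming[OF w e(1)] unfolding m_def by metis
  obtain \<delta> where delta: "\<delta> > 0" "\<And>f x y. f \<in> F \<Longrightarrow> dist x y < \<delta> \<Longrightarrow> norm (f x - f y) \<le> e"
    using equi[OF e(1)] by metis
  obtain Y where Y: "finite Y" "cball (0::'a) R \<subseteq> (\<Union>y\<in>Y. ball y (\<delta> / 2))"
    using compact_cball[of "0::'a" R] delta(1) unfolding compact_eq_totally_bounded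
    by (meson half_gt_zero)
  \<comment> \<open>A partition of unity for the net \<open>Y\<close>, multiplied by |\<phi>|. On
    the ball of radius R one has \<open>S x \<ge> \<delta> / 2\<close>, so the maximum in the
    denominator equals \<open>S x\<close>; elsewhere it prevents division by zero, and \<phi> is 0
    there.\<close>
  define S where "S x = (\<Sum>y\<in>Y. max 0 (\<delta> - dist x y))" for x
  define \<tau> where "\<tau> y x = \<bar>\<phi> x\<bar> * max 0 (\<delta> - dist x y) / max (S x) (\<delta> / 2)" for y x
  have Spos: "max (S x) (\<delta> / 2) > 0" for x using delta(1) by (auto simp: max_def)
  have S0: "S x \<ge> max 0 (\<delta> - dist x y)" if "y \<in> Y" for x y
    unfolding S_def using Y(1) that by (intro member_le_sum) auto
  have chi0: "\<tau> y x \<ge> 0" for x y using Spos[of x] by (auto simp: \<tau>_def intro!: divide_nonneg_pos)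
  have chi_sum: "(\<Sum>y\<in>Y. \<tau> y x) = \<bar>\<phi> x\<bar>" for x
  proof (cases "norm x > R")
    case False
    then have "x \<in> cball 0 R" by simp
    then obtain y where "y \<in> Y" "x \<in> ball y (\<delta> / 2)" using Y(2) by blast
    then have y: "y \<in> Y" "dist x y < \<delta> / 2" by (simp_all add: dist_commute)
    have "S x \<ge> \<delta> / 2" using S0[OF y(1), of x] y(2) by simp
    then have "max (S x) (\<delta> / 2) = S x" "S x \<noteq> 0" using delta(1) by auto
    moreover have "(\<Sum>y\<in>Y. \<tau> y x) = \<bar>\<phi> x\<bar> * S x / max (S x) (\<delta> / 2)"
      by (simp add: \<tau>_def S_def sum_distrib_left sum_divide_distrib)
    ultimately show ?thesis by simp
  qed (simp add: \<tau>_def phi)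
  have chi_cont: "continuous_on UNIV (\<tau> y)" for y
  proof -
    have "continuous_on UNIV S" unfolding S_def by (intro continuous_intros)
    then show ?thesis unfolding \<tau>_def using Spos by (intro continuous_intros phi) (auto simp: less_imp_neq[symmetric])
  qed
  have chi1: "\<tau> y x \<le> 1" if "y \<in> Y" for x y
    using chi_sum[of x] phi(2)[of x] member_le_sum[OF that, of "\<lambda>y. \<tau> y x"] chi0 Y(1) by auto
  have chi_lim: "(\<tau> y \<longlongrightarrow> 0) at_infinity" for y
  proof (rule tendsto_eventually)
    show "\<forall>\<^sub>F x in at_infinity. \<tau> y x = 0"
      unfolding eventually_at_infinity by (intro exI[of _ "\<bar>R\<bar> + 1"]) (auto simp: \<tau>_def phi)
  qed
  have phi_lim: "(\<phi> \<longlongrightarrow> 0) at_infinity"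
  proof (rule tendsto_eventually)
    show "\<forall>\<^sub>F x in at_infinity. \<phi> x = 0"
      unfolding eventually_at_infinity by (intro exI[of _ "\<bar>R\<bar> + 1"]) (auto simp: phi)
  qed
  have [measurable]: "\<phi> \<in> borel_measurable borel" "\<tau> y \<in> borel_measurable borel" for y
    using phi chi_cont by (auto intro: borel_measurable_continuous_onI)
  have conv: "(\<lambda>n. signed_integral (q n) h) \<longlonglongrightarrow> (LINT x|lborel. w x * h x)"
    if h: "continuous_on UNIV h" "(h \<longlongrightarrow> 0) at_infinity" "\<And>x. \<bar>h x\<bar> \<le> 1" for h :: "'a \<Rightarrow> real"
  proof -
    have "signed_integral (density_measure w) h = (LINT x|lborel. w x *\<^sub>R h x)"
      using h borel_measurable_continuous_onI by (intro signed_integral_density_measure[OF w, of h 1]) auto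
    then show ?thesis using weak[unfolded weakly_converges_def, rule_format, OF h(1,2)] by simp
  qed
  have "\<forall>\<^sub>F n in sequentially. tv_norm (q n) < m + e \<and> signed_integral (q n) \<phi> > m - 2 * e
      \<and> (\<Sum>y\<in>Y. \<bar>signed_integral (q n) (\<tau> y) - (LINT x|lborel. w x * \<tau> y x)\<bar>) < e"
  proof (intro eventually_conj)
    show "\<forall>\<^sub>F n in sequentially. tv_norm (q n) < m + e"
      using tv e(1) by (intro order_tendstoD(2)) (auto simp: m_def)
    show "\<forall>\<^sub>F n in sequentially. signed_integral (q n) \<phi> > m - 2 * e"
      using conv[OF phi(1) phi_lim phi(2)] phi(4) e(1) by (intro order_tendstoD(1)) auto
    have "(\<lambda>n. \<Sum>y\<in>Y. \<bar>signed_integral (q n) (\<tau> y) - (LINT x|lborel. w x * \<tau> y x)\<bar>) \<longlonglongrightarrow>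
        (\<Sum>y\<in>Y. \<bar>(LINT x|lborel. w x * \<tau> y x) - (LINT x|lborel. w x * \<tau> y x)\<bar>)"
      using chi0 chi1 chi_cont chi_lim by (intro tendsto_intros conv) (auto simp: abs_le_iff intro: order_trans)
    then show "\<forall>\<^sub>F n in sequentially. (\<Sum>y\<in>Y. \<bar>signed_integral (q n) (\<tau> y) - (LINT x|lborel. w x * \<tau> y x)\<bar>) < e"
      using e(1) by (intro order_tendstoD(2)) auto
  qed
  moreover have "norm (signed_integral (q n) f - (LINT y|lborel. w y *\<^sub>R f y)) \<le> \<epsilon>"
    if n: "tv_norm (q n) < m + e" "signed_integral (q n) \<phi> > m - 2 * e"
      "(\<Sum>y\<in>Y. \<bar>signed_integral (q n) (\<tau> y) - (LINT x|lborel. w x * \<tau> y x)\<bar>) < e"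
      and f: "f \<in> F" for n f
  proof -
    have fcont: "continuous_on UNIV f"
      unfolding continuous_on_iff
    proof (intro ballI allI impI)
      fix x :: 'a and \<eta> :: real assume "\<eta> > 0"
      then obtain d where "d > 0" "\<And>g x y. g \<in> F \<Longrightarrow> dist x y < d \<Longrightarrow> norm (g x - g y) \<le> \<eta> / 2"
        using equi[of "\<eta> / 2"] by (metis half_gt_zero)
      then show "\<exists>d>0. \<forall>x'\<in>UNIV. dist x' x < d \<longrightarrow> dist (f x') (f x) < \<eta>"
        using f \<open>\<eta> > 0\<close> by (intro exI[of _ d]) (force simp: dist_norm intro: le_less_trans)
    qed
    have fm[measurable]: "f \<in> borel_measurable borel" by (rule borel_measurable_continuous_onI[OF fcont])
    \<comment> \<open>f = h1 + h2 + h3: \<open>h1\<close> carries the weight 1 - |\<phi>| of small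
      mass, \<open>h2\<close> the oscillation of f within distance \<delta> of points of the net,
      and \<open>h3\<close> is a combination of the fixed test functions
      \<open>\<tau> y\<close>.\<close>
    define h1 where "h1 x = (1 - \<bar>\<phi> x\<bar>) *\<^sub>R f x" for x
    define h3 where "h3 x = (\<Sum>y\<in>Y. \<tau> y x *\<^sub>R f y)" for x
    define h2 where "h2 x = (\<Sum>y\<in>Y. \<tau> y x *\<^sub>R (f x - f y))" for x
    have hm[measurable]: "h1 \<in> borel_measurable borel" "h2 \<in> borel_measurable borel" "h3 \<in> borel_measurable borel"
      unfolding h1_def h2_def h3_def by measurable
    have h2eq: "h2 x = \<bar>\<phi> x\<bar> *\<^sub>R f x - h3 x" for x
      unfolding h2_def h3_def chi_sum[symmetric] scaleR_sum_left by (simp add: scaleR_diff_right sum_subtractf)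
    have split: "f x = h1 x + h2 x + h3 x" for x
      unfolding h2eq h1_def by (simp add: scaleR_diff_left)
    have b1: "norm (h1 x) \<le> C' * (1 - \<bar>\<phi> x\<bar>)" for x
      using C'(2)[OF f, of x] phi(2)[of x] by (simp add: h1_def mult.commute[of C'] mult_left_mono)
    have b2: "norm (h2 x) \<le> e" for x
    proof -
      have "norm (h2 x) \<le> (\<Sum>y\<in>Y. norm (\<tau> y x *\<^sub>R (f x - f y)))" unfolding h2_def by (rule norm_sum)
      also have "\<dots> \<le> (\<Sum>y\<in>Y. \<tau> y x * e)"
      proof (rule sum_mono)
        fix y
        show "norm (\<tau> y x *\<^sub>R (f x - f y)) \<le> \<tau> y x * e"
        proof (cases "dist x y < \<delta>")
          case True
          then show ?thesis using delta(2)[OF f True] chi0[of y x] by (simp add: mult_left_mono)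
        qed (simp add: \<tau>_def)
      qed
      also have "\<dots> = \<bar>\<phi> x\<bar> * e" by (simp add: chi_sum flip: sum_distrib_right)
      also have "\<dots> \<le> 1 * e" using phi(2)[of x] e(1) by (intro mult_right_mono) auto
      finally show ?thesis by simp
    qed
    have b1': "norm (h1 x) \<le> C'" for x
      using b1[of x] mult_left_mono[of "1 - \<bar>\<phi> x\<bar>" 1 C'] C'(1) by simp
    have b3: "norm (h3 x) \<le> 2 * C' + e" for x
    proof -
      have "h3 x = f x - h1 x - h2 x" using split[of x] by (simp add: algebra_simps)
      then have "norm (h3 x) \<le> norm (f x) + norm (h1 x) + norm (h2 x)"
        using norm_triangle_ineq4[of "f x - h1 x" "h2 x"] norm_triangle_ineq4[of "f x" "h1 x"] by simp
      then show ?thesis using C'(2)[OF f, of x] b1'[of x] b2[of x] by linarith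
    qed
    have b12: "norm (h1 x + h2 x) \<le> C' + e" for x
      using norm_triangle_ineq[of "h1 x" "h2 x"] b1'[of x] b2[of x] by linarith
    have sf: "signed_integral (q n) f = signed_integral (q n) h1 + signed_integral (q n) h2 + signed_integral (q n) h3"
    proof -
      have "signed_integral (q n) (\<lambda>x. (h1 x + h2 x) + h3 x) = signed_integral (q n) (\<lambda>x. h1 x + h2 x) + signed_integral (q n) h3"
        by (rule signed_integral_add[OF q _ b12 _ b3]) measurable
      moreover have "signed_integral (q n) (\<lambda>x. h1 x + h2 x) = signed_integral (q n) h1 + signed_integral (q n) h2"
        by (rule signed_integral_add[OF q _ b1' _ b2]) measurable
      moreover have "f = (\<lambda>x. h1 x + h2 x + h3 x)" using split by blast
      ultimately show ?thesis by simp
    qed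
    have iw: "integrable lborel (\<lambda>x. w x *\<^sub>R h1 x)" "integrable lborel (\<lambda>x. w x *\<^sub>R h2 x)" "integrable lborel (\<lambda>x. w x *\<^sub>R h3 x)"
      by (rule integrable_scaleR_bounded[OF w _ b1'] integrable_scaleR_bounded[OF w _ b2] integrable_scaleR_bounded[OF w _ b3], measurable)+
    have wf: "(LINT y|lborel. w y *\<^sub>R f y) = (LINT y|lborel. w y *\<^sub>R h1 y) + (LINT y|lborel. w y *\<^sub>R h2 y) + (LINT y|lborel. w y *\<^sub>R h3 y)"
      unfolding split[of _] using iw by (simp add: scaleR_add_right)
    \<comment> \<open>The |q n|-mass of 1 - |\<phi>| is at most (m + e) - (m - 2 e) = 3 e, since the
      integral of |\<phi>| against |q n| dominates that of \<phi> against q n.\<close>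
    have q1: "norm (signed_integral (q n) h1) \<le> C' * (3 * e)"
    proof -
      have "norm (signed_integral (q n) h1) \<le> tv_integral (q n) (\<lambda>x. C' * (1 - \<bar>\<phi> x\<bar>))"
        using C'(1) by (intro norm_signed_integral_le[OF q _ b1, where C = C']) (auto intro: mult_left_le)
      also have "\<dots> = C' * tv_integral (q n) (\<lambda>x. 1 - \<bar>\<phi> x\<bar>)" by (rule tv_integral_mult)
      also have "tv_integral (q n) (\<lambda>x. 1 - \<bar>\<phi> x\<bar>) = tv_norm (q n) - tv_integral (q n) (\<lambda>x. \<bar>\<phi> x\<bar>)"
      proof -
        have "integrable (pos_variation (q n)) (\<lambda>x. \<bar>\<phi> x\<bar>)" "integrable (neg_variation (q n)) (\<lambda>x. \<bar>\<phi> x\<bar>)"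
          using phi(2) by (auto intro!: integrable_variation[OF q, of _ 1])
        moreover have "integrable (pos_variation (q n)) (\<lambda>x. 1::real)" "integrable (neg_variation (q n)) (\<lambda>x. 1::real)"
          by (auto intro!: integrable_variation[OF q, of _ 1])
        ultimately show ?thesis
          by (simp add: tv_integral_def tv_norm_def)
      qed
      also have "\<dots> \<le> 3 * e"
      proof -
        have "norm (signed_integral (q n) \<phi>) \<le> tv_integral (q n) (\<lambda>x. \<bar>\<phi> x\<bar>)"
          using phi(2) by (intro norm_signed_integral_le[OF q, of _ _ 1]) auto
        then show ?thesis using n(1,2) by simp
      qed
      finally show ?thesis using C'(1) by (simp add: mult_left_mono)
    qed
    have q2: "norm (signed_integral (q n) h2) \<le> e * (m + 1)"
    proof -
      have "norm (signed_integral (q n) h2) \<le> tv_integral (q n) (\<lambda>_. e)"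
        by (intro norm_signed_integral_le[OF q _ b2, where C = e]) auto
      also have "\<dots> \<le> e * (m + 1)" using n(1) e(1,2) by (simp add: tv_integral_const mult_left_mono)
      finally show ?thesis .
    qed
    have q3: "norm (signed_integral (q n) h3 - (LINT y|lborel. w y *\<^sub>R h3 y)) \<le> C' * e"
    proof -
      have 1: "signed_integral (q n) h3 = (\<Sum>y\<in>Y. signed_integral (q n) (\<tau> y) *\<^sub>R f y)"
        unfolding h3_def using chi0 chi1 by (intro signed_integral_sum_scaleR[OF q, of _ _ 1]) auto
      have 2: "(LINT y|lborel. w y *\<^sub>R h3 y) = (\<Sum>y\<in>Y. (LINT x|lborel. w x * \<tau> y x) *\<^sub>R f y)"
      proof -
        have i: "integrable lborel (\<lambda>x. w x * \<tau> y x)" if "y \<in> Y" for y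
          using integrable_scaleR_bounded[OF w, of "\<tau> y" 1] chi0[of y] chi1[OF that] by simp
        have "(LINT x|lborel. w x *\<^sub>R h3 x) = (LINT x|lborel. (\<Sum>y\<in>Y. (w x * \<tau> y x) *\<^sub>R f y))"
          by (simp add: h3_def scaleR_sum_right)
        also have "\<dots> = (\<Sum>y\<in>Y. (LINT x|lborel. (w x * \<tau> y x) *\<^sub>R f y))"
          using i by (intro Bochner_Integration.integral_sum) auto
        also have "\<dots> = (\<Sum>y\<in>Y. (LINT x|lborel. w x * \<tau> y x) *\<^sub>R f y)"
          using i by (intro sum.cong) auto
        finally show ?thesis .
      qed
      have "norm (signed_integral (q n) h3 - (LINT y|lborel. w y *\<^sub>R h3 y))
        = norm (\<Sum>y\<in>Y. (signed_integral (q n) (\<tau> y) - (LINT x|lborel. w x * \<tau> y x)) *\<^sub>R f y)"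
        unfolding 1 2 by (simp add: scaleR_diff_left sum_subtractf)
      also have "\<dots> \<le> (\<Sum>y\<in>Y. \<bar>signed_integral (q n) (\<tau> y) - (LINT x|lborel. w x * \<tau> y x)\<bar> * C')"
        using C'(2)[OF f] by (intro sum_norm_le) (simp add: mult_left_mono)
      also have "\<dots> = C' * (\<Sum>y\<in>Y. \<bar>signed_integral (q n) (\<tau> y) - (LINT x|lborel. w x * \<tau> y x)\<bar>)"
        by (simp add: sum_distrib_left mult.commute)
      also have "\<dots> \<le> C' * e" using n(3) C'(1) by (intro mult_left_mono) auto
      finally show ?thesis .
    qed
    have w1: "norm (LINT y|lborel. w y *\<^sub>R h1 y) \<le> C' * e"
    proof -
      have i1: "integrable lborel (\<lambda>x. \<bar>w x\<bar> * \<bar>\<phi> x\<bar>)"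
        using integrable_scaleR_bounded[OF integrable_abs[OF w], of "\<lambda>x. \<bar>\<phi> x\<bar>" 1] phi(2) by simp
      have i2: "integrable lborel (\<lambda>x. w x * \<phi> x)"
        using integrable_scaleR_bounded[OF w, of "\<phi>" 1] phi(2) by simp
      have "norm (LINT y|lborel. w y *\<^sub>R h1 y) \<le> (LINT y|lborel. C' * (\<bar>w y\<bar> - \<bar>w y\<bar> * \<bar>\<phi> y\<bar>))"
      proof (rule order_trans[OF integral_norm_bound integral_mono])
        show "norm (w x *\<^sub>R h1 x) \<le> C' * (\<bar>w x\<bar> - \<bar>w x\<bar> * \<bar>\<phi> x\<bar>)" for x
          using mult_left_mono[OF b1[of x], of "\<bar>w x\<bar>"] by (simp add: algebra_simps)
      qed (use integrable_norm[OF iw(1)] i1 w in auto)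
      also have "\<dots> = C' * (m - (LINT y|lborel. \<bar>w y\<bar> * \<bar>\<phi> y\<bar>))"
        using i1 w by (simp add: m_def)
      also have "\<dots> \<le> C' * e"
      proof (rule mult_left_mono)
        have "(LINT x|lborel. w x * \<phi> x) \<le> (LINT y|lborel. \<bar>w y\<bar> * \<bar>\<phi> y\<bar>)"
          by (rule integral_mono[OF i2 i1]) (metis abs_ge_self abs_mult)
        then show "m - (LINT y|lborel. \<bar>w y\<bar> * \<bar>\<phi> y\<bar>) \<le> e" using phi(4) by linarith
      qed (use C' in auto)
      finally show ?thesis .
    qed
    have w2: "norm (LINT y|lborel. w y *\<^sub>R h2 y) \<le> e * m"
    proof -
      have "norm (LINT y|lborel. w y *\<^sub>R h2 y) \<le> (LINT y|lborel. e * \<bar>w y\<bar>)"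
      proof (rule order_trans[OF integral_norm_bound integral_mono])
        show "norm (w x *\<^sub>R h2 x) \<le> e * \<bar>w x\<bar>" for x
          using mult_left_mono[OF b2[of x], of "\<bar>w x\<bar>"] by (simp add: mult.commute)
      qed (use integrable_norm[OF iw(2)] w in auto)
      then show ?thesis by (simp add: m_def)
    qed
    have "norm (signed_integral (q n) f - (LINT y|lborel. w y *\<^sub>R f y)) =
      norm (signed_integral (q n) h1 + signed_integral (q n) h2 + (signed_integral (q n) h3 - (LINT y|lborel. w y *\<^sub>R h3 y))
         - (LINT y|lborel. w y *\<^sub>R h1 y) - (LINT y|lborel. w y *\<^sub>R h2 y))"
      unfolding sf wf by (simp add: algebra_simps)
    also have "\<dots> \<le> norm (signed_integral (q n) h1) + norm (signed_integral (q n) h2)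
        + norm (signed_integral (q n) h3 - (LINT y|lborel. w y *\<^sub>R h3 y))
        + norm (LINT y|lborel. w y *\<^sub>R h1 y) + norm (LINT y|lborel. w y *\<^sub>R h2 y)"
      by (intro order_trans[OF norm_triangle_ineq4] add_right_mono order_trans[OF norm_triangle_ineq] order_refl)
    also have "\<dots> \<le> C' * (3 * e) + e * (m + 1) + C' * e + C' * e + e * m"
      using q1 q2 q3 w1 w2 by (intro add_mono)
    also have "\<dots> \<le> (5 * C' + 2 * m + 2) * e"
      using e(1) by (simp add: algebra_simps)
    also have "\<dots> \<le> \<epsilon>" using e(3) .
    finally show ?thesis .
  qed
  ultimately show ?thesis unfolding eventually_sequentially by blast
qed

section \<open>Moduli of continuity of the vortex flows and bounds for the Euler velocity\<close>

section \<open>Velocity estimates\<close>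

lemma rot_measurable [measurable]: "rot \<in> borel_measurable borel"
  by (rule borel_measurable_continuous_onI) (rule continuous_on_rot[OF continuous_on_id])

lemma norm_vortex_kernel_le: "\<alpha> > 0 \<Longrightarrow> norm (vortex_kernel \<alpha> x y) \<le> 1 / (2 * pi * \<alpha>)"
  using norm_vortex_profile[of "(x - y) /\<^sub>R \<alpha>"] mult_left_mono[of _ 1 "1 / (2 * pi * \<alpha>)"]
  by (simp add: vortex_kernel_eq divide_right_mono)

lemma continuous_on_vortex_kernel:
  assumes "\<alpha> > 0" "continuous_on S f"
  shows "continuous_on S (\<lambda>y. vortex_kernel \<alpha> a (f y))"
  unfolding vortex_kernel_eq[OF assms(1)] by (intro continuous_intros assms)

text \<open>Scaling by 1/\<alpha> is absorbed into the constant c of the profile estimate. The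
  resulting \<open>K\<close> depends on \<alpha>, so it serves only in arguments at fixed
  \<alpha>.\<close>

lemma vortex_kernel_log_lipschitz:
  assumes a: "\<alpha> > 0"
  obtains K where "K > 0" "\<And>r x y x' y'. 0 < r \<Longrightarrow> r \<le> 1 \<Longrightarrow> norm ((x - y) - (x' - y')) \<le> r \<Longrightarrow>
     norm (vortex_kernel \<alpha> x y - vortex_kernel \<alpha> x' y') \<le> K * osgood_modulus r"
proof -
  define c where "c = max 1 (1 / \<alpha>)"
  show thesis
  proof (rule that[of "1 / (2 * pi * \<alpha>) * (2 * c)"])
    show "0 < 1 / (2 * pi * \<alpha>) * (2 * c)" using a by (simp add: c_def max_def)
    fix r :: real and x y x' y' :: "real^2" assume r: "0 < r" "r \<le> 1" and le: "norm ((x - y) - (x' - y')) \<le> r"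
    have "norm ((x - y) /\<^sub>R \<alpha> - (x' - y') /\<^sub>R \<alpha>) \<le> c * r"
    proof -
      have "norm ((x - y) /\<^sub>R \<alpha> - (x' - y') /\<^sub>R \<alpha>) = 1 / \<alpha> * norm ((x - y) - (x' - y'))"
        using a by (simp add: divide_inverse flip: scaleR_diff_right)
      also have "\<dots> \<le> c * r" using a r le by (intro mult_mono) (auto simp: c_def)
      finally show ?thesis .
    qed
    then have *: "norm (vortex_profile ((x - y) /\<^sub>R \<alpha>) - vortex_profile ((x' - y') /\<^sub>R \<alpha>)) \<le> 2 * c * osgood_modulus r"
      using r by (intro vortex_profile_log_lipschitz) (auto simp: c_def)
    have "norm (vortex_kernel \<alpha> x y - vortex_kernel \<alpha> x' y') =
        1 / (2 * pi * \<alpha>) * norm (vortex_profile ((x - y) /\<^sub>R \<alpha>) - vortex_profile ((x' - y') /\<^sub>R \<alpha>))"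
      using a by (simp add: vortex_kernel_eq flip: scaleR_diff_right)
    also have "\<dots> \<le> 1 / (2 * pi * \<alpha>) * (2 * c * osgood_modulus r)" using a * by (intro mult_left_mono) auto
    finally show "norm (vortex_kernel \<alpha> x y - vortex_kernel \<alpha> x' y') \<le> 1 / (2 * pi * \<alpha>) * (2 * c) * osgood_modulus r" by simp
  qed
qed

lemma vortex_flow_measure_preserving:
  "vortex_flow \<alpha> q \<eta> \<Longrightarrow> 0 \<le> t \<Longrightarrow> (\<lambda>x. \<eta> x t) \<in> measure_preserving_homeos"
  by (simp add: vortex_flow_def)

lemma continuous_on_vortex_kernel_flow:
  assumes "\<alpha> > 0" "\<psi> \<in> measure_preserving_homeos"
  shows "continuous_on UNIV (\<lambda>y. vortex_kernel \<alpha> a (\<psi> y))"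
    and "(\<lambda>y. vortex_kernel \<alpha> a (\<psi> y)) \<in> borel_measurable borel"
proof -
  show "continuous_on UNIV (\<lambda>y. vortex_kernel \<alpha> a (\<psi> y))"
    using measure_preserving_homeos_measurable(1)[OF assms(2)] by (rule continuous_on_vortex_kernel[OF assms(1)])
  then show "(\<lambda>y. vortex_kernel \<alpha> a (\<psi> y)) \<in> borel_measurable borel"
    by (rule borel_measurable_continuous_onI)
qed

lemma norm_vortex_velocity_le:
  assumes a: "\<alpha> > 0" and q: "signed_measure q" and psi: "\<psi> \<in> measure_preserving_homeos"
  shows "norm (signed_integral q (\<lambda>y. vortex_kernel \<alpha> a (\<psi> y))) \<le> 1 / (2 * pi * \<alpha>) * tv_norm q"
  unfolding tv_integral_const[symmetric]
  by (rule norm_signed_integral_le[OF q continuous_on_vortex_kernel_flow(2)[OF a psi]])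
     (auto intro: norm_vortex_kernel_le[OF a])

text \<open>Two trajectories of one flow: the difference of their velocities is at most
  \<open>tv_norm q\<close> times the log-Lipschitz modulus of the kernel, and Osgood comparison
  applies. Only the bound Q on the norm enters, so \<delta> is common to all such q and all their
  flows.\<close>

lemma vortex_flow_equicontinuous:
  assumes a: "\<alpha> > 0" and T: "T > 0" and \<epsilon>: "\<epsilon> > 0"
  shows "\<exists>\<delta>>0. \<forall>q \<eta> t x y. signed_measure q \<longrightarrow> tv_norm q \<le> Q \<longrightarrow> vortex_flow \<alpha> q \<eta> \<longrightarrow>
    0 \<le> t \<longrightarrow> t \<le> T \<longrightarrow> dist x y < \<delta> \<longrightarrow> norm (\<eta> x t - \<eta> y t) \<le> \<epsilon>"
proof -
  define Q' where "Q' = max Q 1"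
  have Q': "Q' > 0" "Q \<le> Q'" by (auto simp: Q'_def)
  obtain K where K: "K > 0" "\<And>r x y x' y'. 0 < r \<Longrightarrow> r \<le> 1 \<Longrightarrow> norm ((x - y) - (x' - y')) \<le> r \<Longrightarrow>
     norm (vortex_kernel \<alpha> x y - vortex_kernel \<alpha> x' y') \<le> K * osgood_modulus r"
    using vortex_kernel_log_lipschitz[OF a] by blast
  have KQ: "K * Q' > 0" using K Q' by simp
  \<comment> \<open>The index type \<open>unit\<close> gives a family with a single curve, the
    difference of the two trajectories.\<close>
  obtain \<delta> where \<delta>: "0 < \<delta>" "\<delta> \<le> 1" and comparison:
    "\<And>(g :: unit \<Rightarrow> real \<Rightarrow> real^2) g' i t.
       osgood_family (K * Q') T \<delta> g g' \<Longrightarrow> 0 \<le> t \<Longrightarrow> t \<le> T \<Longrightarrow> norm (g i t) \<le> \<epsilon>"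
    by (rule osgood_comparison[OF KQ T \<epsilon>, where 'i = unit and 'v = "real^2"]) blast
  show ?thesis
  proof (intro exI[of _ \<delta>] conjI allI impI \<delta>(1))
    fix q :: "(real^2) set \<Rightarrow> real" and \<eta> :: "real^2 \<Rightarrow> real \<Rightarrow> real^2" and t :: real and x y :: "real^2"
    assume q: "signed_measure q" "tv_norm q \<le> Q" and flow: "vortex_flow \<alpha> q \<eta>"
      and t: "0 \<le> t" "t \<le> T" and xy: "dist x y < \<delta>"
    define u where "u z s = signed_integral q (\<lambda>y. vortex_kernel \<alpha> (\<eta> z s) (\<eta> y s))" for z s
    have der: "(\<eta> z has_vector_derivative u z s) (at s within {0..})" if "0 \<le> s" for z s
      using flow that by (simp add: vortex_flow_def u_def)
    note mph = vortex_flow_measure_preserving[OF flow]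
    have ub: "norm (u z s) \<le> 1 / (2 * pi * \<alpha>) * tv_norm q" if "0 \<le> s" for z s
      unfolding u_def by (rule norm_vortex_velocity_le[OF a q(1) mph[OF that]])
    have "osgood_family (K * Q') T \<delta> (\<lambda>_::unit. \<lambda>s. \<eta> x s - \<eta> y s) (\<lambda>_ s. u x s - u y s)"
      unfolding osgood_family_def
    proof (intro conjI allI ballI impI exI)
      show "norm (\<eta> x 0 - \<eta> y 0) \<le> \<delta>" using flow xy by (simp add: vortex_flow_def dist_norm)
    next
      fix s :: real assume "s \<in> {0..T}"
      then have s: "0 \<le> s" "s \<le> T" by auto
      show "((\<lambda>s. \<eta> x s - \<eta> y s) has_vector_derivative u x s - u y s) (at s within {0..})"
        by (intro has_vector_derivative_diff der s)
    next
      fix s :: real assume "s \<in> {0..T}"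
      then have s: "0 \<le> s" "s \<le> T" by auto
      show "norm (u x s - u y s) \<le> 1 / (2 * pi * \<alpha>) * tv_norm q + 1 / (2 * pi * \<alpha>) * tv_norm q"
        by (rule order_trans[OF norm_triangle_ineq4]) (intro add_mono ub s)
    next
      fix s r :: real
      assume "s \<in> {0..T}" "r \<in> {\<delta>..1}" and le: "\<forall>j::unit. norm (\<eta> x s - \<eta> y s) \<le> r"
      then have s: "0 \<le> s" "s \<le> T" and r: "\<delta> \<le> r" "r \<le> 1" by auto
      have r0: "r > 0" using \<delta> r by simp
      have kd: "norm (vortex_kernel \<alpha> (\<eta> x s) (\<eta> z s) - vortex_kernel \<alpha> (\<eta> y s) (\<eta> z s)) \<le> K * osgood_modulus r" for z
        using le r r0 by (intro K) auto
      have "u x s - u y s = signed_integral q (\<lambda>z. vortex_kernel \<alpha> (\<eta> x s) (\<eta> z s) - vortex_kernel \<alpha> (\<eta> y s) (\<eta> z s))"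
        unfolding u_def
        by (rule signed_integral_diff[symmetric, OF q(1) continuous_on_vortex_kernel_flow(2)[OF a mph] norm_vortex_kernel_le[OF a]
            continuous_on_vortex_kernel_flow(2)[OF a mph] norm_vortex_kernel_le[OF a]]) (use s in auto)
      also have "norm \<dots> \<le> tv_integral q (\<lambda>_. K * osgood_modulus r)"
        by (rule norm_signed_integral_le[OF q(1) _ kd])
           (auto intro!: borel_measurable_diff continuous_on_vortex_kernel_flow(2)[OF a mph] s)
      also have "\<dots> \<le> (K * Q') * osgood_modulus r"
        using K(1) q(2) Q'(2) osgood_modulus_ge[OF r0 r(2)] r0 by (simp add: tv_integral_const mult_ac)
      finally show "norm (u x s - u y s) \<le> (K * Q') * osgood_modulus r" .
    qed
    then show "norm (\<eta> x t - \<eta> y t) \<le> \<epsilon>" using comparison t by blast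
  qed
qed

lemma osgood_modulus_small:
  assumes "\<epsilon> > 0"
  obtains b where "b > 0" "b \<le> 1" "\<And>r. 0 < r \<Longrightarrow> r \<le> b \<Longrightarrow> osgood_modulus r < \<epsilon>"
proof -
  have "\<forall>\<^sub>F r in at_right 0. osgood_modulus r < \<epsilon>" using osgood_modulus_tendsto_0 assms by (rule order_tendstoD)
  then obtain b where "b > 0" "\<And>r. 0 < r \<Longrightarrow> r < b \<Longrightarrow> osgood_modulus r < \<epsilon>"
    by (auto simp: eventually_at_right_field)
  then show thesis by (intro that[of "min 1 (b / 2)"]) auto
qed

lemma norm_integral_le_nn_integral:
  fixes f :: "'a \<Rightarrow> 'b::{banach, second_countable_topology}"
  assumes "integrable M f" "\<And>x. norm (f x) \<le> h x" "(\<integral>\<^sup>+x. ennreal (h x) \<partial>M) \<le> ennreal c" "c \<ge> 0"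
  shows "norm (integral\<^sup>L M f) \<le> c"
proof -
  have "ennreal (norm (integral\<^sup>L M f)) \<le> (\<integral>\<^sup>+x. ennreal (norm (f x)) \<partial>M)"
    by (rule integral_norm_bound_ennreal[OF assms(1)])
  also have "\<dots> \<le> (\<integral>\<^sup>+x. ennreal (h x) \<partial>M)" by (intro nn_integral_mono ennreal_leI assms)
  also note assms(3)
  finally show ?thesis using assms(4) by simp
qed

text \<open>All three bounds reduce to \<open>nn_integral_potential\<close>, with d = 1, d = r and d
  = \<alpha> respectively. The constant depends only on w because the maps enter solely through
  preservation of Lebesgue measure.\<close>

lemma euler_velocity_estimates:
  fixes w :: "real^2 \<Rightarrow> real"
  assumes w: "in_L1_Linf w"
  obtains C where "C \<ge> 1"
    "\<And>\<psi> a. \<psi> \<in> measure_preserving_homeos \<Longrightarrow> norm (LINT y|lborel. w y *\<^sub>R euler_kernel a (\<psi> y)) \<le> C"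
    "\<And>\<psi> \<theta> a b r. \<psi> \<in> measure_preserving_homeos \<Longrightarrow> \<theta> \<in> measure_preserving_homeos \<Longrightarrow> 0 < r \<Longrightarrow> r \<le> 1 \<Longrightarrow>
      norm (a - b) \<le> r \<Longrightarrow> (\<And>y. norm (\<psi> y - \<theta> y) \<le> r) \<Longrightarrow>
      norm ((LINT y|lborel. w y *\<^sub>R euler_kernel a (\<psi> y)) - (LINT y|lborel. w y *\<^sub>R euler_kernel b (\<theta> y))) \<le> C * osgood_modulus r"
    "\<And>\<psi> a \<alpha>. \<psi> \<in> measure_preserving_homeos \<Longrightarrow> 0 < \<alpha> \<Longrightarrow> \<alpha> \<le> 1 \<Longrightarrow>
      norm ((LINT y|lborel. w y *\<^sub>R vortex_kernel \<alpha> a (\<psi> y)) - (LINT y|lborel. w y *\<^sub>R euler_kernel a (\<psi> y))) \<le> C * osgood_modulus \<alpha>"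
proof -
  have wi: "integrable lborel w" using w by (simp add: in_L1_Linf_def)
  then have wm[measurable]: "w \<in> borel_measurable borel" by (simp add: borel_measurable_integrable)
  define m where "m = (LINT x|lborel. \<bar>w x\<bar>)"
  have m: "m \<ge> 0" by (simp add: m_def)
  have nm: "(\<integral>\<^sup>+x. ennreal \<bar>w x\<bar> \<partial>lborel) = ennreal m"
    unfolding m_def using wi by (intro nn_integral_eq_integral) auto
  define g where "g d z = min (1 / norm z) (d / (norm z)\<^sup>2)" for d :: real and z :: "real^2"
  obtain C where C: "C \<ge> 1" and pot: "\<And>\<psi> a d. \<psi> \<in> measure_preserving_homeos \<Longrightarrow> 0 < d \<Longrightarrow> d \<le> 1 \<Longrightarrow>
     (\<integral>\<^sup>+y. ennreal (\<bar>w y\<bar> * g d (a - \<psi> y)) \<partial>lborel) \<le> ennreal (C * osgood_modulus d)"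
    using nn_integral_potential[OF w] unfolding g_def by blast
  have g0: "g d z \<ge> 0" if "d > 0" for d z using that by (simp add: g_def)
  have osg1: "osgood_modulus 1 = 1" by (simp add: osgood_modulus_def)
  have gm: "(\<lambda>y. g d (a - \<psi> y)) \<in> borel_measurable borel" if "\<psi> \<in> borel_measurable borel" for d a \<psi>
    using that unfolding g_def by measurable
  have em: "(\<lambda>y. euler_kernel a (\<psi> y)) \<in> borel_measurable borel" if [measurable]: "\<psi> \<in> borel_measurable borel" for a \<psi>
    unfolding euler_kernel_eq by measurable
  \<comment> \<open>Near the diagonal 1/|z| is below \<open>g 1 z\<close>, elsewhere below 1. The
    extra 1 contributes the norm m of w, hence the constant C + m.\<close>
  have enorm: "norm (euler_kernel a b) \<le> g 1 (a - b) + 1" for a b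
  proof -
    have "norm (euler_kernel a b) \<le> 1 / norm (a - b)"
    proof (cases "a = b")
      case False
      have "norm (euler_kernel a b) = 1 / (2 * pi) * (1 / norm (a - b))"
        using False by (simp add: euler_kernel_eq power2_eq_square)
      also have "\<dots> \<le> 1 * (1 / norm (a - b))" using pi_ge_two by (intro mult_right_mono) auto
      finally show ?thesis by simp
    qed (simp add: euler_kernel_def)
    also have "\<dots> \<le> g 1 (a - b) + 1"
    proof (cases "norm (a - b) \<le> 1")
      case True
      have "1 / norm (a - b) \<le> 1 / (norm (a - b))\<^sup>2"
        using True by (cases "a = b") (auto simp: field_simps power2_eq_square)
      then show ?thesis by (simp add: g_def)
    next
      case False
      then have "1 / norm (a - b) \<le> 1" using divide_le_eq_1[of 1 "norm (a - b)"] by linarith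
      then show ?thesis using g0[of 1 "a - b"] by simp
    qed
    finally show ?thesis .
  qed
  have bound: "(\<integral>\<^sup>+y. ennreal (\<bar>w y\<bar> * (g 1 (a - \<psi> y) + 1)) \<partial>lborel) \<le> ennreal (C + m)"
    if psi: "\<psi> \<in> measure_preserving_homeos" for a \<psi>
  proof -
    note [measurable] = measure_preserving_homeos_measurable(2)[OF psi] gm
    have "(\<integral>\<^sup>+y. ennreal (\<bar>w y\<bar> * (g 1 (a - \<psi> y) + 1)) \<partial>lborel) =
        (\<integral>\<^sup>+y. ennreal (\<bar>w y\<bar> * g 1 (a - \<psi> y)) + ennreal \<bar>w y\<bar> \<partial>lborel)"
      using g0 by (intro nn_integral_cong) (simp add: distrib_left flip: ennreal_plus)
    also have "\<dots> = (\<integral>\<^sup>+y. ennreal (\<bar>w y\<bar> * g 1 (a - \<psi> y)) \<partial>lborel) + ennreal m"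
      by (subst nn_integral_add) (auto simp: nm)
    also have "\<dots> \<le> ennreal (C * osgood_modulus 1) + ennreal m"
      using psi by (intro add_right_mono pot) auto
    also have "\<dots> = ennreal (C + m)" using C m by (simp add: osg1)
    finally show ?thesis .
  qed
  have ebound: "norm (w y *\<^sub>R euler_kernel a b) \<le> \<bar>w y\<bar> * (g 1 (a - b) + 1)" for y a b
    by (simp add: mult_left_mono enorm)
  have eint: "integrable lborel (\<lambda>y. w y *\<^sub>R euler_kernel a (\<psi> y))"
    if psi: "\<psi> \<in> measure_preserving_homeos" for a \<psi>
  proof (rule integrableI_bounded)
    show "(\<lambda>y. w y *\<^sub>R euler_kernel a (\<psi> y)) \<in> borel_measurable lborel"
      using em[OF measure_preserving_homeos_measurable(2)[OF psi]] by measurable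
    have "(\<integral>\<^sup>+y. ennreal (norm (w y *\<^sub>R euler_kernel a (\<psi> y))) \<partial>lborel)
        \<le> (\<integral>\<^sup>+y. ennreal (\<bar>w y\<bar> * (g 1 (a - \<psi> y) + 1)) \<partial>lborel)"
      by (intro nn_integral_mono ennreal_leI ebound)
    also have "\<dots> < \<infinity>" using bound[OF psi, of a] by (rule le_less_trans) simp
    finally show "(\<integral>\<^sup>+y. ennreal (norm (w y *\<^sub>R euler_kernel a (\<psi> y))) \<partial>lborel) < \<infinity>" .
  qed
  have vint: "integrable lborel (\<lambda>y. w y *\<^sub>R vortex_kernel \<alpha> a (\<psi> y))"
    if "\<psi> \<in> measure_preserving_homeos" "\<alpha> > 0" for a \<psi> \<alpha>
    by (rule integrable_scaleR_bounded[OF wi _ norm_vortex_kernel_le[OF that(2)]])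
      (use continuous_on_vortex_kernel_flow(2)[OF that(2,1)] in simp)
  show thesis
  proof (rule that[of "C + m"])
    show "1 \<le> C + m" using C m by simp
  next
    fix \<psi> :: "real^2 \<Rightarrow> real^2" and a
    assume psi: "\<psi> \<in> measure_preserving_homeos"
    show "norm (LINT y|lborel. w y *\<^sub>R euler_kernel a (\<psi> y)) \<le> C + m"
      by (rule norm_integral_le_nn_integral[OF eint[OF psi] ebound bound[OF psi]]) (use C m in simp)
  next
    fix \<psi> \<theta> :: "real^2 \<Rightarrow> real^2" and a b :: "real^2" and r :: real
    assume psi: "\<psi> \<in> measure_preserving_homeos" and chi: "\<theta> \<in> measure_preserving_homeos"
      and r: "0 < r" "r \<le> 1" and ab: "norm (a - b) \<le> r" and diff: "\<And>y. norm (\<psi> y - \<theta> y) \<le> r"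
    note [measurable] = measure_preserving_homeos_measurable(2)[OF psi] measure_preserving_homeos_measurable(2)[OF chi] gm
    have osg0: "osgood_modulus r \<ge> 0" using osgood_modulus_ge[OF r] r by simp
    \<comment> \<open>The arguments of the kernels differ by at most 2 r, one r from a - b and one
      from \<psi> - \<theta>. The estimate 1/(2 \<pi>) \<le> 1/4 turns the two factors 2 into 1/2,
      so the two potentials together cost C times the modulus.\<close>
    have pt: "norm (w y *\<^sub>R euler_kernel a (\<psi> y) - w y *\<^sub>R euler_kernel b (\<theta> y)) \<le>
       1 / 2 * (\<bar>w y\<bar> * g r (a - \<psi> y)) + 1 / 2 * (\<bar>w y\<bar> * g r (b - \<theta> y))" for y
    proof -
      have "norm ((a - \<psi> y) - (b - \<theta> y)) \<le> 2 * r"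
        using norm_triangle_ineq4[of "a - b" "\<psi> y - \<theta> y"] ab diff[of y] by (simp add: algebra_simps)
      then have "norm ((1 / (norm (a - \<psi> y))\<^sup>2) *\<^sub>R rot (a - \<psi> y) - (1 / (norm (b - \<theta> y))\<^sup>2) *\<^sub>R rot (b - \<theta> y))
         \<le> 2 * g r (a - \<psi> y) + 2 * g r (b - \<theta> y)"
        unfolding g_def using r by (intro euler_kernel_diff_bound)
      moreover have "norm (euler_kernel a (\<psi> y) - euler_kernel b (\<theta> y)) = 1 / (2 * pi) *
          norm ((1 / (norm (a - \<psi> y))\<^sup>2) *\<^sub>R rot (a - \<psi> y) - (1 / (norm (b - \<theta> y))\<^sup>2) *\<^sub>R rot (b - \<theta> y))"
        unfolding euler_kernel_eq scaleR_diff_right[symmetric] by (simp only: norm_scaleR) simp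
      ultimately have "norm (euler_kernel a (\<psi> y) - euler_kernel b (\<theta> y)) \<le> 1 / (2 * pi) * (2 * g r (a - \<psi> y) + 2 * g r (b - \<theta> y))"
        by (simp add: divide_right_mono)
      also have "\<dots> \<le> 1 / 4 * (2 * g r (a - \<psi> y) + 2 * g r (b - \<theta> y))"
        using pi_ge_two g0[OF r(1)] by (intro mult_right_mono) (auto simp: field_simps)
      finally have "\<bar>w y\<bar> * norm (euler_kernel a (\<psi> y) - euler_kernel b (\<theta> y)) \<le>
          \<bar>w y\<bar> * (1 / 4 * (2 * g r (a - \<psi> y) + 2 * g r (b - \<theta> y)))"
        by (rule mult_left_mono) simp
      then show ?thesis by (simp add: algebra_simps flip: scaleR_diff_right)
    qed
    have "(\<integral>\<^sup>+y. ennreal (1 / 2 * (\<bar>w y\<bar> * g r (a - \<psi> y)) + 1 / 2 * (\<bar>w y\<bar> * g r (b - \<theta> y))) \<partial>lborel)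
       = (\<integral>\<^sup>+y. ennreal (1 / 2) * ennreal (\<bar>w y\<bar> * g r (a - \<psi> y)) + ennreal (1 / 2) * ennreal (\<bar>w y\<bar> * g r (b - \<theta> y)) \<partial>lborel)"
      using g0[OF r(1)] by (intro nn_integral_cong) (simp only: ennreal_plus ennreal_mult mult_nonneg_nonneg abs_ge_zero zero_le_divide_1_iff zero_le_numeral)
    also have "\<dots> = ennreal (1 / 2) * (\<integral>\<^sup>+y. ennreal (\<bar>w y\<bar> * g r (a - \<psi> y)) \<partial>lborel) + ennreal (1 / 2) * (\<integral>\<^sup>+y. ennreal (\<bar>w y\<bar> * g r (b - \<theta> y)) \<partial>lborel)"
      by (simp add: nn_integral_add nn_integral_cmult)
    also have "\<dots> \<le> ennreal (1 / 2) * ennreal (C * osgood_modulus r) + ennreal (1 / 2) * ennreal (C * osgood_modulus r)"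
      by (intro add_mono mult_left_mono pot psi chi r) auto
    also have "\<dots> = ennreal (1 / 2 * (C * osgood_modulus r) + 1 / 2 * (C * osgood_modulus r))"
      using C osg0 by (subst ennreal_plus) (auto simp only: ennreal_mult mult_nonneg_nonneg)
    also have "\<dots> \<le> ennreal ((C + m) * osgood_modulus r)"
      using m osg0 by (intro ennreal_leI) (simp add: distrib_right)
    finally have nn: "(\<integral>\<^sup>+y. ennreal (1 / 2 * (\<bar>w y\<bar> * g r (a - \<psi> y)) + 1 / 2 * (\<bar>w y\<bar> * g r (b - \<theta> y))) \<partial>lborel) \<le> ennreal ((C + m) * osgood_modulus r)" .
    have "norm (LINT y|lborel. w y *\<^sub>R euler_kernel a (\<psi> y) - w y *\<^sub>R euler_kernel b (\<theta> y)) \<le> (C + m) * osgood_modulus r"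
      by (rule norm_integral_le_nn_integral[OF _ pt nn]) (use eint psi chi C m osg0 in auto)
    then show "norm ((LINT y|lborel. w y *\<^sub>R euler_kernel a (\<psi> y)) - (LINT y|lborel. w y *\<^sub>R euler_kernel b (\<theta> y))) \<le> (C + m) * osgood_modulus r"
      using eint psi chi by simp
  next
    fix \<psi> :: "real^2 \<Rightarrow> real^2" and a and \<alpha> :: real
    assume psi: "\<psi> \<in> measure_preserving_homeos" and \<alpha>: "0 < \<alpha>" "\<alpha> \<le> 1"
    have osg0: "osgood_modulus \<alpha> \<ge> 0" using osgood_modulus_ge[OF \<alpha>] \<alpha> by simp
    have pt: "norm (w y *\<^sub>R vortex_kernel \<alpha> a (\<psi> y) - w y *\<^sub>R euler_kernel a (\<psi> y)) \<le> \<bar>w y\<bar> * g \<alpha> (a - \<psi> y)" for y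
      using euler_vortex_kernel_diff_bound[OF \<alpha>(1), of a "\<psi> y"]
      by (simp add: g_def mult_left_mono norm_minus_commute flip: scaleR_diff_right)
    have "norm (LINT y|lborel. w y *\<^sub>R vortex_kernel \<alpha> a (\<psi> y) - w y *\<^sub>R euler_kernel a (\<psi> y)) \<le> C * osgood_modulus \<alpha>"
      by (rule norm_integral_le_nn_integral[OF _ pt pot[OF psi \<alpha>]]) (use eint vint psi \<alpha> C osg0 in auto)
    also have "\<dots> \<le> (C + m) * osgood_modulus \<alpha>" using m osg0 by (intro mult_right_mono) auto
    finally show "norm ((LINT y|lborel. w y *\<^sub>R vortex_kernel \<alpha> a (\<psi> y)) - (LINT y|lborel. w y *\<^sub>R euler_kernel a (\<psi> y))) \<le> (C + m) * osgood_modulus \<alpha>"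
      using eint vint psi \<alpha> by simp
  qed
qed

section \<open>Velocity convergence at fixed \<alpha>, comparison of the flows, and the choice of
  parameters\<close>

section \<open>Convergence of the flows\<close>

text \<open>At fixed \<alpha> the functions y \<mapsto> K^\<alpha>(a, \<eta>(y, t)) are bounded and
  share a modulus of continuity, composed from those of the kernel and of the flow.\<close>

lemma vortex_velocity_converges:
  fixes w :: "real^2 \<Rightarrow> real"
  assumes w: "integrable lborel w" and q: "\<And>n. signed_measure (q n)"
    and weak: "weakly_converges q (density_measure w)"
    and tv: "(\<lambda>n. tv_norm (q n)) \<longlonglongrightarrow> (LINT x|lborel. \<bar>w x\<bar>)"
    and a: "\<alpha> > 0" and T: "T > 0" and \<epsilon>: "\<epsilon> > 0"
  shows "\<exists>N. \<forall>n\<ge>N. \<forall>\<eta> t a. vortex_flow \<alpha> (q n) \<eta> \<longrightarrow> 0 \<le> t \<longrightarrow> t \<le> T \<longrightarrow>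
    norm (signed_integral (q n) (\<lambda>y. vortex_kernel \<alpha> a (\<eta> y t))
      - (LINT y|lborel. w y *\<^sub>R vortex_kernel \<alpha> a (\<eta> y t))) \<le> \<epsilon>"
proof -
  obtain Q where "\<forall>n. norm (tv_norm (q n)) \<le> Q"
    using convergent_imp_Bseq[OF convergentI[OF tv]] by (rule BseqE)
  then have Q: "tv_norm (q n) \<le> Q" for n by (simp add: abs_le_iff)
  \<comment> \<open>The flows of all signed measures of norm at most Q are included, so that
    \<open>F\<close> does not change with n although the test functions do.\<close>
  define F where "F = {f. \<exists>q \<eta> t a. f = (\<lambda>y. vortex_kernel \<alpha> a (\<eta> y t)) \<and> signed_measure q \<and> tv_norm q \<le> Q \<and>
     vortex_flow \<alpha> q \<eta> \<and> 0 \<le> t \<and> t \<le> T}"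
  have "\<exists>N. \<forall>n\<ge>N. \<forall>f\<in>F. norm (signed_integral (q n) f - (LINT y|lborel. w y *\<^sub>R f y)) \<le> \<epsilon>"
  proof (rule weakly_converges_uniform[OF w q weak tv _ _ \<epsilon>])
    show "norm (f x) \<le> 1 / (2 * pi * \<alpha>)" if "f \<in> F" for f x
      using that norm_vortex_kernel_le[OF a] by (auto simp: F_def)
  next
    fix e :: real assume e: "e > 0"
    obtain K where K: "K > 0" "\<And>r x y x' y'. 0 < r \<Longrightarrow> r \<le> 1 \<Longrightarrow> norm ((x - y) - (x' - y')) \<le> r \<Longrightarrow>
       norm (vortex_kernel \<alpha> x y - vortex_kernel \<alpha> x' y') \<le> K * osgood_modulus r"
      using vortex_kernel_log_lipschitz[OF a] by blast
    have "e / K > 0" using e K(1) by simp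
    then obtain b where b: "b > 0" "b \<le> 1" "\<And>r. 0 < r \<Longrightarrow> r \<le> b \<Longrightarrow> osgood_modulus r < e / K"
      by (rule osgood_modulus_small) blast
    obtain \<delta> where \<delta>: "\<delta> > 0" "\<And>q \<eta> t x y. signed_measure q \<Longrightarrow> tv_norm q \<le> Q \<Longrightarrow> vortex_flow \<alpha> q \<eta> \<Longrightarrow>
        0 \<le> t \<Longrightarrow> t \<le> T \<Longrightarrow> dist x y < \<delta> \<Longrightarrow> norm (\<eta> x t - \<eta> y t) \<le> b"
      using vortex_flow_equicontinuous[OF a T b(1), of Q] by blast
    show "\<exists>\<delta>>0. \<forall>f\<in>F. \<forall>x y. dist x y < \<delta> \<longrightarrow> norm (f x - f y) \<le> e"
    proof (intro exI[of _ \<delta>] conjI ballI allI impI \<delta>(1))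
      fix f and x y :: "real^2" assume "f \<in> F" and xy: "dist x y < \<delta>"
      then obtain q' \<eta> t c where f: "f = (\<lambda>y. vortex_kernel \<alpha> c (\<eta> y t))"
        and *: "signed_measure q'" "tv_norm q' \<le> Q" "vortex_flow \<alpha> q' \<eta>" "0 \<le> t" "t \<le> T"
        by (auto simp: F_def)
      have "norm ((c - \<eta> x t) - (c - \<eta> y t)) \<le> b"
        using \<delta>(2)[OF * xy] by (simp add: norm_minus_commute)
      then have "norm (f x - f y) \<le> K * osgood_modulus b" unfolding f by (intro K b)
      also have "\<dots> \<le> K * (e / K)" using b K(1) by (intro mult_left_mono) (auto intro: less_imp_le)
      finally show "norm (f x - f y) \<le> e" using K(1) by simp
    qed
  qed
  then obtain N where N: "\<And>n f. n \<ge> N \<Longrightarrow> f \<in> F \<Longrightarrow> norm (signed_integral (q n) f - (LINT y|lborel. w y *\<^sub>R f y)) \<le> \<epsilon>"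
    by blast
  show ?thesis
  proof (intro exI[of _ N] allI impI)
    fix n \<eta> t c assume "n \<ge> N" and *: "vortex_flow \<alpha> (q n) \<eta>" "0 \<le> t" "t \<le> T"
    show "norm (signed_integral (q n) (\<lambda>y. vortex_kernel \<alpha> c (\<eta> y t))
      - (LINT y|lborel. w y *\<^sub>R vortex_kernel \<alpha> c (\<eta> y t))) \<le> \<epsilon>"
      by (rule N[OF \<open>n \<ge> N\<close>]) (unfold F_def, use * q Q in blast)
  qed
qed

text \<open>The order of choices matters: first \<delta> from the Osgood comparison, then
  \<open>a0\<close> making the kernel error at most \<delta>, and finally N, depending on \<alpha>,
  making the error of weak convergence at most \<delta>.\<close>

lemma vortex_flow_close_to_euler_flow:
  fixes w :: "real^2 \<Rightarrow> real"
  assumes w: "in_L1_Linf w" and \<eta>: "euler_flow w \<eta>" and q: "\<And>n. signed_measure (q n)"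
    and weak: "weakly_converges q (density_measure w)"
    and tv: "(\<lambda>n. tv_norm (q n)) \<longlonglongrightarrow> (LINT x|lborel. \<bar>w x\<bar>)"
    and T: "T > 0" and \<epsilon>: "\<epsilon> > 0"
  shows "\<exists>a0>0. \<forall>\<alpha>. 0 < \<alpha> \<longrightarrow> \<alpha> \<le> a0 \<longrightarrow> (\<exists>N. \<forall>n\<ge>N. \<forall>\<theta>. vortex_flow \<alpha> (q n) \<theta> \<longrightarrow>
    (\<forall>t\<in>{0..T}. \<forall>x. norm (\<theta> x t - \<eta> x t) \<le> \<epsilon>))"
proof -
  obtain C where C: "C \<ge> 1"
    and bound: "\<And>\<psi> a. \<psi> \<in> measure_preserving_homeos \<Longrightarrow> norm (LINT y|lborel. w y *\<^sub>R euler_kernel a (\<psi> y)) \<le> C"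
    and stab: "\<And>\<psi> \<theta> a b r. \<psi> \<in> measure_preserving_homeos \<Longrightarrow> \<theta> \<in> measure_preserving_homeos \<Longrightarrow> 0 < r \<Longrightarrow> r \<le> 1 \<Longrightarrow>
      norm (a - b) \<le> r \<Longrightarrow> (\<And>y. norm (\<psi> y - \<theta> y) \<le> r) \<Longrightarrow>
      norm ((LINT y|lborel. w y *\<^sub>R euler_kernel a (\<psi> y)) - (LINT y|lborel. w y *\<^sub>R euler_kernel b (\<theta> y))) \<le> C * osgood_modulus r"
    and approx: "\<And>\<psi> a \<alpha>. \<psi> \<in> measure_preserving_homeos \<Longrightarrow> 0 < \<alpha> \<Longrightarrow> \<alpha> \<le> 1 \<Longrightarrow>
      norm ((LINT y|lborel. w y *\<^sub>R vortex_kernel \<alpha> a (\<psi> y)) - (LINT y|lborel. w y *\<^sub>R euler_kernel a (\<psi> y))) \<le> C * osgood_modulus \<alpha>"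
    by (rule euler_velocity_estimates[OF w]) blast
  have C2: "C + 2 > 0" using C by simp
  \<comment> \<open>C comes from the stability of the Euler velocity. The 2 accounts for two errors
    of size \<delta>, each at most \<open>osgood_modulus r\<close> when \<delta> \<le> r \<le>
    1.\<close>
  obtain \<delta> where \<delta>: "0 < \<delta>" "\<delta> \<le> 1" and comparison:
    "\<And>(g :: real^2 \<Rightarrow> real \<Rightarrow> real^2) g' i t.
       osgood_family (C + 2) T \<delta> g g' \<Longrightarrow> 0 \<le> t \<Longrightarrow> t \<le> T \<Longrightarrow> norm (g i t) \<le> \<epsilon>"
    by (rule osgood_comparison[OF C2 T \<epsilon>, where 'i = "real^2" and 'v = "real^2"]) blast
  have "\<delta> / C > 0" using \<delta>(1) C by simp
  then obtain a0 where a0: "a0 > 0" "a0 \<le> 1" "\<And>r. 0 < r \<Longrightarrow> r \<le> a0 \<Longrightarrow> osgood_modulus r < \<delta> / C"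
    by (rule osgood_modulus_small) blast
  have wi: "integrable lborel w" using w by (simp add: in_L1_Linf_def)
  show ?thesis
  proof (intro exI[of _ a0] conjI allI impI a0(1))
    fix \<alpha> assume \<alpha>: "0 < \<alpha>" "\<alpha> \<le> a0"
    obtain N where N: "\<And>n \<eta> t a. n \<ge> N \<Longrightarrow> vortex_flow \<alpha> (q n) \<eta> \<Longrightarrow> 0 \<le> t \<Longrightarrow> t \<le> T \<Longrightarrow>
      norm (signed_integral (q n) (\<lambda>y. vortex_kernel \<alpha> a (\<eta> y t))
        - (LINT y|lborel. w y *\<^sub>R vortex_kernel \<alpha> a (\<eta> y t))) \<le> \<delta>"
      using vortex_velocity_converges[OF wi q weak tv \<alpha>(1) T \<delta>(1)] by blast
    show "\<exists>N. \<forall>n\<ge>N. \<forall>\<theta>. vortex_flow \<alpha> (q n) \<theta> \<longrightarrow> (\<forall>t\<in>{0..T}. \<forall>x. norm (\<theta> x t - \<eta> x t) \<le> \<epsilon>)"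
    proof (intro exI[of _ N] allI impI)
      fix n \<theta> assume n: "n \<ge> N" and \<theta>: "vortex_flow \<alpha> (q n) \<theta>"
      define u where "u x s = (LINT y|lborel. w y *\<^sub>R euler_kernel (\<eta> x s) (\<eta> y s))" for x s
      define v where "v x s = signed_integral (q n) (\<lambda>y. vortex_kernel \<alpha> (\<theta> x s) (\<theta> y s))" for x s
      have mp: "(\<lambda>x. \<eta> x s) \<in> measure_preserving_homeos" "(\<lambda>x. \<theta> x s) \<in> measure_preserving_homeos" if "0 \<le> s" for s
        using \<eta> \<theta> that by (simp_all add: euler_flow_def vortex_flow_def)
      have "osgood_family (C + 2) T \<delta> (\<lambda>x s. \<theta> x s - \<eta> x s) (\<lambda>x s. v x s - u x s)"
        unfolding osgood_family_def
      proof (intro conjI allI ballI impI exI)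
        show "norm (\<theta> x 0 - \<eta> x 0) \<le> \<delta>" for x
          using \<eta> \<theta> \<delta> by (simp add: euler_flow_def vortex_flow_def)
      next
        fix x s assume "s \<in> {0..T}"
        then have s: "0 \<le> s" "s \<le> T" by auto
        show "((\<lambda>s. \<theta> x s - \<eta> x s) has_vector_derivative v x s - u x s) (at s within {0..})"
          using \<eta> \<theta> s unfolding u_def v_def euler_flow_def vortex_flow_def
          by (intro has_vector_derivative_diff) auto
        have "norm (v x s) \<le> 1 / (2 * pi * \<alpha>) * tv_norm (q n)" "norm (u x s) \<le> C"
          unfolding u_def v_def
          by (rule norm_vortex_velocity_le[OF \<alpha>(1) q mp(2)[OF s(1)]], rule bound[OF mp(1)[OF s(1)]])
        then show "norm (v x s - u x s) \<le> 1 / (2 * pi * \<alpha>) * tv_norm (q n) + C"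
          by (intro order_trans[OF norm_triangle_ineq4] add_mono)
      next
        fix x s r assume "s \<in> {0..T}" "r \<in> {\<delta>..1}" and le: "\<forall>j. norm (\<theta> j s - \<eta> j s) \<le> r"
        then have s: "0 \<le> s" "s \<le> T" and r: "\<delta> \<le> r" "r \<le> 1" by auto
        have r0: "r > 0" using \<delta> r by simp
        let ?V = "LINT y|lborel. w y *\<^sub>R vortex_kernel \<alpha> (\<theta> x s) (\<theta> y s)"
        let ?E = "LINT y|lborel. w y *\<^sub>R euler_kernel (\<theta> x s) (\<theta> y s)"
        have "norm (v x s - ?V) \<le> \<delta>" unfolding v_def by (rule N[OF n \<theta> s])
        moreover have "norm (?V - ?E) \<le> \<delta>"
        proof -
          have "norm (?V - ?E) \<le> C * osgood_modulus \<alpha>" using \<alpha> a0(2) by (intro approx mp s) auto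
          also have "\<dots> \<le> C * (\<delta> / C)" using a0(3)[OF \<alpha>] C by (intro mult_left_mono) auto
          finally show ?thesis using C by simp
        qed
        moreover have "norm (?E - u x s) \<le> C * osgood_modulus r"
          unfolding u_def using le by (intro stab mp s r0 r) auto
        moreover have "norm (v x s - u x s) \<le> norm (v x s - ?V) + norm (?V - ?E) + norm (?E - u x s)"
          using norm_triangle_ineq[of "(v x s - ?V) + (?V - ?E)" "?E - u x s"] norm_triangle_ineq[of "v x s - ?V" "?V - ?E"]
          by simp
        ultimately have "norm (v x s - u x s) \<le> \<delta> + \<delta> + C * osgood_modulus r" by linarith
        also have "\<dots> \<le> (C + 2) * osgood_modulus r" using osgood_modulus_ge[OF r0 r(2)] r(1) by (simp add: algebra_simps)
        finally show "norm (v x s - u x s) \<le> (C + 2) * osgood_modulus r" .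
      qed
      then show "\<forall>t\<in>{0..T}. \<forall>x. norm (\<theta> x t - \<eta> x t) \<le> \<epsilon>"
        using comparison[where g = "\<lambda>x s. \<theta> x s - \<eta> x s"] by auto
    qed
  qed
qed

theorem theorem2:
  fixes \<omega>\<^sub>0 :: "real^2 \<Rightarrow> real"
    and \<eta> :: "real^2 \<Rightarrow> real \<Rightarrow> real^2"
    and q\<^sub>0 :: "nat \<Rightarrow> (real^2) set \<Rightarrow> real"
    and T :: real
  assumes "in_L1_Linf \<omega>\<^sub>0"
    and "euler_flow \<omega>\<^sub>0 \<eta>"
    and "\<And>n. signed_measure (q\<^sub>0 n)"
    and "weakly_converges q\<^sub>0 (density_measure \<omega>\<^sub>0)"
    and "(\<lambda>n. tv_norm (q\<^sub>0 n)) \<longlonglongrightarrow> (LINT x|lborel. \<bar>\<omega>\<^sub>0 x\<bar>)"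
    and "T > 0"
  shows "\<exists>\<alpha> :: nat \<Rightarrow> real. (\<forall>n. \<alpha> n > 0) \<and> \<alpha> \<longlonglongrightarrow> 0 \<and>
    (\<forall>\<eta>\<alpha> :: nat \<Rightarrow> real^2 \<Rightarrow> real \<Rightarrow> real^2. (\<forall>n. vortex_flow (\<alpha> n) (q\<^sub>0 n) (\<eta>\<alpha> n)) \<longrightarrow>
       (\<lambda>n. SUP t\<in>{0..T}. SUP x. ennreal (norm (\<eta>\<alpha> n x t - \<eta> x t))) \<longlonglongrightarrow> 0)"
proof -
  \<comment> \<open>Quantifying over all flows inside \<open>P\<close> makes the choice of
    parameters independent of the flows given later.\<close>
  define P where "P \<epsilon> a n \<longleftrightarrow> (\<forall>\<theta>. vortex_flow a (q\<^sub>0 n) \<theta> \<longrightarrow> (\<forall>t\<in>{0..T}. \<forall>x. norm (\<theta> x t - \<eta> x t) \<le> \<epsilon>))"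
    for \<epsilon> a :: real and n :: nat
  have "\<exists>a0>0. \<forall>a. 0 < a \<longrightarrow> a \<le> a0 \<longrightarrow> (\<exists>N. \<forall>n\<ge>N. P \<epsilon> a n)" if "\<epsilon> > 0" for \<epsilon>
    unfolding P_def by (rule vortex_flow_close_to_euler_flow[OF assms that])
  moreover have "P \<epsilon> a n \<Longrightarrow> \<epsilon> \<le> \<epsilon>' \<Longrightarrow> P \<epsilon>' a n" for \<epsilon> \<epsilon>' a n
    unfolding P_def by (meson order_trans)
  ultimately obtain \<alpha> where \<alpha>: "\<And>n. \<alpha> n > 0" "\<alpha> \<longlonglongrightarrow> 0" and P: "\<And>\<epsilon>. \<epsilon> > 0 \<Longrightarrow> \<exists>N. \<forall>n\<ge>N. P \<epsilon> (\<alpha> n) n"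
    by (rule diagonal_sequence[of P]) blast+
  show ?thesis
  proof (intro exI[of _ \<alpha>] conjI allI impI \<alpha>)
    fix \<eta>\<alpha> :: "nat \<Rightarrow> real^2 \<Rightarrow> real \<Rightarrow> real^2"
    assume flow: "\<forall>n. vortex_flow (\<alpha> n) (q\<^sub>0 n) (\<eta>\<alpha> n)"
    show "(\<lambda>n. SUP t\<in>{0..T}. SUP x. ennreal (norm (\<eta>\<alpha> n x t - \<eta> x t))) \<longlonglongrightarrow> 0"
    proof (rule order_tendstoI)
      fix a :: ennreal assume "0 < a"
      \<comment> \<open>Pointwise bounds pass to the supremum only as non-strict inequalities, so an
        intermediate value b is inserted; it is finite because b < a.\<close>
      then obtain b where b: "0 < b" "b < a" using dense by blast
      then obtain \<epsilon> where \<epsilon>: "\<epsilon> > 0" "b = ennreal \<epsilon>"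
        by (cases b) (auto simp: ennreal_less_zero_iff)
      obtain N where N: "\<And>n. n \<ge> N \<Longrightarrow> P \<epsilon> (\<alpha> n) n" using P[OF \<epsilon>(1)] by blast
      have "(SUP t\<in>{0..T}. SUP x. ennreal (norm (\<eta>\<alpha> n x t - \<eta> x t))) \<le> b" if "n \<ge> N" for n
        using N[OF that] flow unfolding P_def \<epsilon>(2) by (intro SUP_least ennreal_leI) auto
      then show "\<forall>\<^sub>F n in sequentially. (SUP t\<in>{0..T}. SUP x. ennreal (norm (\<eta>\<alpha> n x t - \<eta> x t))) < a"
        unfolding eventually_sequentially using b(2) le_less_trans by blast
    qed simp
  qed
qed

end
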